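(* Let $\Gamma$, $\tilde\Gamma$ and $\Gamma_n$ ($n\ge1$) be countable discrete groups, and let $$\Gamma\xleftarrow{\ \varphi\ }\tilde\Gamma\xrightarrow{\ \varphi_n\ }\Gamma_n\qquad(n\ge1)$$ be group homomorphisms with kernels $K=\ker\varphi$ and $K_n=\ker\varphi_n$. Fix $\tilde f\in L^1(\tilde\Gamma)$ and set $f=\varphi_*(\tilde f)\in L^1(\Gamma)$ and $f_n=\varphi_{n*}(\tilde f)\in L^1(\Gamma_n)$. Assume that $K_n\to K$. Then $$\det\nolimits_{\mathcal{N}\Gamma} f\;\ge\;\limsup_{n\to\infty}\det\nolimits_{\mathcal{N}\Gamma_n} f_n ,$$ and if $\tilde f\in L^1(\tilde\Gamma)^\times$, then equality holds in the form $$\det\nolimits_{\mathcal{N}\Gamma} f=\lim_{n\to\infty}\det\nolimits_{\mathcal{N}\Gamma_n} f_n .$$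
   Context: For a discrete group $\Gamma$ and $p=1,2$, elements of $L^p(\Gamma)$ are written as formal series $\sum_{\gamma\in\Gamma} x_\gamma \gamma$ with $x_\gamma\in\mathbb{C}$, $\sum_\gamma |x_\gamma|^p<\infty$. $L^1(\Gamma)$ is a unital Banach $*$-algebra under convolution, and $L^1(\Gamma)^\times$ is its group of units. The von Neumann algebra $\mathcal{N}\Gamma$ is the algebra of bounded operators $A: L^2(\Gamma)\to L^2(\Gamma)$ that commute with left multiplication by every $\gamma\in\Gamma$. Its canonical trace is $\tau_{\mathcal{N}\Gamma}(A) = (A e, e)$, where $e\in\Gamma\subset L^2(\Gamma)$ is the unit element. Fuglede–Kadison determinant: for invertible $A\in\mathcal{N}\Gamma$, $\det_{\mathcal{N}\Gamma}A = \exp \tau_{\mathcal{N}\Gamma}(\log|A|)$ with $|A|=(A^*A)^{1/2}$; for arbitrary $A\in\mathcal{N}\Gamma$, $\det_{\mathcal{N}\Gamma}A=\lim_{\varepsilon\to0+}\det_{\mathcal{N}\Gamma}(|A|+\varepsilon)\in[0,\infty)$. $L^1(\Gamma)$ is viewed as a subalgebra of $\mathcal{N}\Gamma$ via the injective homomorphism $r: L^1(\Gamma)\to\mathcal{N}\Gamma$, $r(\sum_\gamma f_\gamma\gamma)=\sum_\gamma f_\gamma R_{\gamma^{-1}}$, where $R_\gamma(x)=x\gamma$ on $L^2(\Gamma)$. So $\det_{\mathcal{N}\Gamma} f$ means $\det_{\mathcal{N}\Gamma} r(f)$ for $f\in L^1(\Gamma)$. For a homomorphism $\varphi:\Gamma\to\Gamma'$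 of discrete groups, $\varphi_*:L^1(\Gamma)\to L^1(\Gamma')$ is defined by $\varphi_*(\sum_\gamma f_\gamma\gamma)=\sum_\gamma f_\gamma\varphi(\gamma)$. For normal subgroups $K$, $K_n$ of $\tilde\Gamma$, $K_n\to K$ means that no element of $\tilde\Gamma$ is contained in the symmetric difference $K\bigtriangleup K_n$ for infinitely many $n$; equivalently, for every finite subset $Q\subset\tilde\Gamma$ one has $(K\bigtriangleup K_n)\cap Q=\emptyset$ for all sufficiently large $n$. *)

theory Defs
  imports "HOL-Analysis.Analysis" "HOL-Algebra.Coset"
begin

text \<open>
  A formal series \<open>\<Sum>\<gamma>. x\<^sub>\<gamma> \<gamma>\<close> over a group \<open>G\<close> is a function \<open>x\<close> on the
  underlying type that vanishes outside \<open>carrier G\<close>.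
\<close>

definition group_l1 :: "('a, 'm) monoid_scheme \<Rightarrow> ('a \<Rightarrow> complex) set" where
  "group_l1 G = {x. (\<forall>g. g \<notin> carrier G \<longrightarrow> x g = 0) \<and> (\<lambda>g. cmod (x g)) summable_on carrier G}"

definition group_l2 :: "('a, 'm) monoid_scheme \<Rightarrow> ('a \<Rightarrow> complex) set" where
  "group_l2 G = {x. (\<forall>g. g \<notin> carrier G \<longrightarrow> x g = 0) \<and> (\<lambda>g. (cmod (x g))\<^sup>2) summable_on carrier G}"

definition unit_series :: "('a, 'm) monoid_scheme \<Rightarrow> 'a \<Rightarrow> complex" where
  "unit_series G = (\<lambda>g. if g = \<one>\<^bsub>G\<^esub> then 1 else 0)"

definition convolution ::
  "('a, 'm) monoid_scheme \<Rightarrow> ('a \<Rightarrow> complex) \<Rightarrow> ('a \<Rightarrow> complex) \<Rightarrow> 'a \<Rightarrow> complex" where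
  "convolution G x y =
     (\<lambda>g. if g \<in> carrier G then \<Sum>\<^sub>\<infinity>h\<in>carrier G. x h * y (inv\<^bsub>G\<^esub> h \<otimes>\<^bsub>G\<^esub> g) else 0)"

definition l1_monoid :: "('a, 'm) monoid_scheme \<Rightarrow> ('a \<Rightarrow> complex) monoid" where
  "l1_monoid G = \<lparr>carrier = group_l1 G, mult = convolution G, one = unit_series G\<rparr>"

definition push_forward ::
  "('a, 'm) monoid_scheme \<Rightarrow> ('a \<Rightarrow> 'b) \<Rightarrow> ('a \<Rightarrow> complex) \<Rightarrow> 'b \<Rightarrow> complex" where
  "push_forward G \<phi> x = (\<lambda>g'. \<Sum>\<^sub>\<infinity>g\<in>{g \<in> carrier G. \<phi> g = g'}. x g)"

definition l2_inner ::
  "('a, 'm) monoid_scheme \<Rightarrow> ('a \<Rightarrow> complex) \<Rightarrow> ('a \<Rightarrow> complex) \<Rightarrow> complex" where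
  "l2_inner G x y = (\<Sum>\<^sub>\<infinity>g\<in>carrier G. x g * cnj (y g))"

definition l2_norm :: "('a, 'm) monoid_scheme \<Rightarrow> ('a \<Rightarrow> complex) \<Rightarrow> real" where
  "l2_norm G x = sqrt (\<Sum>\<^sub>\<infinity>g\<in>carrier G. (cmod (x g))\<^sup>2)"

definition left_translate ::
  "('a, 'm) monoid_scheme \<Rightarrow> 'a \<Rightarrow> ('a \<Rightarrow> complex) \<Rightarrow> 'a \<Rightarrow> complex" where
  "left_translate G h x = (\<lambda>g. if g \<in> carrier G then x (inv\<^bsub>G\<^esub> h \<otimes>\<^bsub>G\<^esub> g) else 0)"

definition right_translate ::
  "('a, 'm) monoid_scheme \<Rightarrow> 'a \<Rightarrow> ('a \<Rightarrow> complex) \<Rightarrow> 'a \<Rightarrow> complex" where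
  "right_translate G h x = (\<lambda>g. if g \<in> carrier G then x (g \<otimes>\<^bsub>G\<^esub> inv\<^bsub>G\<^esub> h) else 0)"

type_synonym 'a l2_op = "('a \<Rightarrow> complex) \<Rightarrow> ('a \<Rightarrow> complex)"

text \<open>
  Operators are extensional functions on \<open>group_l2 G\<close> (value \<open>undefined\<close> outside), so that
  equality of operators is HOL equality.
\<close>

definition bounded_ops :: "('a, 'm) monoid_scheme \<Rightarrow> 'a l2_op set" where
  "bounded_ops G = {A \<in> group_l2 G \<rightarrow>\<^sub>E group_l2 G.
     (\<forall>x\<in>group_l2 G. \<forall>y\<in>group_l2 G. A (\<lambda>g. x g + y g) = (\<lambda>g. A x g + A y g)) \<and>
     (\<forall>c. \<forall>x\<in>group_l2 G. A (\<lambda>g. c * x g) = (\<lambda>g. c * A x g)) \<and>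
     (\<exists>C. \<forall>x\<in>group_l2 G. l2_norm G (A x) \<le> C * l2_norm G x)}"

definition group_vN :: "('a, 'm) monoid_scheme \<Rightarrow> 'a l2_op set" where
  "group_vN G = {A \<in> bounded_ops G. \<forall>h\<in>carrier G. \<forall>x\<in>group_l2 G.
     A (left_translate G h x) = left_translate G h (A x)}"

definition vN_monoid :: "('a, 'm) monoid_scheme \<Rightarrow> 'a l2_op monoid" where
  "vN_monoid G = \<lparr>carrier = group_vN G, mult = compose (group_l2 G), one = (\<lambda>x\<in>group_l2 G. x)\<rparr>"

definition vN_trace :: "('a, 'm) monoid_scheme \<Rightarrow> 'a l2_op \<Rightarrow> complex" where
  "vN_trace G A = l2_inner G (A (unit_series G)) (unit_series G)"

definition op_norm :: "('a, 'm) monoid_scheme \<Rightarrow> 'a l2_op \<Rightarrow> real" where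
  "op_norm G A = (SUP x\<in>{x \<in> group_l2 G. l2_norm G x \<le> 1}. l2_norm G (A x))"

definition op_minus :: "('a, 'm) monoid_scheme \<Rightarrow> 'a l2_op \<Rightarrow> 'a l2_op \<Rightarrow> 'a l2_op" where
  "op_minus G A B = (\<lambda>x\<in>group_l2 G. \<lambda>g. A x g - B x g)"

definition op_plus_scalar :: "('a, 'm) monoid_scheme \<Rightarrow> 'a l2_op \<Rightarrow> complex \<Rightarrow> 'a l2_op" where
  "op_plus_scalar G A c = (\<lambda>x\<in>group_l2 G. \<lambda>g. A x g + c * x g)"

definition op_poly :: "('a, 'm) monoid_scheme \<Rightarrow> real poly \<Rightarrow> 'a l2_op \<Rightarrow> 'a l2_op" where
  "op_poly G p A = (\<lambda>x\<in>group_l2 G. \<lambda>g. \<Sum>i\<le>degree p. of_real (coeff p i) * (A ^^ i) x g)"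

definition op_adjoint :: "('a, 'm) monoid_scheme \<Rightarrow> 'a l2_op \<Rightarrow> 'a l2_op" where
  "op_adjoint G A = (THE B. B \<in> group_vN G \<and>
     (\<forall>x\<in>group_l2 G. \<forall>y\<in>group_l2 G. l2_inner G (A x) y = l2_inner G x (B y)))"

definition op_spectrum :: "('a, 'm) monoid_scheme \<Rightarrow> 'a l2_op \<Rightarrow> complex set" where
  "op_spectrum G A = {z. op_plus_scalar G A (- z) \<notin> Units (vN_monoid G)}"

text \<open>
  Continuous functional calculus \<open>u(A)\<close> for self-adjoint \<open>A\<close> and real \<open>u\<close> continuous on the
  spectrum (a compact subset of the real line): the operator to which \<open>p\<^sub>n(A)\<close> converges in
  norm whenever the polynomials \<open>p\<^sub>n\<close> converge to \<open>u\<close> uniformly on the spectrum. Such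
  polynomials exist by the Weierstrass theorem, so the operator is unique.
\<close>

definition func_calc :: "('a, 'm) monoid_scheme \<Rightarrow> (real \<Rightarrow> real) \<Rightarrow> 'a l2_op \<Rightarrow> 'a l2_op" where
  "func_calc G u A = (THE B. B \<in> group_vN G \<and>
     (\<forall>p :: nat \<Rightarrow> real poly.
        uniform_limit {t. complex_of_real t \<in> op_spectrum G A} (\<lambda>n. poly (p n)) u sequentially \<longrightarrow>
        (\<lambda>n. op_norm G (op_minus G (op_poly G (p n) A) B)) \<longlonglongrightarrow> 0))"

definition op_abs :: "('a, 'm) monoid_scheme \<Rightarrow> 'a l2_op \<Rightarrow> 'a l2_op" where
  "op_abs G A = func_calc G sqrt (compose (group_l2 G) (op_adjoint G A) A)"

text \<open>
  The trace of a self-adjoint operator is real, so taking the real part below only changes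
  the type.
\<close>

definition fk_det_invertible :: "('a, 'm) monoid_scheme \<Rightarrow> 'a l2_op \<Rightarrow> real" where
  "fk_det_invertible G A = exp (Re (vN_trace G (func_calc G ln (op_abs G A))))"

definition fk_det :: "('a, 'm) monoid_scheme \<Rightarrow> 'a l2_op \<Rightarrow> real" where
  "fk_det G A =
     Lim (at_right 0) (\<lambda>\<epsilon>. fk_det_invertible G (op_plus_scalar G (op_abs G A) (complex_of_real \<epsilon>)))"

definition l1_rep :: "('a, 'm) monoid_scheme \<Rightarrow> ('a \<Rightarrow> complex) \<Rightarrow> 'a l2_op" where
  "l1_rep G f = (\<lambda>x\<in>group_l2 G. \<lambda>g.
     \<Sum>\<^sub>\<infinity>h\<in>carrier G. f h * right_translate G (inv\<^bsub>G\<^esub> h) x g)"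

definition sets_converge_on :: "'a set \<Rightarrow> (nat \<Rightarrow> 'a set) \<Rightarrow> 'a set \<Rightarrow> bool" where
  "sets_converge_on X Kn K \<longleftrightarrow> (\<forall>g\<in>X. \<not> (\<exists>\<^sub>\<infinity>n. g \<in> sym_diff K (Kn n)))"

end

theory Submission
  imports Defs "HOL-Library.Function_Algebras" "HOL-Computational_Algebra.Fundamental_Theorem_Algebra"
begin

text \<open>
  Let \<open>S = r(f)\<^sup>* r(f)\<close> and \<open>S\<^sub>n = r(f\<^sub>n)\<^sup>* r(f\<^sub>n)\<close>; all their spectra lie in \<open>[0, M]\<close> with \<open>M\<close> the square
  of the \<open>L\<^sup>1\<close>-norm of the series upstairs. The trace of the \<open>k\<close>-th power of \<open>S\<close> (of \<open>S\<^sub>n\<close>) is the sum over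
  \<open>K\<close> (over \<open>K\<^sub>n\<close>) of one and the same \<open>L\<^sup>1\<close>-series, so the moments converge by dominated convergence, and
  by the Weierstrass theorem the traces of \<open>u(S\<^sub>n)\<close> converge to that of \<open>u(S)\<close> for every continuous \<open>u\<close>
  on \<open>[0, M]\<close>. With \<open>u(s) = ln (\<surd>s + \<epsilon>)\<close> this says that \<open>det (\<bar>A\<^sub>n\<bar> + \<epsilon>)\<close> converges for each fixed \<open>\<epsilon> > 0\<close>.
  These determinants decrease to \<open>det A\<^sub>n\<close> as \<open>\<epsilon>\<close> decreases to \<open>0\<close>, which gives the upper bound on the
  limes superior. If the series upstairs is invertible, then all \<open>S\<^sub>n \<ge> c\<close> for one \<open>c > 0\<close>, hence
  \<open>det (\<bar>A\<^sub>n\<bar> + \<epsilon>) \<le> exp (\<epsilon> / \<surd>c) det A\<^sub>n\<close> uniformly in \<open>n\<close>, and the two limits may be exchanged.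
\<close>

text \<open>The operators \<open>S\<close> and \<open>S_n\<close> act on different Hilbert spaces,
  so they cannot be compared as operators; only numbers attached to them, the traces of polynomials,
  can converge. The logarithm is unbounded at 0, and the shift by \<epsilon> removes this at the
  price of a second limit. An infimum of convergent families is only upper semicontinuous, which is
  why the general statement is one-sided.

  Much of the work lies in the continuous calculus. \<open>func_calc\<close> describes its value by
  all polynomial sequences converging uniformly on the spectrum, which may be much smaller than the
  interval of the Weierstrass theorem, so the norm of \<open>p(A)\<close> has to be bounded by the
  values of \<open>p\<close> on the spectrum itself. As the polynomials are real, factoring over the
  reals suffices: a linear factor is invertible when its root is off the spectrum, a quadratic
  factor without real roots is always invertible, and non-real points of the spectrum never have to
  be discussed.\<close>

section \<open>Linear structure on formal series\<close>

definition scale_series :: "complex \<Rightarrow> ('a \<Rightarrow> complex) \<Rightarrow> 'a \<Rightarrow> complex" (infixr "*\<^sub>c" 75) where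
  "c *\<^sub>c x = (\<lambda>g. c * x g)"

lemma scale_series_apply [simp]: "(c *\<^sub>c x) g = c * x g"
  by (simp add: scale_series_def)

lemma scale_series_simps [simp]:
  "0 *\<^sub>c x = 0" "c *\<^sub>c 0 = 0" "1 *\<^sub>c x = x" "a *\<^sub>c b *\<^sub>c x = (a * b) *\<^sub>c x"
  by (auto simp: fun_eq_iff)

lemma scale_series_distrib:
  "c *\<^sub>c (x + y) = c *\<^sub>c x + c *\<^sub>c y" "c *\<^sub>c (x - y) = c *\<^sub>c x - c *\<^sub>c y"
  "(a + b) *\<^sub>c x = a *\<^sub>c x + b *\<^sub>c x" "(a - b) *\<^sub>c x = a *\<^sub>c x - b *\<^sub>c x"
  by (auto simp: fun_eq_iff algebra_simps)

lemma diff_conv_scale: "x - y = x + (-1) *\<^sub>c y"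
  by (simp add: fun_eq_iff)

section \<open>Square-summable series\<close>

text \<open>The terms are nonnegative, so one bound on the finite partial sums yields summability
  and the norm estimate together.\<close>

lemma group_l2I:
  assumes "\<And>g. g \<notin> carrier G \<Longrightarrow> x g = 0" "0 \<le> C"
    and "\<And>F. finite F \<Longrightarrow> F \<subseteq> carrier G \<Longrightarrow> (\<Sum>g\<in>F. (cmod (x g))\<^sup>2) \<le> C\<^sup>2"
  shows "x \<in> group_l2 G" "l2_norm G x \<le> C"
proof -
  have s: "(\<lambda>g. (cmod (x g))\<^sup>2) summable_on carrier G"
    using assms(3) by (intro nonneg_bdd_above_summable_on bdd_aboveI2[where M="C\<^sup>2"]) auto
  then show "x \<in> group_l2 G"
    using assms(1) by (auto simp: group_l2_def)
  have "(\<Sum>\<^sub>\<infinity>g\<in>carrier G. (cmod (x g))\<^sup>2) \<le> C\<^sup>2"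
    using s assms(3) by (intro infsum_le_finite_sums) auto
  then show "l2_norm G x \<le> C"
    unfolding l2_norm_def using assms(2) by (simp add: real_le_lsqrt)
qed

lemma l2_norm_nonneg [simp]: "0 \<le> l2_norm G x"
  by (simp add: l2_norm_def infsum_nonneg)

lemma l2_norm_sq: "(l2_norm G x)\<^sup>2 = (\<Sum>\<^sub>\<infinity>g\<in>carrier G. (cmod (x g))\<^sup>2)"
  by (simp add: l2_norm_def infsum_nonneg)

lemma sum_sq_le_l2_norm:
  assumes "x \<in> group_l2 G" "finite F" "F \<subseteq> carrier G"
  shows "(\<Sum>g\<in>F. (cmod (x g))\<^sup>2) \<le> (l2_norm G x)\<^sup>2"
  using assms unfolding l2_norm_sq by (intro finite_sum_le_infsum) (auto simp: group_l2_def)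

lemma l2_outside: "x \<in> group_l2 G \<Longrightarrow> g \<notin> carrier G \<Longrightarrow> x g = 0"
  by (simp add: group_l2_def)

lemma cmod_le_l2_norm:
  assumes "x \<in> group_l2 G"
  shows "cmod (x g) \<le> l2_norm G x"
proof (cases "g \<in> carrier G")
  case True
  have "(cmod (x g))\<^sup>2 \<le> (l2_norm G x)\<^sup>2"
    using sum_sq_le_l2_norm[OF assms, of "{g}"] True by simp
  then show ?thesis by (simp add: power2_le_iff_abs_le)
qed (use assms in \<open>simp add: l2_outside\<close>)

lemma l2_norm_eq_0: "x \<in> group_l2 G \<Longrightarrow> l2_norm G x = 0 \<Longrightarrow> x = 0"
  using cmod_le_l2_norm[of x G] by (auto simp: fun_eq_iff)

lemma l2_zero [simp]: "0 \<in> group_l2 G" "l2_norm G 0 = 0"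
  by (auto simp: group_l2_def l2_norm_def)

lemma l2_scale [simp]:
  assumes "x \<in> group_l2 G"
  shows "c *\<^sub>c x \<in> group_l2 G"
  using assms by (auto simp: group_l2_def norm_mult power_mult_distrib intro!: summable_on_cmult_right)

lemma l2_norm_scale [simp]: "l2_norm G (c *\<^sub>c x) = cmod c * l2_norm G x"
  by (simp add: l2_norm_def norm_mult power_mult_distrib infsum_cmult_right' real_sqrt_mult)

lemma l2_add [simp]:
  assumes "x \<in> group_l2 G" "y \<in> group_l2 G"
  shows "x + y \<in> group_l2 G"
proof -
  have b: "(cmod (a + b))\<^sup>2 \<le> 2 * (cmod a)\<^sup>2 + 2 * (cmod b)\<^sup>2" for a b :: complex
  proof -
    have "(cmod (a + b))\<^sup>2 \<le> (cmod a + cmod b)\<^sup>2"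
      by (simp add: norm_triangle_ineq power_mono)
    also have "\<dots> \<le> 2 * (cmod a)\<^sup>2 + 2 * (cmod b)\<^sup>2"
      using sum_squares_bound[of "cmod a" "cmod b"] by (simp add: power2_sum)
    finally show ?thesis .
  qed
  have "(\<lambda>g. 2 * (cmod (x g))\<^sup>2 + 2 * (cmod (y g))\<^sup>2) summable_on carrier G"
    using assms by (intro summable_on_add summable_on_cmult_right) (auto simp: group_l2_def)
  then have "(\<lambda>g. (cmod (x g + y g))\<^sup>2) summable_on carrier G"
    by (rule summable_on_comparison_test) (auto simp: b)
  then show ?thesis
    using assms by (auto simp: group_l2_def)
qed

lemma l2_diff [simp]:
  assumes "x \<in> group_l2 G" "y \<in> group_l2 G"
  shows "x - y \<in> group_l2 G"
  using assms by (simp add: diff_conv_scale)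

lemma l2_inner_abs_summable:
  assumes "x \<in> group_l2 G" "y \<in> group_l2 G"
  shows "(\<lambda>g. norm (x g * cnj (y g))) summable_on carrier G"
proof (rule summable_on_comparison_test)
  show "(\<lambda>g. (cmod (x g))\<^sup>2 + (cmod (y g))\<^sup>2) summable_on carrier G"
    using assms by (intro summable_on_add) (auto simp: group_l2_def)
  fix g
  have "0 \<le> cmod (x g) * cmod (y g)" by simp
  then show "norm (x g * cnj (y g)) \<le> (cmod (x g))\<^sup>2 + (cmod (y g))\<^sup>2"
    using sum_squares_bound[of "cmod (x g)" "cmod (y g)"] by (simp only: norm_mult complex_mod_cnj)
qed auto

lemmas l2_inner_summable = abs_summable_summable[OF l2_inner_abs_summable]

lemma l2_inner_add_left:
  assumes "x \<in> group_l2 G" "y \<in> group_l2 G" "z \<in> group_l2 G"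
  shows "l2_inner G (x + y) z = l2_inner G x z + l2_inner G y z"
  unfolding l2_inner_def using assms l2_inner_summable
  by (subst infsum_add[symmetric]) (auto simp: algebra_simps)

lemma l2_inner_scale_left: "l2_inner G (c *\<^sub>c x) z = c * l2_inner G x z"
  by (simp add: l2_inner_def mult.assoc infsum_cmult_right')

lemma l2_inner_commute: "l2_inner G x y = cnj (l2_inner G y x)"
  unfolding l2_inner_def infsum_cnj[symmetric] by (simp add: mult.commute)

lemma l2_inner_diff_left:
  assumes "x \<in> group_l2 G" "y \<in> group_l2 G" "z \<in> group_l2 G"
  shows "l2_inner G (x - y) z = l2_inner G x z - l2_inner G y z"
  using assms by (simp add: diff_conv_scale l2_inner_add_left l2_inner_scale_left)

lemma l2_inner_add_right:
  assumes "x \<in> group_l2 G" "y \<in> group_l2 G" "z \<in> group_l2 G"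
  shows "l2_inner G z (x + y) = l2_inner G z x + l2_inner G z y"
  using l2_inner_add_left[OF assms] by (metis complex_cnj_add l2_inner_commute)

lemma l2_inner_diff_right:
  assumes "x \<in> group_l2 G" "y \<in> group_l2 G" "z \<in> group_l2 G"
  shows "l2_inner G z (x - y) = l2_inner G z x - l2_inner G z y"
  using l2_inner_diff_left[OF assms] by (metis complex_cnj_diff l2_inner_commute)

lemma l2_inner_scale_right: "l2_inner G x (c *\<^sub>c y) = cnj c * l2_inner G x y"
  by (metis complex_cnj_mult l2_inner_commute l2_inner_scale_left)

lemmas l2_inner_simps = l2_inner_add_left l2_inner_diff_left l2_inner_add_right
  l2_inner_diff_right l2_inner_scale_left l2_inner_scale_right

lemma l2_inner_self:
  assumes "x \<in> group_l2 G"
  shows "l2_inner G x x = of_real ((l2_norm G x)\<^sup>2)"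
proof -
  have *: "x g * cnj (x g) = of_real ((cmod (x g))\<^sup>2)" for g
    by (rule complex_norm_square[symmetric])
  have "(\<lambda>g. (cmod (x g))\<^sup>2) summable_on carrier G"
    using assms by (simp add: group_l2_def)
  then show ?thesis unfolding l2_inner_def l2_norm_sq *
    by (intro infsumI has_sum_of_real has_sum_infsum)
qed

lemma Re_l2_inner_commute: "Re (l2_inner G x y) = Re (l2_inner G y x)"
  by (subst l2_inner_commute) simp

lemma l2_norm_add_sq:
  assumes "x \<in> group_l2 G" "y \<in> group_l2 G"
  shows "(l2_norm G (x + y))\<^sup>2 = (l2_norm G x)\<^sup>2 + 2 * Re (l2_inner G x y) + (l2_norm G y)\<^sup>2"
proof -
  have "of_real ((l2_norm G (x + y))\<^sup>2) = l2_inner G (x + y) (x + y)"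
    using assms by (simp only: l2_inner_self l2_add)
  also have "\<dots> = l2_inner G x x + l2_inner G x y + l2_inner G y x + l2_inner G y y"
    using assms by (simp add: l2_inner_simps)
  finally have "Re (of_real ((l2_norm G (x + y))\<^sup>2)) = Re \<dots>" by simp
  then show ?thesis
    using Re_l2_inner_commute[of G x y] assms by (simp add: l2_inner_self)
qed

lemma l2_norm_diff_sq:
  assumes "x \<in> group_l2 G" "y \<in> group_l2 G"
  shows "(l2_norm G (x - y))\<^sup>2 = (l2_norm G x)\<^sup>2 - 2 * Re (l2_inner G x y) + (l2_norm G y)\<^sup>2"
  using assms by (simp add: diff_conv_scale l2_norm_add_sq l2_inner_scale_right)

lemma Re_l2_inner_le:
  assumes "x \<in> group_l2 G" "y \<in> group_l2 G"
  shows "Re (l2_inner G x y) \<le> l2_norm G x * l2_norm G y"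
proof (cases "l2_norm G x = 0 \<or> l2_norm G y = 0")
  case True
  then have "x = 0 \<or> y = 0" using assms l2_norm_eq_0 by blast
  then show ?thesis by (auto simp: l2_inner_def)
next
  case False
  let ?a = "l2_norm G x" and ?b = "l2_norm G y"
  have p: "0 < ?a * ?b" using False by (simp add: less_le)
  \<comment> \<open>Each vector is scaled by the norm of the other, which makes the norms equal;
    expanding the square gives the claim up to the positive factor \<open>?a * ?b\<close>.\<close>
  have "0 \<le> (l2_norm G (of_real ?b *\<^sub>c x - of_real ?a *\<^sub>c y))\<^sup>2" by simp
  also have "\<dots> = 2 * (?a * ?b) * (?a * ?b) - 2 * (?a * ?b) * Re (l2_inner G x y)"
    using assms
    by (simp add: l2_norm_diff_sq l2_inner_simps power_mult_distrib)
       (simp add: power2_eq_square algebra_simps)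
  finally have "(?a * ?b) * Re (l2_inner G x y) \<le> (?a * ?b) * (?a * ?b)" by simp
  then show ?thesis using p by (simp only: mult_le_cancel_left_pos)
qed

lemma l2_inner_Cauchy_Schwarz:
  assumes "x \<in> group_l2 G" "y \<in> group_l2 G"
  shows "cmod (l2_inner G x y) \<le> l2_norm G x * l2_norm G y"
proof (cases "l2_inner G x y = 0")
  case False
  \<comment> \<open>Multiplication by \<open>c\<close>, of modulus one, rotates the inner product to
    its modulus, so the bound on real parts applies to \<open>c *\<^sub>c x\<close>.\<close>
  define c where "c = cnj (sgn (l2_inner G x y))"
  have "cmod c = 1" using False by (simp add: c_def norm_sgn)
  have "c * l2_inner G x y = of_real (cmod (l2_inner G x y))"
    using False unfolding c_def
    by (simp add: sgn_div_norm divide_simps scaleR_conv_of_real complex_norm_square[symmetric]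
        power2_eq_square mult.commute)
  then have "cmod (l2_inner G x y) = Re (l2_inner G (c *\<^sub>c x) y)"
    by (simp add: l2_inner_scale_left)
  also have "\<dots> \<le> l2_norm G (c *\<^sub>c x) * l2_norm G y"
    using assms by (intro Re_l2_inner_le) auto
  finally show ?thesis using \<open>cmod c = 1\<close> by simp
qed simp

lemma l2_norm_triangle:
  assumes "x \<in> group_l2 G" "y \<in> group_l2 G"
  shows "l2_norm G (x + y) \<le> l2_norm G x + l2_norm G y"
proof (rule power2_le_imp_le)
  show "(l2_norm G (x + y))\<^sup>2 \<le> (l2_norm G x + l2_norm G y)\<^sup>2"
    using assms Re_l2_inner_le[OF assms] by (simp add: l2_norm_add_sq power2_sum)
qed simp

lemma l2_norm_minus_commute: "l2_norm G (x - y) = l2_norm G (y - x)"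
proof -
  have "x - y = (-1) *\<^sub>c (y - x)" by (simp add: fun_eq_iff)
  then show ?thesis by (metis l2_norm_scale mult_1 norm_minus_cancel norm_one)
qed

lemma l2_norm_triangle_diff:
  assumes "x \<in> group_l2 G" "y \<in> group_l2 G" "z \<in> group_l2 G"
  shows "l2_norm G (x - z) \<le> l2_norm G (x - y) + l2_norm G (y - z)"
  using l2_norm_triangle[of "x - y" G "y - z"] assms by simp

text \<open>Fatou's lemma for coefficientwise limits: each finite partial sum passes to the limit.
  The filter is arbitrary because the lemma serves both for sequences of operators and for partial
  sums indexed by the finite subsets of a group.\<close>

lemma l2_norm_le_limit:
  fixes X :: "'i \<Rightarrow> 'a \<Rightarrow> complex"
  assumes "F \<noteq> bot" "\<forall>\<^sub>F i in F. X i \<in> group_l2 G \<and> l2_norm G (X i) \<le> C" "0 \<le> C"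
    and "\<And>g. g \<in> carrier G \<Longrightarrow> ((\<lambda>i. X i g) \<longlongrightarrow> x g) F" "\<And>g. g \<notin> carrier G \<Longrightarrow> x g = 0"
  shows "x \<in> group_l2 G" "l2_norm G x \<le> C"
proof -
  have *: "(\<Sum>g\<in>Q. (cmod (x g))\<^sup>2) \<le> C\<^sup>2" if "finite Q" "Q \<subseteq> carrier G" for Q
  proof (rule tendsto_upperbound[OF _ _ assms(1)])
    show "((\<lambda>i. \<Sum>g\<in>Q. (cmod (X i g))\<^sup>2) \<longlongrightarrow> (\<Sum>g\<in>Q. (cmod (x g))\<^sup>2)) F"
      using that assms(4) by (intro tendsto_intros) auto
    show "\<forall>\<^sub>F i in F. (\<Sum>g\<in>Q. (cmod (X i g))\<^sup>2) \<le> C\<^sup>2"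
      using assms(2)
    proof eventually_elim
      case (elim i)
      then have "(\<Sum>g\<in>Q. (cmod (X i g))\<^sup>2) \<le> (l2_norm G (X i))\<^sup>2"
        using that by (intro sum_sq_le_l2_norm) auto
      also have "\<dots> \<le> C\<^sup>2" using elim by (intro power_mono) auto
      finally show ?case .
    qed
  qed
  show "x \<in> group_l2 G" "l2_norm G x \<le> C"
    using group_l2I[OF assms(5,3) *] by auto
qed

text \<open>From here on series are treated as vectors: equations between them are opened at a group
  element only where \<open>pointwise\<close> is given explicitly.\<close>

lemmas pointwise = fun_eq_iff plus_fun_apply minus_apply zero_fun_apply scale_series_apply

declare plus_fun_apply [simp del] minus_apply [simp del] zero_fun_apply [simp del] scale_series_apply [simp del]

section \<open>Operators in the group von Neumann algebra\<close>

lemma group_vNI: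
  assumes "A \<in> extensional (group_l2 G)" "\<And>x. x \<in> group_l2 G \<Longrightarrow> A x \<in> group_l2 G"
    and "\<And>x y. x \<in> group_l2 G \<Longrightarrow> y \<in> group_l2 G \<Longrightarrow> A (x + y) = A x + A y"
    and "\<And>c x. x \<in> group_l2 G \<Longrightarrow> A (c *\<^sub>c x) = c *\<^sub>c A x"
    and "\<And>x. x \<in> group_l2 G \<Longrightarrow> l2_norm G (A x) \<le> C * l2_norm G x"
    and "\<And>h x. h \<in> carrier G \<Longrightarrow> x \<in> group_l2 G \<Longrightarrow> A (left_translate G h x) = left_translate G h (A x)"
  shows "A \<in> group_vN G"
proof -
  have "\<exists>C. \<forall>x\<in>group_l2 G. l2_norm G (A x) \<le> C * l2_norm G x"
    using assms(5) by blast
  then show ?thesis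
    using assms(1-4,6) unfolding group_vN_def bounded_ops_def plus_fun_def scale_series_def
    by (auto simp: PiE_def)
qed

context
  fixes G :: "('a, 'm) monoid_scheme" and A :: "'a l2_op"
  assumes A: "A \<in> group_vN G"
begin

lemma vN_extensional: "A \<in> extensional (group_l2 G)"
  using A by (auto simp: group_vN_def bounded_ops_def PiE_def)

lemma vN_closed [simp]: "x \<in> group_l2 G \<Longrightarrow> A x \<in> group_l2 G"
  using A by (auto simp: group_vN_def bounded_ops_def)

lemma vN_add: "x \<in> group_l2 G \<Longrightarrow> y \<in> group_l2 G \<Longrightarrow> A (x + y) = A x + A y"
  using A unfolding group_vN_def bounded_ops_def plus_fun_def by auto

lemma vN_scale: "x \<in> group_l2 G \<Longrightarrow> A (c *\<^sub>c x) = c *\<^sub>c A x"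
  using A unfolding group_vN_def bounded_ops_def scale_series_def by auto

lemma vN_diff: "x \<in> group_l2 G \<Longrightarrow> y \<in> group_l2 G \<Longrightarrow> A (x - y) = A x - A y"
  by (simp add: diff_conv_scale vN_add vN_scale)

lemma vN_zero: "A 0 = 0"
  using vN_scale[of 0 0] by simp

lemma vN_left_translate:
  "h \<in> carrier G \<Longrightarrow> x \<in> group_l2 G \<Longrightarrow> A (left_translate G h x) = left_translate G h (A x)"
  using A by (auto simp: group_vN_def)

text \<open>The supremum in \<open>op_norm\<close> is taken in the reals, so it carries information
  only for a bounded set; boundedness of the operator enters here.\<close>

lemma op_norm_bdd: "bdd_above ((\<lambda>y. l2_norm G (A y)) ` {y \<in> group_l2 G. l2_norm G y \<le> 1})"
proof -
  obtain C where C: "\<And>y. y \<in> group_l2 G \<Longrightarrow> l2_norm G (A y) \<le> C * l2_norm G y"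
    using A unfolding group_vN_def bounded_ops_def by blast
  show ?thesis
  proof (intro bdd_aboveI2[where M="\<bar>C\<bar>"])
    fix y assume y: "y \<in> {y \<in> group_l2 G. l2_norm G y \<le> 1}"
    then have "l2_norm G (A y) \<le> C * l2_norm G y" using C by blast
    also have "\<dots> \<le> \<bar>C\<bar> * 1" using y by (intro mult_mono) auto
    finally show "l2_norm G (A y) \<le> \<bar>C\<bar>" by simp
  qed
qed

lemma l2_norm_le_op_norm:
  "y \<in> group_l2 G \<Longrightarrow> l2_norm G y \<le> 1 \<Longrightarrow> l2_norm G (A y) \<le> op_norm G A"
  unfolding op_norm_def using op_norm_bdd by (intro cSUP_upper) auto

lemma op_norm_nonneg: "0 \<le> op_norm G A"
  using l2_norm_le_op_norm[of 0] by (simp add: vN_zero)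

lemma op_norm_bound:
  assumes "x \<in> group_l2 G"
  shows "l2_norm G (A x) \<le> op_norm G A * l2_norm G x"
proof (cases "l2_norm G x = 0")
  case True
  then have "x = 0" using assms l2_norm_eq_0 by blast
  then show ?thesis by (simp add: vN_zero)
next
  case False
  have p: "0 < l2_norm G x" using False by (simp add: less_le)
  have "l2_norm G (A (of_real (1 / l2_norm G x) *\<^sub>c x)) \<le> op_norm G A"
    using assms p by (intro l2_norm_le_op_norm l2_scale) (simp_all only: l2_norm_scale, simp add: norm_divide)
  moreover have "l2_norm G (A (of_real (1 / l2_norm G x) *\<^sub>c x)) = l2_norm G (A x) / l2_norm G x"
    using assms by (simp only: vN_scale l2_norm_scale) (simp add: norm_divide)
  ultimately show ?thesis using p by (simp add: divide_le_eq)
qed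

end

lemma op_norm_le:
  assumes "0 \<le> C" "\<And>x. x \<in> group_l2 G \<Longrightarrow> l2_norm G (A x) \<le> C * l2_norm G x"
  shows "op_norm G A \<le> C"
  unfolding op_norm_def
proof (rule cSUP_least)
  show "{x \<in> group_l2 G. l2_norm G x \<le> 1} \<noteq> {}"
    by (auto intro!: exI[of _ 0])
  fix x assume x: "x \<in> {x \<in> group_l2 G. l2_norm G x \<le> 1}"
  then have "l2_norm G (A x) \<le> C * l2_norm G x" using assms by blast
  also have "\<dots> \<le> C * 1" using x assms(1) by (intro mult_left_mono) auto
  finally show "l2_norm G (A x) \<le> C" by simp
qed

lemma vN_eqI:
  assumes "A \<in> group_vN G" "B \<in> group_vN G" "\<And>x. x \<in> group_l2 G \<Longrightarrow> A x = B x"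
  shows "A = B"
  using assms by (intro extensionalityI[of A "group_l2 G"] vN_extensional) auto

lemma left_translate_linear:
  "left_translate G h (x + y) = left_translate G h x + left_translate G h y"
  "left_translate G h (x - y) = left_translate G h x - left_translate G h y"
  "left_translate G h (c *\<^sub>c x) = c *\<^sub>c left_translate G h x"
  by (auto simp: left_translate_def pointwise)

context group
begin

lemma left_translate_l2 [simp]:
  assumes "h \<in> carrier G" "x \<in> group_l2 G"
  shows "left_translate G h x \<in> group_l2 G"
proof -
  have b: "bij_betw (\<lambda>g. inv h \<otimes> g) (carrier G) (carrier G)"
    using assms(1) by (intro bij_betwI[where g="\<lambda>g. h \<otimes> g"]) (auto simp: m_assoc[symmetric])
  have "(\<lambda>g. (cmod (x (inv h \<otimes> g)))\<^sup>2) summable_on carrier G"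
    using assms(2) summable_on_reindex_bij_betw[OF b, of "\<lambda>g. (cmod (x g))\<^sup>2"]
    by (simp add: group_l2_def)
  then show ?thesis
    by (auto simp: group_l2_def left_translate_def cong: summable_on_cong)
qed

lemma vN_id [simp]: "(\<lambda>x\<in>group_l2 G. x) \<in> group_vN G"
  by (rule group_vNI[where C=1]) auto

lemma vN_compose [simp]:
  assumes "A \<in> group_vN G" "B \<in> group_vN G"
  shows "compose (group_l2 G) A B \<in> group_vN G"
proof (rule group_vNI[where C="op_norm G A * op_norm G B"])
  fix x assume x: "x \<in> group_l2 G"
  have "l2_norm G (A (B x)) \<le> op_norm G A * l2_norm G (B x)"
    using assms x by (simp add: op_norm_bound)
  also have "\<dots> \<le> op_norm G A * (op_norm G B * l2_norm G x)"
    using assms x by (intro mult_left_mono op_norm_bound op_norm_nonneg)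
  finally show "l2_norm G (compose (group_l2 G) A B x) \<le> op_norm G A * op_norm G B * l2_norm G x"
    using x by (simp add: compose_def mult.assoc)
qed (use assms in \<open>auto simp: compose_def vN_add vN_scale vN_left_translate\<close>)

lemma vN_plus_scalar [simp]:
  assumes "A \<in> group_vN G"
  shows "op_plus_scalar G A c \<in> group_vN G"
proof -
  have *: "op_plus_scalar G A c = (\<lambda>x\<in>group_l2 G. A x + c *\<^sub>c x)"
    by (auto simp: op_plus_scalar_def pointwise)
  show ?thesis unfolding *
  proof (rule group_vNI[where C="op_norm G A + cmod c"])
    fix x assume x: "x \<in> group_l2 G"
    have "l2_norm G (A x + c *\<^sub>c x) \<le> l2_norm G (A x) + l2_norm G (c *\<^sub>c x)"
      using assms x by (intro l2_norm_triangle) auto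
    also have "\<dots> \<le> (op_norm G A + cmod c) * l2_norm G x"
      using op_norm_bound[OF assms x] by (simp add: algebra_simps)
    finally show "l2_norm G ((\<lambda>x\<in>group_l2 G. A x + c *\<^sub>c x) x) \<le> (op_norm G A + cmod c) * l2_norm G x"
      using x by simp
  qed (use assms in \<open>auto simp: vN_add vN_scale vN_left_translate left_translate_linear
        scale_series_distrib mult.commute\<close>)
qed

lemma vN_minus [simp]:
  assumes "A \<in> group_vN G" "B \<in> group_vN G"
  shows "op_minus G A B \<in> group_vN G"
proof -
  have *: "op_minus G A B = (\<lambda>x\<in>group_l2 G. A x - B x)"
    by (auto simp: op_minus_def pointwise)
  show ?thesis unfolding *
  proof (rule group_vNI[where C="op_norm G A + op_norm G B"])
    fix x assume x: "x \<in> group_l2 G"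
    have "l2_norm G (A x - B x) \<le> l2_norm G (A x) + l2_norm G (B x)"
      using assms x l2_norm_triangle_diff[of "A x" G 0 "B x"] l2_norm_minus_commute[of G 0 "B x"]
      by simp
    also have "\<dots> \<le> (op_norm G A + op_norm G B) * l2_norm G x"
      using op_norm_bound[OF assms(1) x] op_norm_bound[OF assms(2) x] by (simp add: algebra_simps)
    finally show "l2_norm G ((\<lambda>x\<in>group_l2 G. A x - B x) x) \<le> (op_norm G A + op_norm G B) * l2_norm G x"
      using x by simp
  qed (use assms in \<open>auto simp: vN_add vN_scale vN_left_translate left_translate_linear
        scale_series_distrib\<close>)
qed

lemma op_apply:
  assumes "x \<in> group_l2 G"
  shows "op_plus_scalar G A c x = A x + c *\<^sub>c x" "op_minus G A B x = A x - B x"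
    "compose (group_l2 G) A B x = A (B x)"
  using assms by (auto simp: op_plus_scalar_def op_minus_def compose_def pointwise)

lemma vN_monoid: "monoid (vN_monoid G)"
  by (rule monoidI)
     (auto simp: vN_monoid_def intro!: vN_eqI vN_compose simp: op_apply)

lemma vN_UnitsI:
  assumes "A \<in> group_vN G" "B \<in> group_vN G"
    and "\<And>x. x \<in> group_l2 G \<Longrightarrow> A (B x) = x" "\<And>x. x \<in> group_l2 G \<Longrightarrow> B (A x) = x"
  shows "A \<in> Units (vN_monoid G)"
  using assms unfolding Units_def vN_monoid_def
  by (auto simp: op_apply intro!: bexI[of _ B] vN_eqI)

text \<open>The left inverse is the half that bounds \<open>A\<close> from below, and this is how
  invertibility is exploited later.\<close>

lemma vN_Units_inverse:
  assumes "A \<in> Units (vN_monoid G)"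
  shows "\<exists>B\<in>group_vN G. \<forall>x\<in>group_l2 G. B (A x) = x"
proof -
  obtain B where B: "A \<in> group_vN G" "B \<in> group_vN G"
      "compose (group_l2 G) B A = (\<lambda>x\<in>group_l2 G. x)"
    using assms unfolding Units_def vN_monoid_def by auto
  have "B (A x) = x" if "x \<in> group_l2 G" for x
    using fun_cong[OF B(3), of x] that by (simp add: op_apply)
  then show ?thesis using B(2) by blast
qed

subsection \<open>Polynomials in an operator\<close>

text \<open>A common summation bound \<open>N\<close> lets polynomials of different degrees be added
  termwise.\<close>

lemma op_poly_apply:
  assumes "x \<in> group_l2 G" "degree p \<le> N"
  shows "op_poly G p A x = (\<lambda>g. \<Sum>i\<le>N. of_real (coeff p i) * (A ^^ i) x g)"
  using assms unfolding op_poly_def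
  by (auto simp: fun_eq_iff coeff_eq_0 intro!: sum.mono_neutral_left intro: le_degree)

lemma op_poly_add:
  assumes "x \<in> group_l2 G"
  shows "op_poly G (p + q) A x = op_poly G p A x + op_poly G q A x"
proof -
  let ?N = "max (degree p) (degree q)"
  have "op_poly G p A x = (\<lambda>g. \<Sum>i\<le>?N. of_real (coeff p i) * (A ^^ i) x g)"
    "op_poly G q A x = (\<lambda>g. \<Sum>i\<le>?N. of_real (coeff q i) * (A ^^ i) x g)"
    "op_poly G (p + q) A x = (\<lambda>g. \<Sum>i\<le>?N. of_real (coeff (p + q) i) * (A ^^ i) x g)"
    using assms by (intro op_poly_apply; simp add: degree_add_le_max)+
  then show ?thesis
    by (simp add: pointwise algebra_simps sum.distrib)
qed

lemma op_poly_smult: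
  assumes "x \<in> group_l2 G"
  shows "op_poly G (smult c p) A x = of_real c *\<^sub>c op_poly G p A x"
  using assms op_poly_apply[of x "smult c p" "degree p" A] op_poly_apply[of x p "degree p" A]
  by (simp add: pointwise sum_distrib_left algebra_simps)

lemma op_poly_diff:
  assumes "x \<in> group_l2 G"
  shows "op_poly G (p - q) A x = op_poly G p A x - op_poly G q A x"
  using op_poly_add[OF assms, of p "smult (-1) q" A] op_poly_smult[OF assms, of "-1" q A]
  by (simp add: diff_conv_scale)

lemma op_poly_0 [simp]: "x \<in> group_l2 G \<Longrightarrow> op_poly G 0 A x = 0"
  by (simp add: op_poly_def pointwise)

lemma op_poly_const [simp]: "x \<in> group_l2 G \<Longrightarrow> op_poly G [:c:] A x = of_real c *\<^sub>c x"
  by (simp add: op_poly_def pointwise)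

lemma op_poly_1 [simp]: "x \<in> group_l2 G \<Longrightarrow> op_poly G 1 A x = x"
  by (simp add: op_poly_def pointwise)

context
  fixes A assumes A: "A \<in> group_vN G"
begin

lemma op_poly_pCons_right:
  assumes "x \<in> group_l2 G"
  shows "op_poly G (pCons c p) A x = of_real c *\<^sub>c x + op_poly G p A (A x)"
proof -
  have "degree (pCons c p) \<le> Suc (degree p)" by (simp add: degree_pCons_le)
  from op_poly_apply[OF assms this, of A] show ?thesis
    using op_poly_apply[OF vN_closed[OF A assms], of p "degree p" A]
    by (simp add: pointwise sum.atMost_Suc_shift funpow_swap1 del: funpow.simps sum.atMost_Suc)
       (simp add: funpow_swap1)
qed

text \<open>The powers in \<open>op_poly\<close> yield a recursion that applies \<open>A\<close>
  innermost; commutation moves it outside, which is the Horner form needed for products. Membership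
  is proved along with it since linearity of \<open>A\<close> is available only on square-summable
  series.\<close>

lemma op_poly_commute:
  assumes "x \<in> group_l2 G"
  shows "op_poly G p A x \<in> group_l2 G \<and> op_poly G p A (A x) = A (op_poly G p A x)"
  using assms A
  by (induction p arbitrary: x) (simp_all add: op_poly_pCons_right vN_zero vN_add vN_scale)

lemma op_poly_pCons:
  assumes "x \<in> group_l2 G"
  shows "op_poly G (pCons c p) A x = of_real c *\<^sub>c x + A (op_poly G p A x)"
  using assms op_poly_commute by (simp add: op_poly_pCons_right)

lemma op_poly_vN [simp]: "op_poly G p A \<in> group_vN G"
proof (induction p)
  case 0
  \<comment> \<open>The zero operator is written as the identity minus itself, so that the closure
    rules already proved apply.\<close>
  have "op_poly G 0 A = op_plus_scalar G (\<lambda>x\<in>group_l2 G. x) (-1)"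
    by (auto simp: op_poly_def op_plus_scalar_def pointwise)
  then show ?case by simp
next
  case (pCons c p)
  have "op_poly G (pCons c p) A
      = op_plus_scalar G (compose (group_l2 G) A (op_poly G p A)) (of_real c)"
  proof (rule extensionalityI[where A="group_l2 G"])
    show "op_poly G (pCons c p) A \<in> extensional (group_l2 G)"
      by (simp add: op_poly_def)
    show "op_plus_scalar G (compose (group_l2 G) A (op_poly G p A)) (of_real c) \<in> extensional (group_l2 G)"
      by (simp add: op_plus_scalar_def)
  qed (simp add: op_poly_pCons op_apply add.commute)
  then show ?case using pCons A by simp
qed

lemma op_poly_mult:
  assumes "x \<in> group_l2 G"
  shows "op_poly G (p * q) A x = op_poly G p A (op_poly G q A x)"
  using assms
  by (induction p) (simp_all add: mult_pCons_left op_poly_add op_poly_smult op_poly_pCons)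

end

end

subsection \<open>Norm limits\<close>

text \<open>This is the convergence demanded in \<open>func_calc\<close>, with membership in the von
  Neumann algebra built in, because only then does \<open>op_norm\<close> control vectors.\<close>

definition op_lim :: "('a, 'm) monoid_scheme \<Rightarrow> (nat \<Rightarrow> 'a l2_op) \<Rightarrow> 'a l2_op \<Rightarrow> bool" where
  "op_lim G T B \<longleftrightarrow> (\<forall>n. T n \<in> group_vN G) \<and> B \<in> group_vN G \<and>
     (\<lambda>n. op_norm G (op_minus G (T n) B)) \<longlonglongrightarrow> 0"

context group
begin

lemma op_limI:
  assumes "\<And>n. T n \<in> group_vN G" "B \<in> group_vN G" "e \<longlonglongrightarrow> 0"
    and "\<And>n x. x \<in> group_l2 G \<Longrightarrow> l2_norm G (T n x - B x) \<le> e n * l2_norm G x"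
  shows "op_lim G T B"
proof -
  have b: "op_norm G (op_minus G (T n) B) \<le> \<bar>e n\<bar>" for n
  proof (rule op_norm_le)
    fix x assume x: "x \<in> group_l2 G"
    have "l2_norm G (T n x - B x) \<le> \<bar>e n\<bar> * l2_norm G x"
      using assms(4)[OF x, of n] by (rule order_trans) (simp add: mult_right_mono)
    then show "l2_norm G (op_minus G (T n) B x) \<le> \<bar>e n\<bar> * l2_norm G x"
      using x by (simp add: op_apply)
  qed simp
  have "(\<lambda>n. op_norm G (op_minus G (T n) B)) \<longlonglongrightarrow> 0"
  proof (rule tendsto_sandwich[where f="\<lambda>_. 0" and h="\<lambda>n. \<bar>e n\<bar>"])
    show "\<forall>\<^sub>F n in sequentially. 0 \<le> op_norm G (op_minus G (T n) B)"
      using assms(1,2) by (intro always_eventually allI op_norm_nonneg) auto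
    show "(\<lambda>n. \<bar>e n\<bar>) \<longlonglongrightarrow> 0" using assms(3) by (rule tendsto_rabs_zero)
  qed (use b in auto)
  then show ?thesis using assms(1,2) by (simp add: op_lim_def)
qed

lemma op_lim_vN: "op_lim G T B \<Longrightarrow> T n \<in> group_vN G" "op_lim G T B \<Longrightarrow> B \<in> group_vN G"
  by (auto simp: op_lim_def)

text \<open>Together with \<open>op_limI\<close> this trades operator norms of differences for a
  null sequence of vectorwise bounds, which combine easily under sums and compositions.\<close>

lemma op_lim_rate:
  assumes "op_lim G T B"
  shows "\<exists>e. e \<longlonglongrightarrow> 0 \<and> (\<forall>n. 0 \<le> e n) \<and>
    (\<forall>n. \<forall>x\<in>group_l2 G. l2_norm G (T n x - B x) \<le> e n * l2_norm G x)"
proof (intro exI[of _ "\<lambda>n. op_norm G (op_minus G (T n) B)"] conjI allI ballI)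
  note [simp] = op_lim_vN[OF assms]
  show "(\<lambda>n. op_norm G (op_minus G (T n) B)) \<longlonglongrightarrow> 0" using assms by (simp add: op_lim_def)
  fix n
  show "0 \<le> op_norm G (op_minus G (T n) B)" by (intro op_norm_nonneg) auto
  fix x assume x: "x \<in> group_l2 G"
  then show "l2_norm G (T n x - B x) \<le> op_norm G (op_minus G (T n) B) * l2_norm G x"
    using op_norm_bound[of "op_minus G (T n) B" G x] by (simp add: op_apply)
qed

lemma op_lim_pointwise:
  assumes "op_lim G T B" "x \<in> group_l2 G"
  shows "(\<lambda>n. l2_norm G (T n x - B x)) \<longlonglongrightarrow> 0"
proof -
  obtain e where e: "e \<longlonglongrightarrow> 0"
    and "\<And>n x. x \<in> group_l2 G \<Longrightarrow> l2_norm G (T n x - B x) \<le> e n * l2_norm G x"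
    using op_lim_rate[OF assms(1)] by blast
  then have "l2_norm G (T n x - B x) \<le> e n * l2_norm G x" for n
    using assms(2) by blast
  then have "norm (l2_norm G (T n x - B x)) \<le> e n * l2_norm G x" for n by simp
  moreover from e have "(\<lambda>n. e n * l2_norm G x) \<longlonglongrightarrow> 0"
    by (rule tendsto_mult_left_zero)
  ultimately show ?thesis
    by (rule Lim_null_comparison[OF always_eventually[OF allI]])
qed

lemma l2_limit_unique:
  assumes "\<And>n. X n \<in> group_l2 G" "x \<in> group_l2 G" "y \<in> group_l2 G"
    and "(\<lambda>n. l2_norm G (X n - x)) \<longlonglongrightarrow> 0" "(\<lambda>n. l2_norm G (X n - y)) \<longlonglongrightarrow> 0"
  shows "x = y"
proof -
  have "(\<lambda>n. l2_norm G (X n - x) + l2_norm G (X n - y)) \<longlonglongrightarrow> 0"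
    using tendsto_add[OF assms(4,5)] by simp
  then have "l2_norm G (x - y) \<le> 0"
  proof (rule tendsto_lowerbound)
    have "l2_norm G (x - y) \<le> l2_norm G (X n - x) + l2_norm G (X n - y)" for n
      using l2_norm_triangle_diff[OF assms(2,1,3), of n] unfolding l2_norm_minus_commute[of G x "X n"] .
    then show "\<forall>\<^sub>F n in sequentially. l2_norm G (x - y) \<le> l2_norm G (X n - x) + l2_norm G (X n - y)"
      by simp
  qed simp
  then have "l2_norm G (x - y) = 0" by (simp add: order_antisym)
  then have "x - y = 0" using assms by (intro l2_norm_eq_0) auto
  then show ?thesis by simp
qed

lemma op_lim_unique:
  assumes "op_lim G T B" "op_lim G T B'"
  shows "B = B'"
proof (rule vN_eqI)
  show B: "B \<in> group_vN G" "B' \<in> group_vN G" using assms by (auto simp: op_lim_def)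
  fix x assume x: "x \<in> group_l2 G"
  show "B x = B' x"
    using B x assms by (intro l2_limit_unique[of "\<lambda>n. T n x"] op_lim_pointwise) (auto simp: op_lim_def)
qed

lemma op_lim_inner:
  assumes "op_lim G T B" "x \<in> group_l2 G" "y \<in> group_l2 G"
  shows "(\<lambda>n. l2_inner G (T n x) y) \<longlonglongrightarrow> l2_inner G (B x) y"
proof -
  have m: "T n \<in> group_vN G" "B \<in> group_vN G" for n using assms(1) by (auto simp: op_lim_def)
  have "(\<lambda>n. l2_norm G (T n x - B x) * l2_norm G y) \<longlonglongrightarrow> 0"
    by (rule tendsto_mult_left_zero[OF op_lim_pointwise[OF assms(1,2)]])
  then have "(\<lambda>n. l2_inner G (T n x) y - l2_inner G (B x) y) \<longlonglongrightarrow> 0"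
  proof (rule Lim_null_comparison[rotated])
    have "norm (l2_inner G (T n x) y - l2_inner G (B x) y) \<le> l2_norm G (T n x - B x) * l2_norm G y" for n
      using m assms(2,3) l2_inner_Cauchy_Schwarz[of "T n x - B x" G y]
      by (simp add: l2_inner_diff_left)
    then show "\<forall>\<^sub>F n in sequentially. norm (l2_inner G (T n x) y - l2_inner G (B x) y)
        \<le> l2_norm G (T n x - B x) * l2_norm G y"
      by simp
  qed
  then show ?thesis by (simp add: LIM_zero_iff)
qed

lemma op_lim_const: "A \<in> group_vN G \<Longrightarrow> op_lim G (\<lambda>_. A) A"
  by (rule op_limI[where e="\<lambda>_. 0"]) auto

text \<open>The difference splits as \<open>(S n - A) (T n x) + A (T n x - B x)\<close>; in the
  first summand the norm of \<open>T n\<close> is at most \<open>e n + ?b\<close>.\<close>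

lemma op_lim_compose:
  assumes "op_lim G S A" "op_lim G T B"
  shows "op_lim G (\<lambda>n. compose (group_l2 G) (S n) (T n)) (compose (group_l2 G) A B)"
proof -
  note md = op_lim_vN[OF assms(1)]
  obtain d where d: "d \<longlonglongrightarrow> 0" "\<And>n. 0 \<le> d n"
    "\<And>n x. x \<in> group_l2 G \<Longrightarrow> l2_norm G (S n x - A x) \<le> d n * l2_norm G x"
    using op_lim_rate[OF assms(1)] by blast
  note me = op_lim_vN[OF assms(2)]
  obtain e where e: "e \<longlonglongrightarrow> 0" "\<And>n. 0 \<le> e n"
    "\<And>n x. x \<in> group_l2 G \<Longrightarrow> l2_norm G (T n x - B x) \<le> e n * l2_norm G x"
    using op_lim_rate[OF assms(2)] by blast
  let ?a = "op_norm G A" and ?b = "op_norm G B"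
  have nn: "0 \<le> ?a" "0 \<le> ?b" using md(2) me(2) op_norm_nonneg by auto
  show ?thesis
  proof (rule op_limI[where e="\<lambda>n. d n * (e n + ?b) + ?a * e n"])
    show "(\<lambda>n. d n * (e n + ?b) + ?a * e n) \<longlonglongrightarrow> 0"
      using tendsto_add[OF tendsto_mult[OF d(1) tendsto_add[OF e(1) tendsto_const]]
          tendsto_mult[OF tendsto_const e(1)], of ?b ?a] by simp
    fix n x assume x: "x \<in> group_l2 G"
    have Tx: "l2_norm G (T n x) \<le> (e n + ?b) * l2_norm G x"
    proof -
      have "l2_norm G (T n x) \<le> l2_norm G (T n x - B x) + l2_norm G (B x)"
        using l2_norm_triangle[of "T n x - B x" G "B x"] md me x by simp
      then show ?thesis using e(3)[OF x, of n] op_norm_bound[OF me(2) x] by (simp add: algebra_simps)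
    qed
    have "l2_norm G (S n (T n x) - A (B x))
        \<le> l2_norm G (S n (T n x) - A (T n x)) + l2_norm G (A (T n x) - A (B x))"
      using md me x by (intro l2_norm_triangle_diff) auto
    also have "l2_norm G (S n (T n x) - A (T n x)) \<le> d n * l2_norm G (T n x)"
      using d(3) me x by simp
    also have "d n * l2_norm G (T n x) \<le> d n * ((e n + ?b) * l2_norm G x)"
      using Tx d(2) by (intro mult_left_mono)
    also have "l2_norm G (A (T n x) - A (B x)) = l2_norm G (A (T n x - B x))"
      unfolding vN_diff[OF md(2) vN_closed[OF me(1) x] vN_closed[OF me(2) x]] ..
    also have "\<dots> \<le> ?a * l2_norm G (T n x - B x)"
      using md me x by (intro op_norm_bound) auto
    also have "\<dots> \<le> ?a * (e n * l2_norm G x)"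
      using e(3)[OF x] nn by (intro mult_left_mono)
    finally show "l2_norm G (compose (group_l2 G) (S n) (T n) x - compose (group_l2 G) A B x)
        \<le> (d n * (e n + ?b) + ?a * e n) * l2_norm G x"
      using x by (simp add: op_apply algebra_simps)
  qed (use md me in auto)
qed

lemma op_lim_plus_scalar:
  assumes "op_lim G T B"
  shows "op_lim G (\<lambda>n. op_plus_scalar G (T n) c) (op_plus_scalar G B c)"
proof -
  note me = op_lim_vN[OF assms]
  obtain e where e: "e \<longlonglongrightarrow> 0" "\<And>n. 0 \<le> e n"
    "\<And>n x. x \<in> group_l2 G \<Longrightarrow> l2_norm G (T n x - B x) \<le> e n * l2_norm G x"
    using op_lim_rate[OF assms] by blast
  show ?thesis
    by (rule op_limI[OF _ _ e(1)]) (use e me in \<open>auto simp: op_apply\<close>)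
qed

text \<open>Completeness in the operator norm. Coefficients are dominated by the norm, so the limit
  can be taken coefficient by coefficient; the Cauchy rate \<open>e\<close> then becomes the rate of
  convergence.\<close>

lemma op_lim_exists:
  assumes T: "\<And>n. T n \<in> group_vN G" and e: "e \<longlonglongrightarrow> 0"
    and b: "\<And>m n x. n \<le> m \<Longrightarrow> x \<in> group_l2 G \<Longrightarrow> l2_norm G (T m x - T n x) \<le> e n * l2_norm G x"
  obtains B where "op_lim G T B"
proof -
  define B where "B = (\<lambda>x\<in>group_l2 G. \<lambda>g. lim (\<lambda>n. T n x g))"
  have lim: "(\<lambda>n. T n x g) \<longlonglongrightarrow> B x g" if x: "x \<in> group_l2 G" for x g
  proof -
    have "Cauchy (\<lambda>n. T n x g)"
    proof (rule CauchyI')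
      fix r :: real assume "0 < r"
      have "(\<lambda>n. e n * l2_norm G x) \<longlonglongrightarrow> 0" using e by (rule tendsto_mult_left_zero)
      then have "\<forall>\<^sub>F n in sequentially. e n * l2_norm G x < r"
        using \<open>0 < r\<close> by (rule order_tendstoD)
      then obtain N where N: "\<And>n. n \<ge> N \<Longrightarrow> e n * l2_norm G x < r"
        by (auto simp: eventually_sequentially)
      have "dist (T n x g) (T m x g) < r" if "N \<le> n" "n < m" for m n
      proof -
        have "cmod ((T m x - T n x) g) \<le> l2_norm G (T m x - T n x)"
          by (rule cmod_le_l2_norm) (intro l2_diff vN_closed[OF T] x)
        also have "\<dots> \<le> e n * l2_norm G x" using b that x by simp
        also have "\<dots> < r" using N that by simp
        finally show ?thesis by (simp add: dist_norm norm_minus_commute minus_apply)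
      qed
      then show "\<exists>M. \<forall>m\<ge>M. \<forall>n>m. dist (T m x g) (T n x g) < r" by blast
    qed
    then show ?thesis using x by (simp add: B_def Cauchy_convergent convergent_LIMSEQ_iff[symmetric])
  qed
  \<comment> \<open>Here \<open>n\<close> is fixed and \<open>m\<close> grows:
    \<open>l2_norm_le_limit\<close> preserves the bound \<open>e n * l2_norm G x\<close> in the
    limit.\<close>
  have diff: "B x - T n x \<in> group_l2 G" "l2_norm G (B x - T n x) \<le> e n * l2_norm G x"
    if x: "x \<in> group_l2 G" for x n
  proof -
    have "0 \<le> e n * l2_norm G x"
      using b[of n n x] x l2_norm_nonneg order_trans by blast
    moreover have "\<forall>\<^sub>F m in sequentially. T m x - T n x \<in> group_l2 G \<and>
        l2_norm G (T m x - T n x) \<le> e n * l2_norm G x"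
      using T x b by (auto simp: eventually_sequentially intro!: exI[of _ n])
    moreover have "(\<lambda>m. (T m x - T n x) g) \<longlonglongrightarrow> (B x - T n x) g" for g
      unfolding minus_apply using lim[OF x] by (intro tendsto_diff tendsto_const)
    moreover have "(B x - T n x) g = 0" if "g \<notin> carrier G" for g
    proof -
      have "T m x g = 0" for m using l2_outside[OF vN_closed[OF T x] that] .
      then show ?thesis using lim[OF x, of g] by (simp add: minus_apply LIMSEQ_const_iff)
    qed
    ultimately show "B x - T n x \<in> group_l2 G" "l2_norm G (B x - T n x) \<le> e n * l2_norm G x"
      using l2_norm_le_limit[of sequentially "\<lambda>m. T m x - T n x" G "e n * l2_norm G x" "B x - T n x"]
      by auto
  qed
  \<comment> \<open>Only the differences to \<open>T n x\<close> are known to be square-summable so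
    far, hence the detour through \<open>T 0 x\<close>, which also explains the constant in the norm
    bound below.\<close>
  have Bl2: "B x \<in> group_l2 G" if "x \<in> group_l2 G" for x
    using l2_add[OF diff(1)[OF that, of 0] vN_closed[OF T[of 0] that]] by simp
  have "B \<in> group_vN G"
  proof (rule group_vNI[where C="e 0 + op_norm G (T 0)"])
    show "B \<in> extensional (group_l2 G)" by (simp add: B_def)
    show "B x \<in> group_l2 G" if "x \<in> group_l2 G" for x using Bl2 that .
    fix x assume x: "x \<in> group_l2 G"
    show "B (x + y) = B x + B y" if "y \<in> group_l2 G" for y
    proof
      fix g
      have "(\<lambda>n. T n (x + y) g) \<longlonglongrightarrow> (B x + B y) g"
        unfolding vN_add[OF T x that] plus_fun_apply by (intro tendsto_add lim x that)
      then show "B (x + y) g = (B x + B y) g"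
        using x that by (intro LIMSEQ_unique[OF lim]) auto
    qed
    show "B (c *\<^sub>c x) = c *\<^sub>c B x" for c
    proof
      fix g
      have "(\<lambda>n. T n (c *\<^sub>c x) g) \<longlonglongrightarrow> (c *\<^sub>c B x) g"
        unfolding vN_scale[OF T x] scale_series_apply by (intro tendsto_mult_left lim x)
      then show "B (c *\<^sub>c x) g = (c *\<^sub>c B x) g"
        using x by (intro LIMSEQ_unique[OF lim]) auto
    qed
    show "B (left_translate G h x) = left_translate G h (B x)" if "h \<in> carrier G" for h
    proof
      fix g
      have "(\<lambda>n. T n (left_translate G h x) g) \<longlonglongrightarrow> left_translate G h (B x) g"
        unfolding vN_left_translate[OF T that x] using lim[OF x] by (simp add: left_translate_def)
      then show "B (left_translate G h x) g = left_translate G h (B x) g"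
        using x that by (intro LIMSEQ_unique[OF lim]) auto
    qed
    have "l2_norm G (B x) \<le> l2_norm G (B x - T 0 x) + l2_norm G (T 0 x)"
      using l2_norm_triangle[of "B x - T 0 x" G "T 0 x"] T x Bl2 by simp
    then show "l2_norm G (B x) \<le> (e 0 + op_norm G (T 0)) * l2_norm G x"
      using diff(2)[OF x, of 0] op_norm_bound[OF T x, of 0] by (simp add: algebra_simps)
  qed
  then have "op_lim G T B"
  proof (rule op_limI[OF T _ e])
    fix n x assume "x \<in> group_l2 G"
    then show "l2_norm G (T n x - B x) \<le> e n * l2_norm G x"
      using diff(2) l2_norm_minus_commute[of G "T n x"] by simp
  qed
  then show thesis by (rule that)
qed

lemma unit_series_l2 [simp]: "unit_series G \<in> group_l2 G" "l2_norm G (unit_series G) = 1"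
proof -
  have "finite {g \<in> carrier G. (cmod (unit_series G g))\<^sup>2 \<noteq> 0}"
    by (rule finite_subset[of _ "{\<one>}"]) (auto simp: unit_series_def)
  then show "unit_series G \<in> group_l2 G"
    by (auto simp: group_l2_def unit_series_def intro!: finite_nonzero_values_imp_summable_on)
  have "(\<Sum>\<^sub>\<infinity>g\<in>carrier G. (cmod (unit_series G g))\<^sup>2) = (\<Sum>\<^sub>\<infinity>g\<in>{\<one>}. (cmod (unit_series G g))\<^sup>2)"
    by (rule infsum_cong_neutral) (auto simp: unit_series_def)
  then show "l2_norm G (unit_series G) = 1"
    by (simp add: l2_norm_def unit_series_def)
qed

end

section \<open>Self-adjoint operators and their real spectrum\<close>

definition self_adjoint :: "('a, 'm) monoid_scheme \<Rightarrow> 'a l2_op \<Rightarrow> bool" where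
  "self_adjoint G A \<longleftrightarrow> A \<in> group_vN G \<and>
     (\<forall>x\<in>group_l2 G. \<forall>y\<in>group_l2 G. l2_inner G (A x) y = l2_inner G x (A y))"

lemma self_adjoint_vN: "self_adjoint G A \<Longrightarrow> A \<in> group_vN G"
  by (simp add: self_adjoint_def)

lemma self_adjoint_inner:
  "self_adjoint G A \<Longrightarrow> x \<in> group_l2 G \<Longrightarrow> y \<in> group_l2 G \<Longrightarrow> l2_inner G (A x) y = l2_inner G x (A y)"
  by (simp add: self_adjoint_def)

text \<open>Polarization bounds the norm by the numerical radius.\<close>

lemma self_adjoint_norm_le:
  assumes A: "self_adjoint G A"
    and r: "\<And>x. x \<in> group_l2 G \<Longrightarrow> \<bar>Re (l2_inner G (A x) x)\<bar> \<le> r * (l2_norm G x)\<^sup>2"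
    and x: "x \<in> group_l2 G"
  shows "l2_norm G (A x) \<le> r * l2_norm G x"
proof -
  note vN = self_adjoint_vN[OF A]
  note Ax = vN_closed[OF vN x]
  define a where "a = l2_norm G x"
  define b where "b = l2_norm G (A x)"
  have ab: "0 \<le> a" "0 \<le> b" by (simp_all add: a_def b_def)
  have "0 \<le> r * a\<^sup>2" using r[OF x] by (simp add: a_def)
  then have ra: "0 \<le> r * a" using ab by (cases "a = 0") (auto simp: zero_le_mult_iff)
  show ?thesis
  proof (cases "b = 0")
    case True
    then show ?thesis using ra by (simp add: a_def b_def)
  next
    case False
    then have "x \<noteq> 0" using vN_zero[OF vN] by (auto simp: b_def)
    then have pos: "0 < a" "0 < b" using False ab l2_norm_eq_0[OF x] by (auto simp: a_def less_le)
    \<comment> \<open>The multiple of \<open>A x\<close> with the same norm as \<open>x\<close>: the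
      inner product of \<open>A x\<close> with it is exactly \<open>a * b\<close>, and equal norms
      make the final estimate sharp.\<close>
    define y where "y = of_real (a / b) *\<^sub>c A x"
    have y: "y \<in> group_l2 G" using Ax by (simp add: y_def)
    have ny: "l2_norm G y = a"
      using pos by (simp add: y_def b_def[symmetric] norm_divide)
    have Axy: "Re (l2_inner G (A x) y) = a * b"
      using pos l2_inner_self[OF Ax]
      by (simp add: y_def l2_inner_scale_right b_def[symmetric] power2_eq_square)
    have "Re (l2_inner G (A y) x) = Re (l2_inner G (A x) y)"
      using self_adjoint_inner[OF A y x] Re_l2_inner_commute[of G y] by simp
    then have "4 * Re (l2_inner G (A x) y)
        = Re (l2_inner G (A (x + y)) (x + y)) - Re (l2_inner G (A (x - y)) (x - y))"
      unfolding vN_add[OF vN x y] vN_diff[OF vN x y]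
      using x y Ax vN_closed[OF vN y] by (simp add: l2_inner_simps)
    also have "\<dots> \<le> r * (l2_norm G (x + y))\<^sup>2 + r * (l2_norm G (x - y))\<^sup>2"
      using r[OF l2_add[OF x y]] r[OF l2_diff[OF x y]] by (simp add: abs_le_iff)
    \<comment> \<open>Parallelogram law for \<open>x\<close> and \<open>y\<close>, both of norm
      \<open>a\<close>.\<close>
    also have "\<dots> = 4 * (r * a\<^sup>2)"
      unfolding l2_norm_add_sq[OF x y] l2_norm_diff_sq[OF x y] ny a_def[symmetric]
      by (simp add: algebra_simps)
    finally have "a * b \<le> a * (r * a)"
      using Axy by (simp add: power2_eq_square algebra_simps)
    then show ?thesis using pos by (simp add: a_def b_def)
  qed
qed

context group
begin

lemma self_adjoint_op_poly:
  assumes A: "self_adjoint G A"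
  shows "self_adjoint G (op_poly G p A)"
proof -
  note vN = self_adjoint_vN[OF A]
  have "l2_inner G (op_poly G p A x) y = l2_inner G x (op_poly G p A y)"
    if "x \<in> group_l2 G" "y \<in> group_l2 G" for x y
    using that
  proof (induction p arbitrary: x y)
    case 0
    then show ?case by (simp add: l2_inner_def pointwise)
  next
    case (pCons c p)
    note P = vN_closed[OF op_poly_vN[OF vN, of p]]
    have "l2_inner G (A (op_poly G p A x)) y = l2_inner G (op_poly G p A x) (A y)"
      using self_adjoint_inner[OF A P] pCons by blast
    also have "\<dots> = l2_inner G x (op_poly G p A (A y))"
      using pCons vN_closed[OF vN] by blast
    finally show ?case
      using pCons P vN_closed[OF vN] op_poly_commute[OF vN, of y p]
      by (simp add: op_poly_pCons[OF vN] l2_inner_simps)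
  qed
  then show ?thesis using vN by (simp add: self_adjoint_def)
qed

lemma op_poly_X:
  assumes "A \<in> group_vN G" "x \<in> group_l2 G"
  shows "op_poly G [:a, b:] A x = of_real a *\<^sub>c x + of_real b *\<^sub>c A x"
  using assms(2) by (simp add: op_poly_pCons[OF assms(1)] vN_scale[OF assms(1)] vN_zero[OF assms(1)])

lemma one_minus_geometric: "(1 - p) * (\<Sum>k<n. p ^ k) = 1 - (p :: real poly) ^ n"
  by (rule one_diff_power_eq[symmetric])

text \<open>The inverse is \<open>1 / M\<close> times the Neumann series of \<open>1 - A / M\<close>, where \<open>A \<le> M\<close>.\<close>

lemma self_adjoint_Units:
  assumes A: "self_adjoint G A" and c: "0 < c"
    and lb: "\<And>x. x \<in> group_l2 G \<Longrightarrow> c * (l2_norm G x)\<^sup>2 \<le> Re (l2_inner G (A x) x)"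
  shows "A \<in> Units (vN_monoid G)"
proof -
  note vN = self_adjoint_vN[OF A]
  \<comment> \<open>The maximum with \<open>c\<close> makes \<open>M\<close> positive and places
    \<open>1 - c / M\<close> in the half-open interval from 0 to 1.\<close>
  define M where "M = max c (op_norm G A)"
  have M: "0 < M" "c \<le> M" using c by (auto simp: M_def)
  define q where "q = [:1, - (1 / M):]"
  define r where "r = 1 - c / M"
  have r: "0 \<le> r" "r < 1" using M c by (auto simp: r_def)
  \<comment> \<open>The quadratic form of \<open>1 - A / M\<close> lies between 0 and
    \<open>r\<close> times the squared norm, and self-adjointness turns this into a norm
    bound.\<close>
  have qn: "l2_norm G (op_poly G q A x) \<le> r * l2_norm G x" if x: "x \<in> group_l2 G" for x
    using self_adjoint_op_poly[OF A, of q] _ x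
  proof (rule self_adjoint_norm_le)
    fix x assume x: "x \<in> group_l2 G"
    have "Re (l2_inner G (A x) x) \<le> l2_norm G (A x) * l2_norm G x"
      using vN_closed[OF vN x] x by (rule Re_l2_inner_le)
    also have "\<dots> \<le> op_norm G A * l2_norm G x * l2_norm G x"
      by (intro mult_right_mono op_norm_bound[OF vN x]) simp
    also have "\<dots> \<le> M * (l2_norm G x)\<^sup>2"
      by (simp add: power2_eq_square M_def mult.assoc mult_right_mono)
    finally have ub: "Re (l2_inner G (A x) x) / M \<le> (l2_norm G x)\<^sup>2"
      using M by (simp add: divide_le_eq mult.commute)
    have "Re (l2_inner G (op_poly G q A x) x) = (l2_norm G x)\<^sup>2 - Re (l2_inner G (A x) x) / M"
      unfolding q_def op_poly_X[OF vN x]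
      using x vN_closed[OF vN x] by (simp add: l2_inner_simps l2_inner_self)
    moreover have "c / M * (l2_norm G x)\<^sup>2 \<le> Re (l2_inner G (A x) x) / M"
      using lb[OF x] M by (simp add: divide_right_mono)
    ultimately show "\<bar>Re (l2_inner G (op_poly G q A x) x)\<bar> \<le> r * (l2_norm G x)\<^sup>2"
      using ub by (simp add: r_def left_diff_distrib)
  qed
  have qk: "l2_norm G (op_poly G (q ^ k) A x) \<le> r ^ k * l2_norm G x" if x: "x \<in> group_l2 G" for x k
  proof (induction k)
    case (Suc k)
    note Q = vN_closed[OF op_poly_vN[OF vN, of "q ^ k"] x]
    have "l2_norm G (op_poly G (q ^ Suc k) A x) \<le> r * l2_norm G (op_poly G (q ^ k) A x)"
      unfolding power_Suc op_poly_mult[OF vN x] by (rule qn[OF Q])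
    also have "\<dots> \<le> r * (r ^ k * l2_norm G x)" using Suc r by (intro mult_left_mono)
    finally show ?case by (simp add: mult.assoc)
  qed (use x in simp)
  define t where "t n = smult (1 / M) (\<Sum>k<n. q ^ k)" for n
  define T where "T n = op_poly G (t n) A" for n
  have TvN: "T n \<in> group_vN G" for n using vN by (simp add: T_def)
  \<comment> \<open>With this \<open>K\<close> the summand \<open>r ^ k / M\<close> equals
    \<open>K * (r ^ k - r ^ Suc k)\<close>, so partial sums of the Neumann series telescope.\<close>
  define K where "K = 1 / M / (1 - r)"
  have K: "0 \<le> K" "K * (1 - r) = 1 / M" using M r by (simp_all add: K_def)
  have step: "l2_norm G (T m x - T n x) \<le> K * (r ^ n - r ^ m) * l2_norm G x"
    if "n \<le> m" and x: "x \<in> group_l2 G" for m n :: nat and x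
    using that(1)
  proof (induction m rule: dec_induct)
    case (step m)
    have "l2_norm G (T (Suc m) x - T n x) \<le> l2_norm G (T (Suc m) x - T m x) + l2_norm G (T m x - T n x)"
      using vN_closed[OF TvN x] by (intro l2_norm_triangle_diff)
    also have "T (Suc m) x - T m x = op_poly G (smult (1 / M) (q ^ m)) A x"
      unfolding T_def op_poly_diff[OF x, symmetric] by (simp add: t_def smult_add_right)
    also have "l2_norm G \<dots> \<le> 1 / M * (r ^ m * l2_norm G x)"
      using qk[OF x, of m] M by (simp add: op_poly_smult[OF x] norm_divide divide_right_mono)
    also have "1 / M * (r ^ m * l2_norm G x) = K * (r ^ m - r ^ Suc m) * l2_norm G x"
      by (simp add: K(2)[symmetric] algebra_simps)
    also have "\<dots> + l2_norm G (T m x - T n x)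
        \<le> K * (r ^ m - r ^ Suc m) * l2_norm G x + K * (r ^ n - r ^ m) * l2_norm G x"
      using step.IH by simp
    also have "\<dots> = K * (r ^ n - r ^ Suc m) * l2_norm G x" by (simp add: algebra_simps)
    finally show ?case by simp
  qed simp
  have r0: "(\<lambda>n. r ^ n) \<longlonglongrightarrow> 0" using r by (intro LIMSEQ_power_zero) auto
  have "(\<lambda>n. K * r ^ n) \<longlonglongrightarrow> 0" using r0 by (rule tendsto_mult_right_zero)
  then obtain B where B: "op_lim G T B"
  proof (rule op_lim_exists[OF TvN])
    fix m n :: nat and x assume "n \<le> m" and x: "x \<in> group_l2 G"
    have "l2_norm G (T m x - T n x) \<le> K * (r ^ n - r ^ m) * l2_norm G x"
      using \<open>n \<le> m\<close> x by (rule step)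
    also have "\<dots> \<le> K * r ^ n * l2_norm G x"
      using K r by (intro mult_right_mono mult_left_mono) auto
    finally show "l2_norm G (T m x - T n x) \<le> K * r ^ n * l2_norm G x" .
  qed
  \<comment> \<open>Since \<open>1 - q\<close> is \<open>1 / M\<close> times the variable, the
    geometric sum shows that \<open>t n\<close> inverts the variable up to \<open>q ^ n\<close>,
    whose operator tends to 0.\<close>
  have X: "[:0, 1:] * t n = 1 - q ^ n" for n
  proof -
    have "smult (1 / M) [:0, 1:] = 1 - q" by (simp add: q_def one_pCons)
    then show ?thesis unfolding t_def one_minus_geometric[symmetric] by (metis mult_smult_left mult_smult_right)
  qed
  have AX: "op_poly G [:0, 1:] A x = A x" if "x \<in> group_l2 G" for x
    using that by (simp add: op_poly_X[OF vN])
  have 1: "op_poly G (1 - q ^ n) A x - x = (-1) *\<^sub>c op_poly G (q ^ n) A x" if x: "x \<in> group_l2 G" for x n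
    unfolding op_poly_diff[OF x] using x by (simp add: pointwise)
  have lim1: "op_lim G (\<lambda>n. op_poly G (1 - q ^ n) A) (\<lambda>x\<in>group_l2 G. x)"
    by (rule op_limI[OF _ _ r0]) (use vN qk 1 in auto)
  have "compose (group_l2 G) A (T n) = op_poly G (1 - q ^ n) A" for n
  proof (rule vN_eqI[of _ G])
    fix x assume x: "x \<in> group_l2 G"
    show "compose (group_l2 G) A (T n) x = op_poly G (1 - q ^ n) A x"
      unfolding X[symmetric] op_poly_mult[OF vN x] op_apply[OF x]
      using AX[OF vN_closed[OF TvN x]] by (simp only: T_def)
  qed (use vN TvN in auto)
  then have AB: "compose (group_l2 G) A B = (\<lambda>x\<in>group_l2 G. x)"
    using op_lim_compose[OF op_lim_const[OF vN] B] lim1 by (simp add: op_lim_unique)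
  \<comment> \<open>The other order uses the same polynomial identity, as polynomials
    commute.\<close>
  have "compose (group_l2 G) (T n) A = op_poly G (1 - q ^ n) A" for n
  proof (rule vN_eqI[of _ G])
    fix x assume x: "x \<in> group_l2 G"
    show "compose (group_l2 G) (T n) A x = op_poly G (1 - q ^ n) A x"
      unfolding X[symmetric] mult.commute[of "[:0, 1:]"] op_poly_mult[OF vN x] op_apply[OF x] AX[OF x]
      by (simp only: T_def)
  qed (use vN TvN in auto)
  then have BA: "compose (group_l2 G) B A = (\<lambda>x\<in>group_l2 G. x)"
    using op_lim_compose[OF B op_lim_const[OF vN]] lim1 by (simp add: op_lim_unique)
  show ?thesis
  proof (rule vN_UnitsI[OF vN op_lim_vN(2)[OF B]])
    fix x assume x: "x \<in> group_l2 G"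
    show "A (B x) = x" "B (A x) = x"
      using fun_cong[OF AB, of x] fun_cong[OF BA, of x] x by (simp_all add: op_apply)
  qed
qed

end

section \<open>Real polynomials and their complex roots\<close>

text \<open>Multiplicativity of evaluation at a complex point allows a real polynomial to be reduced
  modulo a real quadratic vanishing there.\<close>

lemma poly_of_real_hom:
  fixes z :: complex
  defines "ev \<equiv> \<lambda>p :: real poly. poly (map_poly of_real p) z"
  shows "ev (p + q) = ev p + ev q" "ev (smult c p) = of_real c * ev p" "ev (p * q) = ev p * ev q"
proof -
  have pCons: "ev (pCons a p) = of_real a + z * ev p" for a p
    by (simp add: ev_def map_poly_pCons)
  have zero: "ev 0 = 0" by (simp add: ev_def)
  show add: "ev (p + q) = ev p + ev q" for p q
    by (induction p q rule: poly_induct2) (simp_all add: pCons zero algebra_simps)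
  show smult: "ev (smult c p) = of_real c * ev p" for c p
    by (induction p) (simp_all add: pCons zero algebra_simps)
  show "ev (p * q) = ev p * ev q"
    by (induction p) (simp_all add: pCons zero add smult algebra_simps)
qed

text \<open>A non-real root \<open>a + i b\<close> is also a root of \<open>(t - a)^2 + b^2\<close>.
  The remainder of \<open>q\<close> modulo this quadratic is real of degree at most one and vanishes
  at the root, so it is zero.\<close>

lemma real_poly_root_or_quadratic_factor:
  fixes q :: "real poly"
  assumes "0 < degree q"
  shows "(\<exists>t. poly q t = 0) \<or> (\<exists>a b s. b \<noteq> 0 \<and> q = [:a\<^sup>2 + b\<^sup>2, - 2 * a, 1:] * s)"
proof -
  have "degree (map_poly complex_of_real q) = degree q"
    by (intro degree_map_poly) auto
  then have "\<not> constant (poly (map_poly complex_of_real q))"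
    using assms by (simp add: constant_degree)
  then obtain z where z: "poly (map_poly complex_of_real q) z = 0"
    using fundamental_theorem_of_algebra by blast
  define a b where "a = Re z" and "b = Im z"
  show ?thesis
  proof (cases "b = 0")
    case True
    then have "z = of_real a" by (simp add: a_def b_def complex_eq_iff)
    have "poly (map_poly complex_of_real q) (of_real a) = of_real (poly q a)"
      by (induction q) (simp_all add: map_poly_pCons)
    then have "poly q a = 0" using z \<open>z = of_real a\<close> by simp
    then show ?thesis by auto
  next
    case False
    define d where "d = [:a\<^sup>2 + b\<^sup>2, - 2 * a, 1:]"
    have z2: "z * z = - of_real (a\<^sup>2 + b\<^sup>2) + of_real (2 * a) * z"
      by (simp add: a_def b_def complex_eq_iff power2_eq_square algebra_simps)
    have dz: "poly (map_poly complex_of_real d) z = 0"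
      using z2 by (simp add: d_def map_poly_pCons algebra_simps)
    define r where "r = q mod d"
    have d: "d \<noteq> 0" "degree d = 2" by (simp_all add: d_def)
    have "degree r < 2" using degree_mod_less'[of d q] d by (cases "r = 0") (auto simp: r_def)
    then have rr: "r = [:coeff r 0, coeff r 1:]"
      by (intro poly_eqI) (auto simp: coeff_pCons coeff_eq_0 split: nat.splits)
    have "poly (map_poly complex_of_real q) z
        = poly (map_poly complex_of_real (d * (q div d) + r)) z" by (simp add: r_def)
    then have "poly (map_poly complex_of_real r) z = 0"
      using z dz by (simp only: poly_of_real_hom) simp
    then have rz: "of_real (coeff r 0) + z * of_real (coeff r 1) = 0"
      by (subst (asm) rr) (simp add: map_poly_pCons)
    then have "Im z * coeff r 1 = 0" "coeff r 0 + Re z * coeff r 1 = 0"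
      by (auto simp: complex_eq_iff)
    then have "coeff r 1 = 0" "coeff r 0 = 0" using False by (auto simp: b_def)
    then have "r = 0" using rr by simp
    then have "q = d * (q div d)" by (simp add: r_def mod_eq_0_iff_dvd)
    then show ?thesis using False unfolding d_def by blast
  qed
qed

section \<open>The norm of a real polynomial in a self-adjoint operator\<close>

definition real_spectrum :: "('a, 'm) monoid_scheme \<Rightarrow> 'a l2_op \<Rightarrow> real set" where
  "real_spectrum G A = {t. complex_of_real t \<in> op_spectrum G A}"

context group
begin

lemma op_plus_scalar_eq_poly:
  assumes "A \<in> group_vN G"
  shows "op_plus_scalar G A (of_real c) = op_poly G [:c, 1:] A"
  using assms by (intro vN_eqI[of _ G]) (simp_all add: op_apply op_poly_X add.commute)

lemma real_spectrum_iff: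
  assumes "A \<in> group_vN G"
  shows "t \<in> real_spectrum G A \<longleftrightarrow> op_poly G [:- t, 1:] A \<notin> Units (vN_monoid G)"
  using op_plus_scalar_eq_poly[OF assms, of "- t"] by (simp add: real_spectrum_def op_spectrum_def)

lemma op_poly_mult_Units:
  assumes "A \<in> group_vN G" "op_poly G p A \<in> Units (vN_monoid G)" "op_poly G q A \<in> Units (vN_monoid G)"
  shows "op_poly G (p * q) A \<in> Units (vN_monoid G)"
proof -
  interpret M: monoid "vN_monoid G" by (rule vN_monoid)
  have "op_poly G (p * q) A = op_poly G p A \<otimes>\<^bsub>vN_monoid G\<^esub> op_poly G q A"
    using assms(1) by (intro vN_eqI[of _ G]) (simp_all add: vN_monoid_def op_apply op_poly_mult)
  then show ?thesis using assms M.Units_m_closed by simp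
qed

lemma op_poly_const_Units:
  assumes "A \<in> group_vN G" "c \<noteq> 0"
  shows "op_poly G [:c:] A \<in> Units (vN_monoid G)"
  using assms by (intro vN_UnitsI[of _ "op_poly G [:1 / c:] A"]) auto

text \<open>Induction over the real factorization: a linear factor is invertible because its root is
  off the spectrum, and a quadratic one because \<open>(A - a)^2 + b^2\<close> is bounded below by
  \<open>b^2\<close>.\<close>

lemma op_poly_Units:
  assumes A: "self_adjoint G A" and "q \<noteq> 0" "\<And>t. poly q t = 0 \<Longrightarrow> t \<notin> real_spectrum G A"
  shows "op_poly G q A \<in> Units (vN_monoid G)"
  using assms(2,3)
proof (induction "degree q" arbitrary: q rule: less_induct)
  case less
  note vN = self_adjoint_vN[OF A]
  show ?case
  proof (cases "degree q = 0")
    case True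
    then obtain c where "q = [:c:]" by (meson degree_eq_zeroE)
    then show ?thesis using less.prems op_poly_const_Units[OF vN] by simp
  next
    case False
    then consider (root) t where "poly q t = 0"
      | (quad) a b s where "b \<noteq> 0" "q = [:a\<^sup>2 + b\<^sup>2, - 2 * a, 1:] * s"
      using real_poly_root_or_quadratic_factor by blast
    then show ?thesis
    proof cases
      case root
      then obtain s where s: "q = [:- t, 1:] * s" by (auto simp: poly_eq_0_iff_dvd dvd_def)
      then have "s \<noteq> 0" using less.prems by auto
      then have "degree q = Suc (degree s)" unfolding s by (subst degree_mult_eq) auto
      then have "op_poly G s A \<in> Units (vN_monoid G)"
        using less s \<open>s \<noteq> 0\<close> by auto
      moreover have "op_poly G [:- t, 1:] A \<in> Units (vN_monoid G)"
        using less.prems(2)[OF root] real_spectrum_iff[OF vN] by blast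
      ultimately show ?thesis unfolding s by (intro op_poly_mult_Units vN)
    next
      case quad
      let ?d = "[:a\<^sup>2 + b\<^sup>2, - 2 * a, 1:]"
      have "s \<noteq> 0" using less.prems quad by auto
      then have "degree q = degree s + 2" unfolding quad(2) by (subst degree_mult_eq) auto
      then have "op_poly G s A \<in> Units (vN_monoid G)"
        using less quad \<open>s \<noteq> 0\<close> by auto
      moreover have "op_poly G ?d A \<in> Units (vN_monoid G)"
      proof (rule self_adjoint_Units[OF self_adjoint_op_poly[OF A], of "b\<^sup>2"])
        show "0 < b\<^sup>2" using quad by simp
        fix x assume x: "x \<in> group_l2 G"
        define y where "y = op_poly G [:- a, 1:] A x"
        have y: "y \<in> group_l2 G" using vN_closed[OF op_poly_vN[OF vN] x] by (simp add: y_def)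
        \<comment> \<open>Completing the square.\<close>
        have "?d = [:- a, 1:] * [:- a, 1:] + [:b\<^sup>2:]" by (simp add: power2_eq_square)
        then have "op_poly G ?d A x = op_poly G [:- a, 1:] A y + of_real (b\<^sup>2) *\<^sub>c x"
          unfolding y_def by (simp only: op_poly_add[OF x] op_poly_mult[OF vN x] op_poly_const[OF x])
        moreover have "l2_inner G (op_poly G [:- a, 1:] A y) x = l2_inner G y y"
          unfolding y_def
          by (rule self_adjoint_inner[OF self_adjoint_op_poly[OF A] y[unfolded y_def] x])
        ultimately have "Re (l2_inner G (op_poly G ?d A x) x) = (l2_norm G y)\<^sup>2 + b\<^sup>2 * (l2_norm G x)\<^sup>2"
          using x y vN_closed[OF op_poly_vN[OF vN] y]
          by (simp add: l2_inner_simps l2_inner_self)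
        then show "b\<^sup>2 * (l2_norm G x)\<^sup>2 \<le> Re (l2_inner G (op_poly G ?d A x) x)" by simp
      qed
      ultimately show ?thesis unfolding quad(2) by (intro op_poly_mult_Units vN)
    qed
  qed
qed

text \<open>
  If \<open>N = \<parallel>p(A)\<parallel>\<close> exceeded every value of \<open>\<bar>p\<bar>\<close> on the spectrum, \<open>N\<^sup>2 - p\<^sup>2\<close> would have no root there,
  so \<open>N\<^sup>2 - p(A)\<^sup>2\<close> would be bounded below, which forces \<open>\<parallel>p(A)\<parallel> < N\<close>.
\<close>

lemma op_norm_op_poly_le_aux:
  assumes A: "self_adjoint G A" and C: "0 \<le> C"
    and b: "\<And>t. t \<in> real_spectrum G A \<Longrightarrow> \<bar>poly p t\<bar> \<le> C"
    and nz: "[:(op_norm G (op_poly G p A))\<^sup>2:] - p * p \<noteq> 0"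
  shows "op_norm G (op_poly G p A) \<le> C"
proof (rule ccontr)
  assume neg: "\<not> op_norm G (op_poly G p A) \<le> C"
  define N where "N = op_norm G (op_poly G p A)"
  have N: "C < N" "0 < N" using neg C by (auto simp: N_def)
  note vN = self_adjoint_vN[OF A]
  note P = op_poly_vN[OF vN, of p]
  define q where "q = [:N\<^sup>2:] - p * p"
  have "op_poly G q A \<in> Units (vN_monoid G)"
  proof (rule op_poly_Units[OF A])
    show "q \<noteq> 0" using nz by (simp add: q_def N_def)
    fix t assume "poly q t = 0"
    then have "(poly p t)\<^sup>2 = N\<^sup>2" by (simp add: q_def power2_eq_square)
    then have "\<bar>poly p t\<bar> = N" using N by (metis abs_of_pos power2_eq_iff abs_minus_cancel)
    then show "t \<notin> real_spectrum G A" using b N by force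
  qed
  then obtain B where B: "B \<in> group_vN G" "\<And>x. x \<in> group_l2 G \<Longrightarrow> B (op_poly G q A x) = x"
    using vN_Units_inverse by blast
  define K where "K = op_norm G B + 1"
  have K: "0 < K" using op_norm_nonneg[OF B(1)] by (simp add: K_def)
  \<comment> \<open>Write \<open>y\<close> for \<open>p(A) x\<close>. Boundedness below of
    \<open>N^2 - p(A)^2\<close>, squared and combined with the bound \<open>N\<close> for
    \<open>p(A) y\<close>, gives that the squared norm of \<open>x\<close> is at most
    \<open>(K * N)^2\<close> times \<open>N^2 |x|^2 - |y|^2\<close>; so \<open>d\<close> is a gap
    below \<open>N^2\<close>. The summand 1 in \<open>K\<close> keeps it meaningful.\<close>
  define d where "d = 1 / (K * N)\<^sup>2"
  have d: "0 < d" using K N by (simp add: d_def)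
  have bound: "(l2_norm G (op_poly G p A x))\<^sup>2 \<le> (N\<^sup>2 - d) * (l2_norm G x)\<^sup>2" if x: "x \<in> group_l2 G" for x
  proof -
    let ?y = "op_poly G p A x"
    have y: "?y \<in> group_l2 G" by (rule vN_closed[OF P x])
    let ?z = "op_poly G p A ?y"
    have z: "?z \<in> group_l2 G" by (rule vN_closed[OF P y])
    have q: "op_poly G q A x = of_real (N\<^sup>2) *\<^sub>c x - ?z"
      unfolding q_def op_poly_diff[OF x] op_poly_mult[OF vN x] op_poly_const[OF x] ..
    have qc: "op_poly G q A x \<in> group_l2 G" by (rule vN_closed[OF op_poly_vN[OF vN] x])
    have "l2_norm G x \<le> op_norm G B * l2_norm G (op_poly G q A x)"
      using op_norm_bound[OF B(1) qc] B(2)[OF x] by simp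
    also have "\<dots> \<le> K * l2_norm G (op_poly G q A x)" by (intro mult_right_mono) (simp_all add: K_def)
    finally have "(l2_norm G x)\<^sup>2 \<le> K\<^sup>2 * (l2_norm G (op_poly G q A x))\<^sup>2"
      by (metis l2_norm_nonneg power_mono power_mult_distrib)
    also have "(l2_norm G (op_poly G q A x))\<^sup>2
        = (N\<^sup>2)\<^sup>2 * (l2_norm G x)\<^sup>2 - 2 * N\<^sup>2 * Re (l2_inner G x ?z) + (l2_norm G ?z)\<^sup>2"
      unfolding q l2_norm_diff_sq[OF l2_scale[OF x] z]
      by (simp add: l2_inner_scale_left power_mult_distrib norm_power)
    also have "Re (l2_inner G x ?z) = (l2_norm G ?y)\<^sup>2"
      unfolding self_adjoint_inner[OF self_adjoint_op_poly[OF A] x y, of p, symmetric] l2_inner_self[OF y]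
      by (rule Re_complex_of_real)
    also have "K\<^sup>2 * ((N\<^sup>2)\<^sup>2 * (l2_norm G x)\<^sup>2 - 2 * N\<^sup>2 * (l2_norm G ?y)\<^sup>2 + (l2_norm G ?z)\<^sup>2)
        \<le> K\<^sup>2 * ((N\<^sup>2)\<^sup>2 * (l2_norm G x)\<^sup>2 - 2 * N\<^sup>2 * (l2_norm G ?y)\<^sup>2 + (N * l2_norm G ?y)\<^sup>2)"
      using op_norm_bound[OF P y] by (intro mult_left_mono add_left_mono power_mono) (auto simp: N_def)
    also have "\<dots> = (K * N)\<^sup>2 * (N\<^sup>2 * (l2_norm G x)\<^sup>2 - (l2_norm G ?y)\<^sup>2)"
      by (simp add: power2_eq_square algebra_simps)
    finally have "d * (l2_norm G x)\<^sup>2 \<le> d * ((K * N)\<^sup>2 * (N\<^sup>2 * (l2_norm G x)\<^sup>2 - (l2_norm G ?y)\<^sup>2))"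
      using d by (intro mult_left_mono) auto
    also have "\<dots> = N\<^sup>2 * (l2_norm G x)\<^sup>2 - (l2_norm G ?y)\<^sup>2"
      using K N by (simp add: d_def)
    finally show ?thesis by (simp add: left_diff_distrib)
  qed
  \<comment> \<open>\<open>N\<^sup>2 - d\<close> is not known to be nonnegative, hence the maximum;
    either way \<open>N'\<close> is a bound strictly below the norm.\<close>
  define N' where "N' = sqrt (max 0 (N\<^sup>2 - d))"
  have "op_norm G (op_poly G p A) \<le> N'"
  proof (rule op_norm_le)
    fix x assume x: "x \<in> group_l2 G"
    have "(l2_norm G (op_poly G p A x))\<^sup>2 \<le> max 0 (N\<^sup>2 - d) * (l2_norm G x)\<^sup>2"
      by (rule order_trans[OF bound[OF x]]) (simp add: mult_right_mono)
    also have "\<dots> = (N' * l2_norm G x)\<^sup>2" by (simp add: N'_def power_mult_distrib)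
    finally show "l2_norm G (op_poly G p A x) \<le> N' * l2_norm G x"
      by (rule power2_le_imp_le) (simp add: N'_def)
  qed (simp add: N'_def)
  moreover have "N' < N"
    unfolding N'_def using N d by (intro real_less_lsqrt) auto
  ultimately show False by (simp add: N_def)
qed

text \<open>On an empty spectrum the auxiliary bound holds with 0 and forces \<open>A\<close> to
  kill the unit series, while 0 being off the spectrum makes \<open>A\<close> invertible.\<close>

lemma real_spectrum_nonempty:
  assumes A: "self_adjoint G A"
  shows "real_spectrum G A \<noteq> {}"
proof
  assume e: "real_spectrum G A = {}"
  note vN = self_adjoint_vN[OF A]
  have X: "op_poly G [:0, 1:] A = A"
    using vN by (intro vN_eqI[of _ G]) (simp_all add: op_poly_X)
  have "op_norm G (op_poly G [:0, 1:] A) \<le> 0"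
  proof (rule op_norm_op_poly_le_aux[OF A])
    show "[:(op_norm G (op_poly G [:0, 1:] A))\<^sup>2:] - [:0, 1:] * [:0, 1:] \<noteq> 0" by simp
  qed (use e in auto)
  then have "l2_norm G (A (unit_series G)) \<le> 0"
    using op_norm_bound[OF vN, of "unit_series G"] by (simp add: X)
  then have "l2_norm G (A (unit_series G)) = 0" by (simp add: order_antisym)
  then have "A (unit_series G) = 0"
    by (rule l2_norm_eq_0[OF vN_closed[OF vN], rotated]) simp
  moreover have "A \<in> Units (vN_monoid G)"
    using e real_spectrum_iff[OF vN, of 0] X by simp
  then obtain B where B: "B \<in> group_vN G" "\<And>x. x \<in> group_l2 G \<Longrightarrow> B (A x) = x"
    using vN_Units_inverse by blast
  then have "B (A (unit_series G)) = unit_series G" "B 0 = 0" by (auto simp: vN_zero[OF B(1)])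
  ultimately have "l2_norm G (unit_series G) = 0" by simp
  then show False by simp
qed

text \<open>The remaining case is that the square of \<open>p\<close> is the constant
  \<open>?N\<^sup>2\<close>. Then the absolute value of \<open>p\<close> equals the norm at every
  point, and one point of the spectrum suffices.\<close>

lemma op_norm_op_poly_le:
  assumes A: "self_adjoint G A"
    and b: "\<And>t. t \<in> real_spectrum G A \<Longrightarrow> \<bar>poly p t\<bar> \<le> C"
  shows "op_norm G (op_poly G p A) \<le> C"
proof -
  let ?N = "op_norm G (op_poly G p A)"
  note vN = self_adjoint_vN[OF A]
  obtain t where t: "t \<in> real_spectrum G A" using real_spectrum_nonempty[OF A] by blast
  have C: "0 \<le> C" using b[OF t] by linarith
  show ?thesis
  proof (cases "[:?N\<^sup>2:] - p * p = 0")
    case True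
    then have "poly ([:?N\<^sup>2:] - p * p) t = 0" by simp
    then have "?N\<^sup>2 = \<bar>poly p t\<bar>\<^sup>2" by (simp add: power2_eq_square)
    then have "?N = \<bar>poly p t\<bar>"
      using op_norm_nonneg[OF op_poly_vN[OF vN]] by (metis abs_ge_zero power2_eq_iff_nonneg)
    then show ?thesis using b[OF t] by simp
  qed (rule op_norm_op_poly_le_aux[OF A C b])
qed

end

section \<open>Continuous functional calculus\<close>

text \<open>The explicit rate is kept beside the uniform limit: it supplies Cauchy bounds for
  operators and a single polynomial of prescribed accuracy.\<close>

lemma Weierstrass_polynomials:
  fixes u :: "real \<Rightarrow> real"
  assumes "continuous_on {a..b} u"
  obtains p :: "nat \<Rightarrow> real poly"
  where "uniform_limit {a..b} (\<lambda>n. poly (p n)) u sequentially"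
    "\<And>n t. t \<in> {a..b} \<Longrightarrow> \<bar>poly (p n) t - u t\<bar> \<le> inverse (real (Suc n))"
proof -
  have "\<exists>p :: real poly. \<forall>t\<in>{a..b}. \<bar>poly p t - u t\<bar> \<le> inverse (real (Suc n))" for n
  proof -
    have "0 < inverse (real (Suc n))" by simp
    then obtain g where g: "real_polynomial_function g"
      "\<And>t. t \<in> {a..b} \<Longrightarrow> \<bar>u t - g t\<bar> < inverse (real (Suc n))"
      using Stone_Weierstrass_real_polynomial_function[OF compact_Icc assms] by blast
    obtain c k where "g = (\<lambda>t. \<Sum>i\<le>k. c i * t ^ i)"
      using g(1) unfolding real_polynomial_function_iff_sum by blast
    then have "g = poly (\<Sum>i\<le>k. monom (c i) i)" by (simp add: fun_eq_iff poly_sum poly_monom)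
    moreover have "\<bar>g t - u t\<bar> \<le> inverse (real (Suc n))" if "t \<in> {a..b}" for t
      using g(2)[OF that] by linarith
    ultimately show ?thesis by metis
  qed
  then obtain p :: "nat \<Rightarrow> real poly"
    where p: "\<And>n t. t \<in> {a..b} \<Longrightarrow> \<bar>poly (p n) t - u t\<bar> \<le> inverse (real (Suc n))"
    by metis
  have "uniform_limit {a..b} (\<lambda>n. poly (p n)) u sequentially"
  proof (rule uniform_limitI)
    fix e :: real assume "0 < e"
    then have "\<forall>\<^sub>F n in sequentially. inverse (real (Suc n)) < e"
      using LIMSEQ_inverse_real_of_nat by (rule order_tendstoD(2)[rotated])
    then show "\<forall>\<^sub>F n in sequentially. \<forall>t\<in>{a..b}. dist (poly (p n) t) (u t) < e"
    proof eventually_elim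
      case (elim n)
      show ?case using le_less_trans[OF p elim] by (simp add: dist_real_def)
    qed
  qed
  then show thesis using p that by blast
qed

text \<open>The order relation \<open>m \<le> A \<le> M\<close> through the quadratic form. Working
  on the interval instead of the spectrum lets one function and one polynomial serve operators over
  different groups.\<close>

definition op_between :: "('a, 'm) monoid_scheme \<Rightarrow> 'a l2_op \<Rightarrow> real \<Rightarrow> real \<Rightarrow> bool" where
  "op_between G A m M \<longleftrightarrow> self_adjoint G A \<and>
     (\<forall>x\<in>group_l2 G. m * (l2_norm G x)\<^sup>2 \<le> Re (l2_inner G (A x) x) \<and>
        Re (l2_inner G (A x) x) \<le> M * (l2_norm G x)\<^sup>2)"

context group
begin

text \<open>For \<open>t\<close> off the interval, either \<open>A - t\<close> or
  \<open>t - A\<close> has a form bounded below by a positive constant.\<close>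

lemma real_spectrum_subset:
  assumes A: "op_between G A m M"
  shows "real_spectrum G A \<subseteq> {m..M}"
proof
  fix t assume t: "t \<in> real_spectrum G A"
  have sa: "self_adjoint G A" using A by (simp add: op_between_def)
  note vN = self_adjoint_vN[OF sa]
  have inner: "Re (l2_inner G (op_poly G [:a, b:] A x) x) = a * (l2_norm G x)\<^sup>2 + b * Re (l2_inner G (A x) x)"
    if x: "x \<in> group_l2 G" for a b x
    unfolding op_poly_X[OF vN x] using x vN_closed[OF vN x] by (simp add: l2_inner_simps l2_inner_self)
  have nu: "op_poly G [:- t, 1:] A \<notin> Units (vN_monoid G)"
    using t real_spectrum_iff[OF vN] by blast
  have "m \<le> t"
  proof (rule ccontr)
    assume "\<not> m \<le> t"
    then have "op_poly G [:- t, 1:] A \<in> Units (vN_monoid G)"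
      using A by (intro self_adjoint_Units[of _ "m - t"] self_adjoint_op_poly sa)
        (auto simp: inner op_between_def left_diff_distrib)
    then show False using nu by blast
  qed
  moreover have "t \<le> M"
  proof (rule ccontr)
    assume "\<not> t \<le> M"
    then have "op_poly G [:t, -1:] A \<in> Units (vN_monoid G)"
      using A by (intro self_adjoint_Units[of _ "t - M"] self_adjoint_op_poly sa)
        (auto simp: inner op_between_def left_diff_distrib)
    \<comment> \<open>The sign is corrected by an invertible constant.\<close>
    then have "op_poly G ([:-1:] * [:t, -1:]) A \<in> Units (vN_monoid G)"
      by (intro op_poly_mult_Units vN op_poly_const_Units) auto
    then show False using nu by simp
  qed
  ultimately show "t \<in> {m..M}" by simp
qed

text \<open>Polynomials close to each other on the spectrum give operators close in norm. The
  spectrum, not an enclosing interval, must appear because \<open>func_calc\<close> admits every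
  sequence converging there.\<close>

lemma op_lim_transfer:
  assumes A: "self_adjoint G A" and lim: "op_lim G (\<lambda>n. op_poly G (q n) A) B"
    and q: "uniform_limit (real_spectrum G A) (\<lambda>n. poly (q n)) u sequentially"
    and p: "uniform_limit (real_spectrum G A) (\<lambda>n. poly (p n)) u sequentially"
  shows "op_lim G (\<lambda>n. op_poly G (p n) A) B"
proof -
  note vN = self_adjoint_vN[OF A]
  define d where "d n = op_norm G (op_poly G (p n - q n) A)" for n
  have d: "d \<longlonglongrightarrow> 0"
  proof (rule LIMSEQ_I)
    fix r :: real assume "0 < r"
    have "uniform_limit (real_spectrum G A) (\<lambda>n t. poly (p n) t - poly (q n) t) (\<lambda>t. u t - u t) sequentially"
      by (rule uniform_limit_minus[OF p q])
    then have "\<forall>\<^sub>F n in sequentially. \<forall>t\<in>real_spectrum G A. \<bar>poly (p n) t - poly (q n) t\<bar> < r / 2"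
      using \<open>0 < r\<close> by (auto dest!: uniform_limitD[where e="r / 2"] simp: dist_real_def)
    then obtain N where N: "\<And>n t. N \<le> n \<Longrightarrow> t \<in> real_spectrum G A \<Longrightarrow> \<bar>poly (p n) t - poly (q n) t\<bar> < r / 2"
      unfolding eventually_sequentially by blast
    have "\<bar>d n\<bar> < r" if "N \<le> n" for n
    proof -
      have "d n \<le> r / 2"
        unfolding d_def using N[OF that] by (intro op_norm_op_poly_le[OF A]) (auto intro: less_imp_le)
      moreover have "0 \<le> d n" unfolding d_def using vN by (intro op_norm_nonneg) auto
      ultimately show ?thesis using \<open>0 < r\<close> by simp
    qed
    then show "\<exists>N. \<forall>n\<ge>N. norm (d n - 0) < r" by auto
  qed
  obtain e where e: "e \<longlonglongrightarrow> 0" "\<And>n x. x \<in> group_l2 G \<Longrightarrow> l2_norm G (op_poly G (q n) A x - B x) \<le> e n * l2_norm G x"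
    using op_lim_rate[OF lim] by blast
  show ?thesis
  proof (rule op_limI)
    show "(\<lambda>n. d n + e n) \<longlonglongrightarrow> 0" using tendsto_add[OF d e(1)] by simp
    fix n x assume x: "x \<in> group_l2 G"
    note P = vN_closed[OF op_poly_vN[OF vN] x]
    have "l2_norm G (op_poly G (p n) A x - B x)
        \<le> l2_norm G (op_poly G (p n) A x - op_poly G (q n) A x) + l2_norm G (op_poly G (q n) A x - B x)"
      by (intro l2_norm_triangle_diff P vN_closed[OF op_lim_vN(2)[OF lim] x])
    also have "\<dots> \<le> d n * l2_norm G x + e n * l2_norm G x"
      unfolding d_def op_poly_diff[OF x, symmetric]
      by (intro add_mono op_norm_bound e(2) op_poly_vN vN x)
    finally show "l2_norm G (op_poly G (p n) A x - B x) \<le> (d n + e n) * l2_norm G x"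
      by (simp add: algebra_simps)
  qed (use vN op_lim_vN(2)[OF lim] in auto)
qed

context
  fixes A and m M :: real
  assumes A: "op_between G A m M"
begin

lemma op_between_self_adjoint: "self_adjoint G A"
  using A by (simp add: op_between_def)

lemmas op_between_vN = self_adjoint_vN[OF op_between_self_adjoint]

lemma op_norm_op_poly_le_sup:
  assumes "\<And>t. t \<in> {m..M} \<Longrightarrow> \<bar>poly p t\<bar> \<le> C"
  shows "op_norm G (op_poly G p A) \<le> C"
  using assms real_spectrum_subset[OF A] by (intro op_norm_op_poly_le[OF op_between_self_adjoint]) auto

lemma func_calc_lim:
  assumes u: "continuous_on {m..M} u"
    and p: "uniform_limit {m..M} (\<lambda>n. poly (p n)) u sequentially"
  shows "op_lim G (\<lambda>n. op_poly G (p n) A) (func_calc G u A)"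
proof -
  note sa = op_between_self_adjoint and vN = op_between_vN
  obtain q where q: "uniform_limit {m..M} (\<lambda>n. poly (q n)) u sequentially"
    "\<And>n t. t \<in> {m..M} \<Longrightarrow> \<bar>poly (q n) t - u t\<bar> \<le> inverse (real (Suc n))"
    by (rule Weierstrass_polynomials[OF u]) blast
  obtain B where B: "op_lim G (\<lambda>n. op_poly G (q n) A) B"
  proof (rule op_lim_exists[of "\<lambda>n. op_poly G (q n) A" "\<lambda>n. 2 * inverse (real (Suc n))"])
    show "(\<lambda>n. 2 * inverse (real (Suc n))) \<longlonglongrightarrow> 0"
      using LIMSEQ_inverse_real_of_nat by (rule tendsto_mult_right_zero)
    fix k n :: nat and x assume nk: "n \<le> k" and x: "x \<in> group_l2 G"
    have "l2_norm G (op_poly G (q k) A x - op_poly G (q n) A x)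
        \<le> op_norm G (op_poly G (q k - q n) A) * l2_norm G x"
      unfolding op_poly_diff[OF x, symmetric] by (intro op_norm_bound op_poly_vN vN x)
    also have "\<dots> \<le> 2 * inverse (real (Suc n)) * l2_norm G x"
    proof (intro mult_right_mono op_norm_op_poly_le_sup)
      fix t assume t: "t \<in> {m..M}"
      have "inverse (real (Suc k)) \<le> inverse (real (Suc n))"
        using nk by (intro le_imp_inverse_le) auto
      then show "\<bar>poly (q k - q n) t\<bar> \<le> 2 * inverse (real (Suc n))"
        using q(2)[OF t, of k] q(2)[OF t, of n] unfolding poly_diff by linarith
    qed simp
    finally show "l2_norm G (op_poly G (q k) A x - op_poly G (q n) A x) \<le> 2 * inverse (real (Suc n)) * l2_norm G x" .
  qed (use vN in auto)
  note sub = uniform_limit_on_subset[OF _ real_spectrum_subset[OF A]]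
  have lim: "op_lim G (\<lambda>n. op_poly G (r n) A) B"
    if "uniform_limit (real_spectrum G A) (\<lambda>n. poly (r n)) u sequentially" for r
    using op_lim_transfer[OF sa B sub[OF q(1)] that] .
  have "func_calc G u A = B"
    unfolding func_calc_def real_spectrum_def[symmetric]
  proof (rule the_equality)
    show "B \<in> group_vN G \<and> (\<forall>p. uniform_limit (real_spectrum G A) (\<lambda>n. poly (p n)) u sequentially \<longrightarrow>
        (\<lambda>n. op_norm G (op_minus G (op_poly G (p n) A) B)) \<longlonglongrightarrow> 0)"
      using lim op_lim_vN(2)[OF B] by (simp add: op_lim_def)
    fix B' assume "B' \<in> group_vN G \<and> (\<forall>p. uniform_limit (real_spectrum G A) (\<lambda>n. poly (p n)) u sequentially \<longrightarrow>
        (\<lambda>n. op_norm G (op_minus G (op_poly G (p n) A) B')) \<longlonglongrightarrow> 0)"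
    then have "op_lim G (\<lambda>n. op_poly G (q n) A) B'"
      using sub[OF q(1)] vN by (simp add: op_lim_def)
    then show "B' = B" using B by (rule op_lim_unique)
  qed
  then show ?thesis using lim[OF sub[OF p]] by simp
qed

lemma func_calc_eqI:
  assumes u: "continuous_on {m..M} u"
    and p: "uniform_limit {m..M} (\<lambda>n. poly (p n)) u sequentially"
    and "op_lim G (\<lambda>n. op_poly G (p n) A) B"
  shows "func_calc G u A = B"
  using op_lim_unique[OF func_calc_lim[OF u p] assms(3)] .

lemma func_calc_vN:
  assumes u: "continuous_on {m..M} u"
  shows "func_calc G u A \<in> group_vN G"
proof -
  obtain p where "uniform_limit {m..M} (\<lambda>n. poly (p n)) u sequentially"
    by (rule Weierstrass_polynomials[OF u]) blast
  from func_calc_lim[OF u this] show ?thesis by (rule op_lim_vN(2))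
qed

lemma func_calc_cong:
  assumes u: "continuous_on {m..M} u" and "\<And>t. t \<in> {m..M} \<Longrightarrow> u t = v t"
  shows "func_calc G u A = func_calc G v A"
proof -
  have v: "continuous_on {m..M} v" by (rule continuous_on_eq[OF assms])
  obtain p where p: "uniform_limit {m..M} (\<lambda>n. poly (p n)) v sequentially"
    by (rule Weierstrass_polynomials[OF v]) blast
  then have "uniform_limit {m..M} (\<lambda>n. poly (p n)) u sequentially"
    using assms(2) by (simp add: uniform_limit_iff)
  then show ?thesis by (rule func_calc_eqI[OF u _ func_calc_lim[OF v p]])
qed

lemma func_calc_poly: "func_calc G (poly p) A = op_poly G p A"
proof (rule func_calc_eqI[where p="\<lambda>_. p"])
  show "op_lim G (\<lambda>_. op_poly G p A) (op_poly G p A)"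
    by (intro op_lim_const op_poly_vN op_between_vN)
  show "continuous_on {m..M} (poly p)"
    by (rule continuous_on_poly[OF continuous_on_id])
qed (simp add: uniform_limit_iff)

lemma func_calc_self_adjoint:
  assumes u: "continuous_on {m..M} u"
  shows "self_adjoint G (func_calc G u A)"
proof -
  obtain p where p: "uniform_limit {m..M} (\<lambda>n. poly (p n)) u sequentially"
    by (rule Weierstrass_polynomials[OF u]) blast
  note lim = func_calc_lim[OF u p]
  have "l2_inner G (func_calc G u A x) y = l2_inner G x (func_calc G u A y)"
    if x: "x \<in> group_l2 G" and y: "y \<in> group_l2 G" for x y
  proof (rule LIMSEQ_unique)
    show "(\<lambda>n. l2_inner G (op_poly G (p n) A x) y) \<longlonglongrightarrow> l2_inner G (func_calc G u A x) y"
      by (rule op_lim_inner[OF lim x y])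
    have "l2_inner G (op_poly G (p n) A x) y = cnj (l2_inner G (op_poly G (p n) A y) x)" for n
      unfolding self_adjoint_inner[OF self_adjoint_op_poly[OF op_between_self_adjoint] x y]
      by (rule l2_inner_commute)
    moreover have "(\<lambda>n. cnj (l2_inner G (op_poly G (p n) A y) x)) \<longlonglongrightarrow> cnj (l2_inner G (func_calc G u A y) x)"
      by (rule tendsto_cnj[OF op_lim_inner[OF lim y x]])
    ultimately show "(\<lambda>n. l2_inner G (op_poly G (p n) A x) y) \<longlonglongrightarrow> l2_inner G x (func_calc G u A y)"
      by (simp only: l2_inner_commute[of G x "func_calc G u A y"])
  qed
  then show ?thesis using func_calc_vN[OF u] by (simp add: self_adjoint_def)
qed

lemma func_calc_mult:
  assumes f: "continuous_on {m..M} f" and g: "continuous_on {m..M} g"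
  shows "func_calc G (\<lambda>t. f t * g t) A = compose (group_l2 G) (func_calc G f A) (func_calc G g A)"
proof -
  obtain p where p: "uniform_limit {m..M} (\<lambda>n. poly (p n)) f sequentially"
    by (rule Weierstrass_polynomials[OF f]) blast
  obtain q where q: "uniform_limit {m..M} (\<lambda>n. poly (q n)) g sequentially"
    by (rule Weierstrass_polynomials[OF g]) blast
  have eq: "compose (group_l2 G) (op_poly G (p n) A) (op_poly G (q n) A) = op_poly G (p n * q n) A" for n
    using op_between_vN by (intro vN_eqI[of _ G]) (simp_all add: op_apply op_poly_mult)
  \<comment> \<open>Products of uniform limits need bounded limit functions, which compactness of
    the interval provides.\<close>
  have "uniform_limit {m..M} (\<lambda>n t. poly (p n) t * poly (q n) t) (\<lambda>t. f t * g t) sequentially"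
    using f g by (intro uniform_lim_mult p q compact_imp_bounded compact_continuous_image compact_Icc)
  then have "uniform_limit {m..M} (\<lambda>n. poly (p n * q n)) (\<lambda>t. f t * g t) sequentially"
    by (simp add: uniform_limit_iff)
  then show ?thesis
    using op_lim_compose[OF func_calc_lim[OF f p] func_calc_lim[OF g q]] f g unfolding eq
    by (intro func_calc_eqI[where p="\<lambda>n. p n * q n"]) (auto intro: continuous_intros)
qed

lemma func_calc_add_const:
  assumes f: "continuous_on {m..M} f"
  shows "func_calc G (\<lambda>t. f t + c) A = op_plus_scalar G (func_calc G f A) (of_real c)"
proof -
  obtain p where p: "uniform_limit {m..M} (\<lambda>n. poly (p n)) f sequentially"
    by (rule Weierstrass_polynomials[OF f]) blast
  have eq: "op_plus_scalar G (op_poly G (p n) A) (of_real c) = op_poly G (p n + [:c:]) A" for n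
    using op_between_vN by (intro vN_eqI[of _ G]) (simp_all add: op_apply op_poly_add)
  have "uniform_limit {m..M} (\<lambda>n t. poly (p n) t + c) (\<lambda>t. f t + c) sequentially"
    by (intro uniform_limit_add p uniform_limit_const)
  then have "uniform_limit {m..M} (\<lambda>n. poly (p n + [:c:])) (\<lambda>t. f t + c) sequentially"
    by (simp add: uniform_limit_iff)
  then show ?thesis
    using op_lim_plus_scalar[OF func_calc_lim[OF f p], of "of_real c"] f unfolding eq
    by (intro func_calc_eqI[where p="\<lambda>n. p n + [:c:]"]) (auto intro: continuous_intros)
qed

text \<open>The bound \<open>C + 2 * r n\<close> for the approximating polynomials survives in the
  limit. With \<open>g\<close> constant the lemma encloses the quadratic form; with \<open>g\<close>
  a nearby function it gives continuity in the function.\<close>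

lemma func_calc_diff_le:
  assumes f: "continuous_on {m..M} f" and g: "continuous_on {m..M} g"
    and C: "\<And>t. t \<in> {m..M} \<Longrightarrow> \<bar>f t - g t\<bar> \<le> C" and x: "x \<in> group_l2 G"
  shows "l2_norm G (func_calc G f A x - func_calc G g A x) \<le> C * l2_norm G x"
proof -
  note vN = op_between_vN
  obtain p where p: "uniform_limit {m..M} (\<lambda>n. poly (p n)) f sequentially"
    "\<And>n t. t \<in> {m..M} \<Longrightarrow> \<bar>poly (p n) t - f t\<bar> \<le> inverse (real (Suc n))"
    by (rule Weierstrass_polynomials[OF f]) blast
  obtain q where q: "uniform_limit {m..M} (\<lambda>n. poly (q n)) g sequentially"
    "\<And>n t. t \<in> {m..M} \<Longrightarrow> \<bar>poly (q n) t - g t\<bar> \<le> inverse (real (Suc n))"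
    by (rule Weierstrass_polynomials[OF g]) blast
  define r where "r n = inverse (real (Suc n))" for n
  let ?F = "func_calc G f A x" and ?H = "func_calc G g A x"
  define P where "P n = op_poly G (p n) A x" for n
  define Q where "Q n = op_poly G (q n) A x" for n
  have mem: "P n \<in> group_l2 G" "Q n \<in> group_l2 G" "?F \<in> group_l2 G" "?H \<in> group_l2 G" for n
    using vN_closed[OF op_poly_vN[OF vN] x] vN_closed[OF func_calc_vN x] f g by (auto simp: P_def Q_def)
  have PF: "(\<lambda>n. l2_norm G (P n - ?F)) \<longlonglongrightarrow> 0"
    unfolding P_def by (rule op_lim_pointwise[OF func_calc_lim[OF f p(1)] x])
  have QH: "(\<lambda>n. l2_norm G (Q n - ?H)) \<longlonglongrightarrow> 0"
    unfolding Q_def by (rule op_lim_pointwise[OF func_calc_lim[OF g q(1)] x])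
  have r: "r \<longlonglongrightarrow> 0" unfolding r_def by (rule LIMSEQ_inverse_real_of_nat)
  have "l2_norm G (?F - ?H)
      \<le> l2_norm G (P n - ?F) + (C + 2 * r n) * l2_norm G x + l2_norm G (Q n - ?H)" for n
  proof -
    have "l2_norm G (P n - Q n) \<le> op_norm G (op_poly G (p n - q n) A) * l2_norm G x"
      unfolding P_def Q_def op_poly_diff[OF x, symmetric] by (intro op_norm_bound op_poly_vN vN x)
    also have "\<dots> \<le> (C + 2 * r n) * l2_norm G x"
    proof (intro mult_right_mono op_norm_op_poly_le_sup)
      fix t assume t: "t \<in> {m..M}"
      show "\<bar>poly (p n - q n) t\<bar> \<le> C + 2 * r n"
        using p(2)[OF t, of n] q(2)[OF t, of n] C[OF t] unfolding poly_diff r_def by linarith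
    qed simp
    finally have "l2_norm G (P n - Q n) \<le> (C + 2 * r n) * l2_norm G x" .
    moreover have "l2_norm G (?F - ?H) \<le> l2_norm G (?F - P n) + l2_norm G (P n - ?H)"
      by (intro l2_norm_triangle_diff mem)
    moreover have "l2_norm G (P n - ?H) \<le> l2_norm G (P n - Q n) + l2_norm G (Q n - ?H)"
      by (intro l2_norm_triangle_diff mem)
    ultimately show ?thesis using l2_norm_minus_commute[of G ?F "P n"] by linarith
  qed
  moreover have "(\<lambda>n. l2_norm G (P n - ?F) + (C + 2 * r n) * l2_norm G x + l2_norm G (Q n - ?H))
      \<longlonglongrightarrow> 0 + (C + 2 * 0) * l2_norm G x + 0"
    by (intro tendsto_intros PF QH r)
  ultimately have "l2_norm G (?F - ?H) \<le> 0 + (C + 2 * 0) * l2_norm G x + 0"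
    by (intro LIMSEQ_le_const) auto
  then show ?thesis by simp
qed

text \<open>Positivity without square roots: \<open>u\<close> stays within \<open>?r\<close> of the
  midpoint \<open>?c\<close>, hence by Cauchy-Schwarz the form of \<open>u(A)\<close> stays within
  \<open>?r\<close> of \<open>?c\<close>, relative to the squared norm.\<close>

lemma func_calc_between:
  assumes u: "continuous_on {m..M} u" and ab: "\<And>t. t \<in> {m..M} \<Longrightarrow> a \<le> u t \<and> u t \<le> b"
  shows "op_between G (func_calc G u A) a b"
proof -
  let ?c = "(a + b) / 2" and ?r = "(b - a) / 2"
  have "a * (l2_norm G x)\<^sup>2 \<le> Re (l2_inner G (func_calc G u A x) x) \<and>
      Re (l2_inner G (func_calc G u A x) x) \<le> b * (l2_norm G x)\<^sup>2" if x: "x \<in> group_l2 G" for x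
  proof -
    note Ux = vN_closed[OF func_calc_vN[OF u] x]
    have "func_calc G (poly [:?c:]) A x = of_real ?c *\<^sub>c x"
      unfolding func_calc_poly using x by simp
    moreover have "\<bar>u t - poly [:?c:] t\<bar> \<le> ?r" if "t \<in> {m..M}" for t
      using ab[OF that] by (auto simp: abs_if field_simps)
    ultimately have le: "l2_norm G (func_calc G u A x - of_real ?c *\<^sub>c x) \<le> ?r * l2_norm G x"
      using func_calc_diff_le[OF u, of "poly [:?c:]" ?r x] x by (simp add: continuous_intros)
    have mem: "func_calc G u A x - of_real ?c *\<^sub>c x \<in> group_l2 G"
      by (intro l2_diff Ux l2_scale x)
    have "\<bar>Re (l2_inner G (func_calc G u A x - of_real ?c *\<^sub>c x) x)\<bar>
        \<le> cmod (l2_inner G (func_calc G u A x - of_real ?c *\<^sub>c x) x)" by (rule abs_Re_le_cmod)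
    also have "\<dots> \<le> l2_norm G (func_calc G u A x - of_real ?c *\<^sub>c x) * l2_norm G x"
      by (rule l2_inner_Cauchy_Schwarz[OF mem x])
    also have "\<dots> \<le> ?r * l2_norm G x * l2_norm G x"
      using le by (intro mult_right_mono) auto
    finally have "\<bar>Re (l2_inner G (func_calc G u A x) x) - ?c * (l2_norm G x)\<^sup>2\<bar> \<le> ?r * (l2_norm G x)\<^sup>2"
      using l2_inner_diff_left[OF Ux l2_scale[OF x] x] l2_inner_self[OF x]
      by (simp add: l2_inner_scale_left power2_eq_square mult.assoc)
    then show ?thesis by (auto simp: abs_if field_simps split: if_splits)
  qed
  then show ?thesis using func_calc_self_adjoint[OF u] by (simp add: op_between_def)
qed

end

end

section \<open>Substitution in the calculus, and its trace\<close>

context group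
begin

context
  fixes A and m M :: real
  assumes A: "op_between G A m M"
begin

lemma op_poly_func_calc:
  assumes u: "continuous_on {m..M} u"
  shows "op_poly G q (func_calc G u A) = func_calc G (\<lambda>t. poly q (u t)) A"
proof (induction q)
  case 0
  have "func_calc G (poly 0) A = op_poly G 0 A" by (rule func_calc_poly[OF A])
  moreover have "(\<lambda>t. poly 0 (u t)) = poly 0" by (simp add: fun_eq_iff)
  moreover have "op_poly G 0 (func_calc G u A) = op_poly G 0 A" by (simp add: op_poly_def)
  ultimately show ?case by simp
next
  case (pCons c q)
  let ?B = "func_calc G u A"
  have B: "?B \<in> group_vN G" by (rule func_calc_vN[OF A u])
  have qu: "continuous_on {m..M} (\<lambda>t. poly q (u t))" by (intro continuous_intros u)
  have uqu: "continuous_on {m..M} (\<lambda>t. u t * poly q (u t))" by (intro continuous_intros u qu)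
  have "op_poly G (pCons c q) ?B
      = op_plus_scalar G (compose (group_l2 G) ?B (op_poly G q ?B)) (of_real c)"
    using B by (intro vN_eqI[of _ G]) (simp_all add: op_apply op_poly_pCons add.commute)
  also have "\<dots> = op_plus_scalar G (func_calc G (\<lambda>t. u t * poly q (u t)) A) (of_real c)"
    unfolding pCons func_calc_mult[OF A u qu] ..
  also have "\<dots> = func_calc G (\<lambda>t. u t * poly q (u t) + c) A"
    by (rule func_calc_add_const[OF A uqu, symmetric])
  finally show ?case by (simp add: add.commute)
qed

text \<open>For a polynomial outer function the rule is algebra. Replacing \<open>v\<close> by
  polynomials on \<open>{a..b}\<close> causes the same error after substituting \<open>u\<close>, so
  both sides are limits of the same operators.\<close>

lemma func_calc_compose:
  assumes u: "continuous_on {m..M} u" and ab: "\<And>t. t \<in> {m..M} \<Longrightarrow> a \<le> u t \<and> u t \<le> b"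
    and v: "continuous_on {a..b} v"
  shows "func_calc G v (func_calc G u A) = func_calc G (\<lambda>t. v (u t)) A"
proof -
  have B: "op_between G (func_calc G u A) a b" by (rule func_calc_between[OF A u ab])
  obtain q where q: "uniform_limit {a..b} (\<lambda>n. poly (q n)) v sequentially"
    "\<And>n t. t \<in> {a..b} \<Longrightarrow> \<bar>poly (q n) t - v t\<bar> \<le> inverse (real (Suc n))"
    by (rule Weierstrass_polynomials[OF v]) blast
  have qu: "continuous_on {m..M} (\<lambda>t. poly (q n) (u t))" for n by (intro continuous_intros u)
  have vu: "continuous_on {m..M} (\<lambda>t. v (u t))"
    by (rule continuous_on_compose2[OF v u]) (use ab in auto)
  have "op_lim G (\<lambda>n. op_poly G (q n) (func_calc G u A)) (func_calc G (\<lambda>t. v (u t)) A)"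
    unfolding op_poly_func_calc[OF u]
  proof (rule op_limI[OF _ _ LIMSEQ_inverse_real_of_nat])
    fix n x assume x: "x \<in> group_l2 G"
    show "l2_norm G (func_calc G (\<lambda>t. poly (q n) (u t)) A x - func_calc G (\<lambda>t. v (u t)) A x)
        \<le> inverse (real (Suc n)) * l2_norm G x"
      by (rule func_calc_diff_le[OF A qu vu _ x], rule q(2)) (use ab in auto)
  qed (intro func_calc_vN[OF A] qu vu)+
  then show ?thesis by (rule func_calc_eqI[OF B v q(1)])
qed

lemma vN_trace_func_calc_lim:
  assumes u: "continuous_on {m..M} u" and p: "uniform_limit {m..M} (\<lambda>n. poly (p n)) u sequentially"
  shows "(\<lambda>n. vN_trace G (op_poly G (p n) A)) \<longlonglongrightarrow> vN_trace G (func_calc G u A)"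
  unfolding vN_trace_def by (intro op_lim_inner func_calc_lim[OF A u p]) auto

lemma vN_trace_func_calc_add:
  assumes f: "continuous_on {m..M} f" and g: "continuous_on {m..M} g"
  shows "vN_trace G (func_calc G (\<lambda>t. f t + g t) A) = vN_trace G (func_calc G f A) + vN_trace G (func_calc G g A)"
proof -
  note vN = op_between_vN[OF A]
  obtain p where p: "uniform_limit {m..M} (\<lambda>n. poly (p n)) f sequentially"
    by (rule Weierstrass_polynomials[OF f]) blast
  obtain q where q: "uniform_limit {m..M} (\<lambda>n. poly (q n)) g sequentially"
    by (rule Weierstrass_polynomials[OF g]) blast
  have "uniform_limit {m..M} (\<lambda>n t. poly (p n) t + poly (q n) t) (\<lambda>t. f t + g t) sequentially"
    by (intro uniform_limit_add p q)
  then have pq: "uniform_limit {m..M} (\<lambda>n. poly (p n + q n)) (\<lambda>t. f t + g t) sequentially"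
    by (simp add: uniform_limit_iff)
  have add: "vN_trace G (op_poly G (p n + q n) A)
      = vN_trace G (op_poly G (p n) A) + vN_trace G (op_poly G (q n) A)" for n
    unfolding vN_trace_def op_poly_add[OF unit_series_l2(1)]
    by (intro l2_inner_add_left vN_closed[OF op_poly_vN[OF vN]] unit_series_l2)
  have fg: "continuous_on {m..M} (\<lambda>t. f t + g t)" by (intro continuous_intros f g)
  show ?thesis
    using vN_trace_func_calc_lim[OF fg pq] unfolding add
    by (rule LIMSEQ_unique) (intro tendsto_add vN_trace_func_calc_lim f g p q)
qed

text \<open>The trace is the quadratic form at the unit series, so it is nonnegative on
  \<open>h \<ge> 0\<close>; that series has norm one, so a constant \<open>c\<close> shifts the
  trace by exactly \<open>c\<close>. The slack \<open>c\<close> later becomes a factor of a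
  determinant.\<close>

lemma vN_trace_func_calc_mono:
  assumes f: "continuous_on {m..M} f" and g: "continuous_on {m..M} g"
    and le: "\<And>t. t \<in> {m..M} \<Longrightarrow> f t \<le> g t + c"
  shows "Re (vN_trace G (func_calc G f A)) \<le> Re (vN_trace G (func_calc G g A)) + c"
proof -
  define h where "h t = g t + c - f t" for t
  have h: "continuous_on {m..M} h" unfolding h_def by (intro continuous_intros f g)
  have "bounded (h ` {m..M})"
    by (intro compact_imp_bounded compact_continuous_image h compact_Icc)
  then obtain b where b: "\<forall>t\<in>{m..M}. \<bar>h t\<bar> \<le> b" unfolding bounded_iff by auto
  have "0 \<le> h t \<and> h t \<le> b" if "t \<in> {m..M}" for t
    using le[OF that] bspec[OF b that] by (auto simp: h_def)
  from func_calc_between[OF A h this]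
  have pos: "0 \<le> Re (vN_trace G (func_calc G h A))"
    unfolding op_between_def vN_trace_def by auto
  have gc: "continuous_on {m..M} (\<lambda>t. g t + c)" by (intro continuous_intros g)
  have "vN_trace G (func_calc G (\<lambda>t. f t + h t) A)
      = vN_trace G (func_calc G f A) + vN_trace G (func_calc G h A)"
    by (rule vN_trace_func_calc_add[OF f h])
  also have "(\<lambda>t. f t + h t) = (\<lambda>t. g t + c)" by (simp add: h_def)
  also have "vN_trace G (func_calc G (\<lambda>t. g t + c) A) = vN_trace G (func_calc G g A) + of_real c"
    unfolding vN_trace_def func_calc_add_const[OF A g] op_apply[OF unit_series_l2(1)]
    by (subst l2_inner_add_left)
       (simp_all add: vN_closed[OF func_calc_vN[OF A g]] l2_inner_scale_left l2_inner_self)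
  finally have "vN_trace G (func_calc G g A) + of_real c
      = vN_trace G (func_calc G f A) + vN_trace G (func_calc G h A)" .
  from arg_cong[OF this, of Re] have "Re (vN_trace G (func_calc G g A)) + c
      = Re (vN_trace G (func_calc G f A)) + Re (vN_trace G (func_calc G h A))"
    by simp
  then show ?thesis using pos by simp
qed

end

end

section \<open>The Fuglede--Kadison determinant\<close>

text \<open>Absolute value, shift and logarithm are merged into one function of \<open>S\<close>,
  because \<open>S\<close> comes from an element of the summable algebra upstairs whereas the
  absolute value is itself only a limit.\<close>

definition fk_log_trace :: "('a, 'm) monoid_scheme \<Rightarrow> 'a l2_op \<Rightarrow> real \<Rightarrow> real" where
  "fk_log_trace G S \<epsilon> = Re (vN_trace G (func_calc G (\<lambda>s. ln (sqrt s + \<epsilon>)) S))"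

lemma continuous_on_ln_sqrt:
  "0 < \<epsilon> \<Longrightarrow> continuous_on {0..M} (\<lambda>s. ln (sqrt s + \<epsilon>))"
  by (intro continuous_intros) (auto simp: add_nonneg_eq_0_iff)

context group
begin

text \<open>Uniqueness comes from testing the two candidates against the vector
  \<open>C y - B y\<close>.\<close>

lemma op_adjoint_eqI:
  assumes "B \<in> group_vN G"
    and "\<And>x y. x \<in> group_l2 G \<Longrightarrow> y \<in> group_l2 G \<Longrightarrow> l2_inner G (A x) y = l2_inner G x (B y)"
  shows "op_adjoint G A = B"
  unfolding op_adjoint_def
proof (rule the_equality)
  fix C assume C: "C \<in> group_vN G \<and>
    (\<forall>x\<in>group_l2 G. \<forall>y\<in>group_l2 G. l2_inner G (A x) y = l2_inner G x (C y))"
  show "C = B"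
  proof (rule vN_eqI[of _ G])
    fix y assume y: "y \<in> group_l2 G"
    have mem: "C y \<in> group_l2 G" "B y \<in> group_l2 G" using C assms(1) y by auto
    then have "l2_inner G (C y - B y) (C y) = l2_inner G (C y - B y) (B y)"
      using C assms(2)[OF l2_diff[OF mem] y] y l2_diff[OF mem] by auto
    then have "l2_inner G (C y - B y) (C y - B y) = 0"
      using mem by (simp add: l2_inner_diff_right)
    then have "l2_norm G (C y - B y) = 0" using mem by (simp add: l2_inner_self)
    then have "C y - B y = 0" using mem by (intro l2_norm_eq_0[of _ G]) auto
    then show "C y = B y" by simp
  qed (use C assms in auto)
qed (use assms in auto)

text \<open>The definition takes an absolute value a second time, of the positive operator
  \<open>B\<close>; the composition rule gives \<open>sqrt (B^2) = B\<close> since \<open>?u\<close>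
  is nonnegative, and only then does the logarithm compose with \<open>?u\<close>.\<close>

lemma fk_det_invertible_op_abs:
  assumes S: "op_between G S 0 M" and A: "compose (group_l2 G) (op_adjoint G A) A = S" and \<epsilon>: "0 < \<epsilon>"
  shows "fk_det_invertible G (op_plus_scalar G (op_abs G A) (of_real \<epsilon>)) = exp (fk_log_trace G S \<epsilon>)"
proof -
  let ?u = "\<lambda>s. sqrt s + \<epsilon>"
  define B where "B = func_calc G ?u S"
  have sqrt: "continuous_on {0..M} sqrt" by (intro continuous_intros)
  have u: "continuous_on {0..M} ?u" by (intro continuous_intros)
  have range: "\<epsilon> \<le> ?u t \<and> ?u t \<le> sqrt M + \<epsilon>" if "t \<in> {0..M}" for t
    using that by simp
  have B: "op_plus_scalar G (op_abs G A) (of_real \<epsilon>) = B"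
    unfolding op_abs_def A B_def func_calc_add_const[OF S sqrt] ..
  have sa: "self_adjoint G B" unfolding B_def by (rule func_calc_self_adjoint[OF S u])
  then have adj: "op_adjoint G B = B"
    by (intro op_adjoint_eqI) (auto simp: self_adjoint_def)
  have "op_abs G B = func_calc G sqrt (func_calc G (\<lambda>t. ?u t * ?u t) S)"
    unfolding op_abs_def adj unfolding func_calc_mult[OF S u u] B_def ..
  also have "\<dots> = func_calc G (\<lambda>t. sqrt (?u t * ?u t)) S"
  proof (rule func_calc_compose[OF S])
    show "continuous_on {0..M} (\<lambda>t. ?u t * ?u t)" by (intro continuous_intros)
    fix t assume t: "t \<in> {0..M}"
    show "0 \<le> ?u t * ?u t \<and> ?u t * ?u t \<le> (sqrt M + \<epsilon>) * (sqrt M + \<epsilon>)"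
      using range[OF t] \<epsilon> by (auto intro!: mult_mono)
  qed (intro continuous_intros)
  also have "\<dots> = B"
    unfolding B_def
  proof (rule func_calc_cong[OF S])
    fix t assume "t \<in> {0..M}"
    then show "sqrt (?u t * ?u t) = ?u t" using \<epsilon> by (simp add: real_sqrt_mult_self)
  qed (intro continuous_intros)
  finally have abs: "op_abs G B = B" .
  have "func_calc G ln B = func_calc G (\<lambda>s. ln (?u s)) S"
    unfolding B_def
  proof (rule func_calc_compose[OF S u range])
    show "continuous_on {\<epsilon>..sqrt M + \<epsilon>} ln" using \<epsilon> by (intro continuous_intros) auto
  qed
  then show ?thesis unfolding B fk_det_invertible_def abs fk_log_trace_def by simp
qed

lemma fk_log_trace_mono:
  assumes S: "op_between G S 0 M" and \<epsilon>: "0 < \<delta>" "\<delta> \<le> \<epsilon>"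
  shows "fk_log_trace G S \<delta> \<le> fk_log_trace G S \<epsilon>"
proof -
  have "fk_log_trace G S \<delta> \<le> fk_log_trace G S \<epsilon> + 0"
    unfolding fk_log_trace_def
    using \<epsilon> by (intro vN_trace_func_calc_mono[OF S] continuous_on_ln_sqrt) (auto simp: add_nonneg_pos)
  then show ?thesis by simp
qed

text \<open>\<open>Lim\<close> is informative only if the limit exists. It does, as the exponentials
  increase with \<epsilon> and are bounded below by 0; exponentiating first also covers log traces
  that tend to minus infinity.\<close>

lemma fk_det_tendsto:
  assumes S: "op_between G S 0 M" and A: "compose (group_l2 G) (op_adjoint G A) A = S"
  shows "((\<lambda>\<epsilon>. exp (fk_log_trace G S \<epsilon>)) \<longlongrightarrow> fk_det G A) (at_right 0)"
    and "0 < \<epsilon> \<Longrightarrow> fk_det G A \<le> exp (fk_log_trace G S \<epsilon>)"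
proof -
  let ?D = "\<lambda>\<epsilon>. exp (fk_log_trace G S \<epsilon>)"
  define L where "L = (INF \<epsilon>\<in>{0<..}. ?D \<epsilon>)"
  have bdd: "bdd_below (?D ` {0<..})" by (rule bdd_belowI[of _ 0]) auto
  have LD: "L \<le> ?D \<epsilon>" if "0 < \<epsilon>" for \<epsilon>
    unfolding L_def using that by (intro cINF_lower bdd) auto
  have lim: "(?D \<longlongrightarrow> L) (at_right 0)"
  proof (rule order_tendstoI)
    fix a assume "a < L"
    then have "a < ?D \<epsilon>" if "0 < \<epsilon>" for \<epsilon>
      using LD[OF that] by (rule less_le_trans)
    then show "\<forall>\<^sub>F \<epsilon> in at_right 0. a < ?D \<epsilon>"
      by (rule eventually_mono[OF eventually_at_right_less])
  next
    fix a assume "L < a"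
    then obtain \<epsilon> where \<epsilon>: "0 < \<epsilon>" "?D \<epsilon> < a"
      unfolding L_def by (subst (asm) cINF_less_iff) (auto simp: bdd)
    have "?D \<delta> < a" if "0 < \<delta>" "\<delta> < \<epsilon>" for \<delta>
    proof -
      have "?D \<delta> \<le> ?D \<epsilon>" using fk_log_trace_mono[OF S that(1), of \<epsilon>] that by simp
      then show ?thesis using \<epsilon>(2) by (rule le_less_trans)
    qed
    then show "\<forall>\<^sub>F \<epsilon> in at_right 0. ?D \<epsilon> < a"
      using \<epsilon>(1) unfolding eventually_at_right_field by blast
  qed
  moreover have "fk_det G A = L"
    unfolding fk_det_def
  proof (rule tendsto_Lim)
    show "((\<lambda>\<epsilon>. fk_det_invertible G (op_plus_scalar G (op_abs G A) (complex_of_real \<epsilon>))) \<longlongrightarrow> L) (at_right 0)"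
      using lim
    proof (rule Lim_transform_eventually)
      show "\<forall>\<^sub>F \<epsilon> in at_right 0. ?D \<epsilon> = fk_det_invertible G (op_plus_scalar G (op_abs G A) (complex_of_real \<epsilon>))"
        by (rule eventually_mono[OF eventually_at_right_less]) (rule fk_det_invertible_op_abs[OF S A, symmetric])
    qed
  qed simp
  ultimately show "(?D \<longlongrightarrow> fk_det G A) (at_right 0)" "0 < \<epsilon> \<Longrightarrow> fk_det G A \<le> ?D \<epsilon>"
    using LD by simp_all
qed

text \<open>Above \<open>c\<close> the shift by \<epsilon> changes the logarithm by at most
  \<open>\<epsilon> / sqrt c\<close>. This depends neither on the group nor on \<open>M\<close>,
  which makes it uniform along a sequence of groups.\<close>

lemma fk_det_lower_bound:
  assumes S: "op_between G S c M" and c: "0 < c"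
    and A: "compose (group_l2 G) (op_adjoint G A) A = S" and \<epsilon>: "0 < \<epsilon>"
  shows "exp (- (\<epsilon> / sqrt c)) * exp (fk_log_trace G S \<epsilon>) \<le> fk_det G A"
proof -
  \<comment> \<open>The limit defining the determinant was established on \<open>{0..M}\<close>; the
    log traces below are compared on \<open>{c..M}\<close>.\<close>
  have S0: "op_between G S 0 M"
    unfolding op_between_def
  proof (intro conjI ballI)
    fix x assume x: "x \<in> group_l2 G"
    have "0 \<le> c * (l2_norm G x)\<^sup>2" using c by simp
    then show "0 * (l2_norm G x)\<^sup>2 \<le> Re (l2_inner G (S x) x)"
      using S x unfolding op_between_def by (metis mult_zero_left order_trans)
  qed (use S in \<open>auto simp: op_between_def\<close>)
  have cont: "continuous_on {c..M} (\<lambda>s. ln (sqrt s + \<delta>))" if "0 < \<delta>" for \<delta>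
    by (rule continuous_on_subset[OF continuous_on_ln_sqrt[OF that, of M]]) (use c in auto)
  have le: "fk_log_trace G S \<epsilon> \<le> fk_log_trace G S \<delta> + \<epsilon> / sqrt c" if \<delta>: "0 < \<delta>" for \<delta>
    unfolding fk_log_trace_def
  proof (rule vN_trace_func_calc_mono[OF S cont[OF \<epsilon>] cont[OF \<delta>]])
    fix t assume t: "t \<in> {c..M}"
    have st: "0 < sqrt c" "sqrt c \<le> sqrt t" using t c by auto
    then have pos: "0 < sqrt t + \<epsilon>" "0 < sqrt t + \<delta>" using \<epsilon> \<delta> by linarith+
    \<comment> \<open>By \<open>ln x \<le> x - 1\<close> the difference is at most a quotient whose
      bound \<open>\<epsilon> / sqrt c\<close> does not involve \<delta>, so \<delta> may tend to 0
      at the end.\<close>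
    have "ln (sqrt t + \<epsilon>) - ln (sqrt t + \<delta>) = ln ((sqrt t + \<epsilon>) / (sqrt t + \<delta>))"
      by (rule ln_divide_pos[OF pos, symmetric])
    also have "\<dots> \<le> (sqrt t + \<epsilon>) / (sqrt t + \<delta>) - 1"
      by (intro ln_le_minus_one divide_pos_pos pos)
    also have "\<dots> = (\<epsilon> - \<delta>) / (sqrt t + \<delta>)" using pos(2) by (simp add: field_simps)
    also have "\<dots> \<le> \<epsilon> / sqrt c" using st \<epsilon> \<delta> by (intro frac_le) linarith+
    finally show "ln (sqrt t + \<epsilon>) \<le> ln (sqrt t + \<delta>) + \<epsilon> / sqrt c" by simp
  qed
  have "exp (- (\<epsilon> / sqrt c)) * exp (fk_log_trace G S \<epsilon>) \<le> exp (fk_log_trace G S \<delta>)" if "0 < \<delta>" for \<delta>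
    using le[OF that] by (simp add: exp_add[symmetric])
  then show ?thesis
    by (intro tendsto_lowerbound[OF fk_det_tendsto(1)[OF S0 A]]
        eventually_mono[OF eventually_at_right_less]) auto
qed

end

section \<open>The representation of an \<open>L\<^sup>1\<close>-algebra induced by a homomorphism\<close>

definition l1_norm :: "('a, 'm) monoid_scheme \<Rightarrow> ('a \<Rightarrow> complex) \<Rightarrow> real" where
  "l1_norm G f = (\<Sum>\<^sub>\<infinity>k\<in>carrier G. cmod (f k))"

definition l1_star :: "('a, 'm) monoid_scheme \<Rightarrow> ('a \<Rightarrow> complex) \<Rightarrow> 'a \<Rightarrow> complex" where
  "l1_star G f = (\<lambda>k. if k \<in> carrier G then cnj (f (inv\<^bsub>G\<^esub> k)) else 0)"

lemma l1_norm_nonneg [simp]: "0 \<le> l1_norm G f"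
  by (simp add: l1_norm_def infsum_nonneg)

lemma group_l1_summable: "f \<in> group_l1 G \<Longrightarrow> (\<lambda>k. cmod (f k)) summable_on carrier G"
  by (simp add: group_l1_def)

text \<open>Tonelli's criterion with a summable majorant for the row sums.\<close>

lemma abs_summable_on_Times:
  fixes F :: "'i \<Rightarrow> 'j \<Rightarrow> complex"
  assumes "\<And>k. k \<in> A \<Longrightarrow> (\<lambda>g. cmod (F k g)) summable_on B"
    and "\<And>k. k \<in> A \<Longrightarrow> (\<Sum>\<^sub>\<infinity>g\<in>B. cmod (F k g)) \<le> c k" "c summable_on A"
  shows "(\<lambda>(k, g). cmod (F k g)) summable_on A \<times> B"
proof (rule summable_on_SigmaI)
  show "(\<lambda>k. \<Sum>\<^sub>\<infinity>g\<in>B. cmod (F k g)) summable_on A"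
    using assms(3) by (rule summable_on_comparison_test) (use assms(2) in \<open>auto simp: infsum_nonneg\<close>)
  fix k assume "k \<in> A"
  then show "((\<lambda>g. case (k, g) of (k, g) \<Rightarrow> cmod (F k g)) has_sum (\<Sum>\<^sub>\<infinity>g\<in>B. cmod (F k g))) B"
    using assms(1) by simp
qed auto

lemma infsum_swap_abs:
  fixes F :: "'i \<Rightarrow> 'j \<Rightarrow> complex"
  assumes "(\<lambda>(k, g). cmod (F k g)) summable_on A \<times> B"
  shows "(\<Sum>\<^sub>\<infinity>k\<in>A. \<Sum>\<^sub>\<infinity>g\<in>B. F k g) = (\<Sum>\<^sub>\<infinity>g\<in>B. \<Sum>\<^sub>\<infinity>k\<in>A. F k g)"
proof (rule infsum_swap_banach)
  show "(\<lambda>(k, g). F k g) summable_on A \<times> B"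
    by (rule abs_summable_summable) (use assms in \<open>simp add: case_prod_unfold\<close>)
qed

context group
begin

lemma bij_betw_mult_left: "h \<in> carrier G \<Longrightarrow> bij_betw (\<lambda>g. h \<otimes> g) (carrier G) (carrier G)"
  by (intro bij_betwI[where g="\<lambda>g. inv h \<otimes> g"]) (auto simp: m_assoc[symmetric])

lemma bij_betw_mult_right: "h \<in> carrier G \<Longrightarrow> bij_betw (\<lambda>g. g \<otimes> h) (carrier G) (carrier G)"
  by (intro bij_betwI[where g="\<lambda>g. g \<otimes> inv h"]) (auto simp: m_assoc)

lemma bij_betw_inv: "bij_betw (m_inv G) (carrier G) (carrier G)"
  by (intro bij_betwI[where g="m_inv G"]) auto

lemma l1_star_l1 [simp]:
  assumes "f \<in> group_l1 G"
  shows "l1_star G f \<in> group_l1 G"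
proof -
  have "(\<lambda>k. cmod (f (inv k))) summable_on carrier G"
    using summable_on_reindex_bij_betw[OF bij_betw_inv, of "\<lambda>k. cmod (f k)"] group_l1_summable[OF assms]
    by simp
  then have "(\<lambda>k. cmod (l1_star G f k)) summable_on carrier G"
    by (subst summable_on_cong[of _ _ "\<lambda>k. cmod (f (inv k))"]) (auto simp: l1_star_def)
  then show ?thesis by (simp add: group_l1_def l1_star_def)
qed

lemma unit_series_l1 [simp]: "unit_series G \<in> group_l1 G"
proof -
  have "finite {k \<in> carrier G. cmod (unit_series G k) \<noteq> 0}"
    by (rule finite_subset[of _ "{\<one>}"]) (auto simp: unit_series_def)
  then show ?thesis
    by (auto simp: group_l1_def unit_series_def intro!: finite_nonzero_values_imp_summable_on)
qed

text \<open>Row \<open>k\<close> is a left translate of \<open>f'\<close> scaled by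
  \<open>f k\<close>, so its absolute sum is \<open>cmod (f k) * l1_norm G f'\<close>.\<close>

lemma convolution_summable:
  assumes f: "f \<in> group_l1 G" and f': "f' \<in> group_l1 G"
  shows "(\<lambda>(k, m). cmod (f k * f' (inv k \<otimes> m))) summable_on carrier G \<times> carrier G"
proof (rule abs_summable_on_Times)
  fix k assume k: "k \<in> carrier G"
  have b: "bij_betw (\<lambda>m. inv k \<otimes> m) (carrier G) (carrier G)"
    using k by (intro bij_betw_mult_left) auto
  have "(\<lambda>m. cmod (f' (inv k \<otimes> m))) summable_on carrier G"
    using summable_on_reindex_bij_betw[OF b, of "\<lambda>m. cmod (f' m)"] group_l1_summable[OF f'] by simp
  then show "(\<lambda>m. cmod (f k * f' (inv k \<otimes> m))) summable_on carrier G"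
    by (simp add: norm_mult summable_on_cmult_right)
  have "(\<Sum>\<^sub>\<infinity>m\<in>carrier G. cmod (f' (inv k \<otimes> m))) = l1_norm G f'"
    unfolding l1_norm_def by (rule infsum_reindex_bij_betw[OF b])
  then show "(\<Sum>\<^sub>\<infinity>m\<in>carrier G. cmod (f k * f' (inv k \<otimes> m))) \<le> cmod (f k) * l1_norm G f'"
    by (simp add: norm_mult infsum_cmult_right')
qed (intro summable_on_cmult_left group_l1_summable f)

lemma convolution_l1 [simp]:
  assumes f: "f \<in> group_l1 G" and f': "f' \<in> group_l1 G"
  shows "convolution G f f' \<in> group_l1 G"
proof -
  let ?F = "\<lambda>(m, k). f k * f' (inv k \<otimes> m)"
  have "(\<lambda>z. norm (?F z)) summable_on carrier G \<times> carrier G"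
    using convolution_summable[OF f f'] by (subst summable_on_swap) (simp add: case_prod_unfold)
  note * = this[unfolded Infinite_Sum.abs_summable_on_Sigma_iff]
  have s: "(\<lambda>k. norm (f k * f' (inv k \<otimes> m))) summable_on carrier G" if "m \<in> carrier G" for m
    using * that by simp
  have t: "(\<lambda>m. norm (\<Sum>\<^sub>\<infinity>k\<in>carrier G. norm (f k * f' (inv k \<otimes> m)))) summable_on carrier G"
    using * by simp
  have "(\<lambda>m. cmod (convolution G f f' m)) summable_on carrier G"
    using t
  proof (rule summable_on_comparison_test)
    fix m assume m: "m \<in> carrier G"
    show "cmod (convolution G f f' m) \<le> norm (\<Sum>\<^sub>\<infinity>k\<in>carrier G. norm (f k * f' (inv k \<otimes> m)))"
      using norm_infsum_bound[OF s[OF m]] m by (simp add: convolution_def)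
  qed auto
  then show ?thesis by (simp add: group_l1_def convolution_def)
qed

end

text \<open>
  \<open>L\<^sup>1(G)\<close> acts on \<open>L\<^sup>2(H)\<close> through \<open>h\<close>; on \<open>f\<close> this is \<open>r(h\<^sub>* f)\<close>, so that products and adjoints
  can be computed in \<open>L\<^sup>1(G)\<close>, independently of \<open>H\<close>.
\<close>

definition hom_rep ::
  "('b, 'k) monoid_scheme \<Rightarrow> ('a, 'm) monoid_scheme \<Rightarrow> ('b \<Rightarrow> 'a) \<Rightarrow> ('b \<Rightarrow> complex) \<Rightarrow> 'a l2_op" where
  "hom_rep G H h f = (\<lambda>x\<in>group_l2 H. \<lambda>g.
     if g \<in> carrier H then \<Sum>\<^sub>\<infinity>k\<in>carrier G. f k * x (g \<otimes>\<^bsub>H\<^esub> h k) else 0)"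

context group_hom
begin

lemma hom_rep_summable:
  assumes "f \<in> group_l1 G" "x \<in> group_l2 H"
  shows "(\<lambda>k. cmod (f k * x (g \<otimes>\<^bsub>H\<^esub> h k))) summable_on carrier G"
proof (rule summable_on_comparison_test)
  show "(\<lambda>k. cmod (f k) * l2_norm H x) summable_on carrier G"
    using assms(1) by (intro summable_on_cmult_left group_l1_summable)
  show "cmod (f k * x (g \<otimes>\<^bsub>H\<^esub> h k)) \<le> cmod (f k) * l2_norm H x" for k
    unfolding norm_mult by (intro mult_left_mono cmod_le_l2_norm assms) simp
qed auto

lemma right_shift_l2:
  assumes x: "x \<in> group_l2 H" and k: "k \<in> carrier H"
  shows "(\<lambda>g. if g \<in> carrier H then x (g \<otimes>\<^bsub>H\<^esub> k) else 0) \<in> group_l2 H" (is "?y \<in> _")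
    and "l2_norm H (\<lambda>g. if g \<in> carrier H then x (g \<otimes>\<^bsub>H\<^esub> k) else 0) = l2_norm H x"
proof -
  have b: "bij_betw (\<lambda>g. g \<otimes>\<^bsub>H\<^esub> k) (carrier H) (carrier H)"
    by (rule H.bij_betw_mult_right[OF k])
  have "(\<lambda>g. (cmod (x (g \<otimes>\<^bsub>H\<^esub> k)))\<^sup>2) summable_on carrier H"
    using x summable_on_reindex_bij_betw[OF b, of "\<lambda>g. (cmod (x g))\<^sup>2"] by (simp add: group_l2_def)
  then show "?y \<in> group_l2 H"
    by (auto simp: group_l2_def cong: summable_on_cong)
  have "(\<Sum>\<^sub>\<infinity>g\<in>carrier H. (cmod (?y g))\<^sup>2) = (\<Sum>\<^sub>\<infinity>g\<in>carrier H. (cmod (x (g \<otimes>\<^bsub>H\<^esub> k)))\<^sup>2)"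
    by (rule infsum_cong) simp
  also have "\<dots> = (\<Sum>\<^sub>\<infinity>g\<in>carrier H. (cmod (x g))\<^sup>2)"
    by (rule infsum_reindex_bij_betw[OF b])
  finally show "l2_norm H ?y = l2_norm H x" by (simp add: l2_norm_def)
qed

text \<open>A finite partial sum is a combination of right shifts, which are isometric; the bound
  passes to the limit over finite subsets. It does not depend on \<open>H\<close>.\<close>

lemma hom_rep_l2:
  assumes f: "f \<in> group_l1 G" and x: "x \<in> group_l2 H"
  shows "hom_rep G H h f x \<in> group_l2 H" "l2_norm H (hom_rep G H h f x) \<le> l1_norm G f * l2_norm H x"
proof -
  define X where "X F = (\<lambda>g. if g \<in> carrier H then \<Sum>k\<in>F. f k * x (g \<otimes>\<^bsub>H\<^esub> h k) else 0)" for F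
  have X: "X F \<in> group_l2 H \<and> l2_norm H (X F) \<le> (\<Sum>k\<in>F. cmod (f k)) * l2_norm H x"
    if "finite F" "F \<subseteq> carrier G" for F
    using that
  proof (induction F rule: finite_induct)
    case empty
    have "X {} = 0" by (simp add: X_def pointwise)
    then show ?case by simp
  next
    case (insert k F)
    define y where "y = (\<lambda>g. if g \<in> carrier H then x (g \<otimes>\<^bsub>H\<^esub> h k) else 0)"
    have y: "y \<in> group_l2 H" "l2_norm H y = l2_norm H x"
      using right_shift_l2[OF x, of "h k"] insert.prems by (auto simp: y_def)
    have eq: "X (insert k F) = f k *\<^sub>c y + X F"
      using insert.hyps by (auto simp: X_def y_def pointwise)
    have IH: "X F \<in> group_l2 H" "l2_norm H (X F) \<le> (\<Sum>k\<in>F. cmod (f k)) * l2_norm H x"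
      using insert by auto
    have "l2_norm H (f k *\<^sub>c y + X F) \<le> l2_norm H (f k *\<^sub>c y) + l2_norm H (X F)"
      using y IH by (intro l2_norm_triangle) auto
    then show ?case unfolding eq using y IH insert.hyps by (simp add: algebra_simps)
  qed
  have fin: "\<forall>\<^sub>F F in finite_subsets_at_top (carrier G).
      X F \<in> group_l2 H \<and> l2_norm H (X F) \<le> l1_norm G f * l2_norm H x"
  proof (rule eventually_finite_subsets_at_top_weakI)
    fix F assume F: "finite F" "F \<subseteq> carrier G"
    have "(\<Sum>k\<in>F. cmod (f k)) \<le> l1_norm G f"
      unfolding l1_norm_def using F by (intro finite_sum_le_infsum group_l1_summable f) auto
    then have "(\<Sum>k\<in>F. cmod (f k)) * l2_norm H x \<le> l1_norm G f * l2_norm H x"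
      by (rule mult_right_mono) simp
    then show "X F \<in> group_l2 H \<and> l2_norm H (X F) \<le> l1_norm G f * l2_norm H x"
      using X[OF F] by linarith
  qed
  have lim: "((\<lambda>F. X F g) \<longlongrightarrow> hom_rep G H h f x g) (finite_subsets_at_top (carrier G))"
    if "g \<in> carrier H" for g
    using infsum_tendsto[OF abs_summable_summable[OF hom_rep_summable[OF f x, of g]]] that x
    by (simp add: X_def hom_rep_def)
  show "hom_rep G H h f x \<in> group_l2 H" "l2_norm H (hom_rep G H h f x) \<le> l1_norm G f * l2_norm H x"
    by (rule l2_norm_le_limit[OF _ fin _ lim]; use x in \<open>simp add: hom_rep_def\<close>)+
qed

lemma hom_rep_vN:
  assumes f: "f \<in> group_l1 G"
  shows "hom_rep G H h f \<in> group_vN H"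
proof (rule group_vNI[where C="l1_norm G f"])
  fix x assume x: "x \<in> group_l2 H"
  note s = abs_summable_summable[OF hom_rep_summable[OF f]]
  show "hom_rep G H h f (x + y) = hom_rep G H h f x + hom_rep G H h f y" if y: "y \<in> group_l2 H" for y
    using x y infsum_add[OF s[OF x] s[OF y]]
    by (simp add: hom_rep_def pointwise distrib_left)
  show "hom_rep G H h f (c *\<^sub>c x) = c *\<^sub>c hom_rep G H h f x" for c
    using x by (simp add: hom_rep_def pointwise mult.left_commute[of _ c] infsum_cmult_right')
  \<comment> \<open>Left and right multiplication commute by associativity.\<close>
  show "hom_rep G H h f (left_translate H k x) = left_translate H k (hom_rep G H h f x)"
    if k: "k \<in> carrier H" for k
    using H.left_translate_l2[OF k x] x k
    by (auto simp: hom_rep_def left_translate_def fun_eq_iff H.m_assoc intro!: infsum_cong)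
qed (auto simp: hom_rep_l2 f, simp add: hom_rep_def)

text \<open>The sum over \<open>G\<close> is grouped into the fibres of \<open>h\<close>, which
  connects push-forwards with the action of the series upstairs.\<close>

lemma l1_rep_push_forward:
  assumes f: "f \<in> group_l1 G"
  shows "l1_rep H (push_forward G h f) = hom_rep G H h f"
proof (rule extensionalityI[of _ "group_l2 H"])
  fix x assume x: "x \<in> group_l2 H"
  show "l1_rep H (push_forward G h f) x = hom_rep G H h f x"
  proof
    fix g
    show "l1_rep H (push_forward G h f) x g = hom_rep G H h f x g"
    proof (cases "g \<in> carrier H")
      case False
      then show ?thesis using x by (simp add: l1_rep_def hom_rep_def right_translate_def)
    next
      case True
      let ?fib = "\<lambda>l. {k \<in> carrier G. h k = l}"
      let ?F = "\<lambda>k. f k * x (g \<otimes>\<^bsub>H\<^esub> h k)"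
      \<comment> \<open>The disjoint union of all fibres is a copy of \<open>G\<close>.\<close>
      have b: "bij_betw snd (Sigma (carrier H) ?fib) (carrier G)"
        by (rule bij_betwI[where g="\<lambda>k. (h k, k)"]) auto
      have s: "?F summable_on carrier G"
        by (rule abs_summable_summable[OF hom_rep_summable[OF f x]])
      then have "(\<lambda>z. ?F (snd z)) summable_on Sigma (carrier H) ?fib"
        by (subst summable_on_reindex_bij_betw[OF b])
      then have "(\<Sum>\<^sub>\<infinity>l\<in>carrier H. \<Sum>\<^sub>\<infinity>k\<in>?fib l. ?F (snd (l, k))) = (\<Sum>\<^sub>\<infinity>z\<in>Sigma (carrier H) ?fib. ?F (snd z))"
        by (rule infsum_Sigma_banach)
      also have "\<dots> = (\<Sum>\<^sub>\<infinity>k\<in>carrier G. ?F k)"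
        by (rule infsum_reindex_bij_betw[OF b])
      finally have "(\<Sum>\<^sub>\<infinity>k\<in>carrier G. ?F k) = (\<Sum>\<^sub>\<infinity>l\<in>carrier H. \<Sum>\<^sub>\<infinity>k\<in>?fib l. ?F k)" by simp
      also have "\<dots> = (\<Sum>\<^sub>\<infinity>l\<in>carrier H. push_forward G h f l * right_translate H (inv\<^bsub>H\<^esub> l) x g)"
      proof (rule infsum_cong)
        fix l assume l: "l \<in> carrier H"
        have "(\<Sum>\<^sub>\<infinity>k\<in>?fib l. ?F k) = (\<Sum>\<^sub>\<infinity>k\<in>?fib l. f k * x (g \<otimes>\<^bsub>H\<^esub> l))"
          by (rule infsum_cong) auto
        also have "\<dots> = push_forward G h f l * x (g \<otimes>\<^bsub>H\<^esub> l)"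
          unfolding push_forward_def by (rule infsum_cmult_left')
        finally show "(\<Sum>\<^sub>\<infinity>k\<in>?fib l. ?F k) = push_forward G h f l * right_translate H (inv\<^bsub>H\<^esub> l) x g"
          using True l by (simp add: right_translate_def)
      qed
      finally show ?thesis using True x by (simp add: l1_rep_def hom_rep_def)
    qed
  qed
qed (simp_all add: l1_rep_def hom_rep_def)

text \<open>In the inner sum the index \<open>l\<close> is replaced by \<open>inv k\<close> times
  \<open>m\<close>, so that the arguments of \<open>x\<close> collapse to \<open>g\<close> times
  \<open>h m\<close>; Fubini then exposes the convolution. Coefficients of \<open>x\<close> are
  bounded, so \<open>convolution_summable\<close> supplies the majorant.\<close>

lemma hom_rep_convolution:
  assumes f: "f \<in> group_l1 G" and f': "f' \<in> group_l1 G" and x: "x \<in> group_l2 H"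
  shows "hom_rep G H h (convolution G f f') x = hom_rep G H h f (hom_rep G H h f' x)"
proof
  fix g
  show "hom_rep G H h (convolution G f f') x g = hom_rep G H h f (hom_rep G H h f' x) g"
  proof (cases "g \<in> carrier H")
    case False
    then show ?thesis using x hom_rep_l2[OF f' x] by (simp add: hom_rep_def)
  next
    case g: True
    let ?x = "\<lambda>m. x (g \<otimes>\<^bsub>H\<^esub> h m)"
    let ?F = "\<lambda>k m. f k * f' (inv\<^bsub>G\<^esub> k \<otimes>\<^bsub>G\<^esub> m) * ?x m"
    have "(\<lambda>(k, m). cmod (f k * f' (inv\<^bsub>G\<^esub> k \<otimes>\<^bsub>G\<^esub> m)) * l2_norm H x) summable_on carrier G \<times> carrier G"
      using summable_on_cmult_left[OF G.convolution_summable[OF f f'], of "l2_norm H x"]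
      by (simp add: case_prod_unfold)
    then have s: "(\<lambda>(k, m). cmod (?F k m)) summable_on carrier G \<times> carrier G"
    proof (rule summable_on_comparison_test)
      fix z :: "'a \<times> 'a"
      show "(case z of (k, m) \<Rightarrow> cmod (?F k m))
          \<le> (case z of (k, m) \<Rightarrow> cmod (f k * f' (inv\<^bsub>G\<^esub> k \<otimes>\<^bsub>G\<^esub> m)) * l2_norm H x)"
        unfolding norm_mult[of _ "x _"] case_prod_unfold
        by (intro mult_left_mono cmod_le_l2_norm x) simp
    qed auto
    have "hom_rep G H h f (hom_rep G H h f' x) g
        = (\<Sum>\<^sub>\<infinity>k\<in>carrier G. f k * hom_rep G H h f' x (g \<otimes>\<^bsub>H\<^esub> h k))"
      using g x hom_rep_l2[OF f' x] by (simp add: hom_rep_def)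
    also have "\<dots> = (\<Sum>\<^sub>\<infinity>k\<in>carrier G. \<Sum>\<^sub>\<infinity>m\<in>carrier G. ?F k m)"
    proof (rule infsum_cong)
      fix k assume k: "k \<in> carrier G"
      have b: "bij_betw (\<lambda>m. inv\<^bsub>G\<^esub> k \<otimes>\<^bsub>G\<^esub> m) (carrier G) (carrier G)"
        using k by (intro G.bij_betw_mult_left) auto
      have "hom_rep G H h f' x (g \<otimes>\<^bsub>H\<^esub> h k)
          = (\<Sum>\<^sub>\<infinity>l\<in>carrier G. f' l * x (g \<otimes>\<^bsub>H\<^esub> h k \<otimes>\<^bsub>H\<^esub> h l))"
        using g k x by (simp add: hom_rep_def)
      also have "\<dots> = (\<Sum>\<^sub>\<infinity>m\<in>carrier G. f' (inv\<^bsub>G\<^esub> k \<otimes>\<^bsub>G\<^esub> m)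
          * x (g \<otimes>\<^bsub>H\<^esub> h k \<otimes>\<^bsub>H\<^esub> h (inv\<^bsub>G\<^esub> k \<otimes>\<^bsub>G\<^esub> m)))"
        by (rule infsum_reindex_bij_betw[OF b, symmetric])
      also have "\<dots> = (\<Sum>\<^sub>\<infinity>m\<in>carrier G. f' (inv\<^bsub>G\<^esub> k \<otimes>\<^bsub>G\<^esub> m) * ?x m)"
      proof (rule infsum_cong)
        fix m assume m: "m \<in> carrier G"
        have "g \<otimes>\<^bsub>H\<^esub> h k \<otimes>\<^bsub>H\<^esub> h (inv\<^bsub>G\<^esub> k \<otimes>\<^bsub>G\<^esub> m) = g \<otimes>\<^bsub>H\<^esub> h (k \<otimes>\<^bsub>G\<^esub> (inv\<^bsub>G\<^esub> k \<otimes>\<^bsub>G\<^esub> m))"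
          using g k m by (simp add: H.m_assoc)
        also have "k \<otimes>\<^bsub>G\<^esub> (inv\<^bsub>G\<^esub> k \<otimes>\<^bsub>G\<^esub> m) = m" using k m by (simp add: G.m_assoc[symmetric])
        finally show "f' (inv\<^bsub>G\<^esub> k \<otimes>\<^bsub>G\<^esub> m) * x (g \<otimes>\<^bsub>H\<^esub> h k \<otimes>\<^bsub>H\<^esub> h (inv\<^bsub>G\<^esub> k \<otimes>\<^bsub>G\<^esub> m))
            = f' (inv\<^bsub>G\<^esub> k \<otimes>\<^bsub>G\<^esub> m) * ?x m" by simp
      qed
      finally show "f k * hom_rep G H h f' x (g \<otimes>\<^bsub>H\<^esub> h k) = (\<Sum>\<^sub>\<infinity>m\<in>carrier G. ?F k m)"
        by (simp add: infsum_cmult_right' mult.assoc)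
    qed
    also have "\<dots> = (\<Sum>\<^sub>\<infinity>m\<in>carrier G. \<Sum>\<^sub>\<infinity>k\<in>carrier G. ?F k m)"
      by (rule infsum_swap_abs[OF s])
    also have "\<dots> = (\<Sum>\<^sub>\<infinity>m\<in>carrier G. convolution G f f' m * ?x m)"
      by (rule infsum_cong) (simp add: convolution_def infsum_cmult_left')
    finally show ?thesis using g x by (simp add: hom_rep_def)
  qed
qed

lemma hom_rep_unit:
  assumes x: "x \<in> group_l2 H"
  shows "hom_rep G H h (unit_series G) x = x"
proof
  fix g
  have "(\<Sum>\<^sub>\<infinity>k\<in>carrier G. unit_series G k * x (g \<otimes>\<^bsub>H\<^esub> h k)) = (\<Sum>\<^sub>\<infinity>k\<in>{\<one>\<^bsub>G\<^esub>}. x (g \<otimes>\<^bsub>H\<^esub> h k))"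
    by (rule infsum_cong_neutral) (auto simp: unit_series_def)
  then show "hom_rep G H h (unit_series G) x g = x g"
    using x l2_outside[OF x] by (auto simp: hom_rep_def)
qed

text \<open>Translating \<open>g\<close> by the inverse of \<open>h k\<close> moves the shift from
  \<open>x\<close> to \<open>y\<close>, and inverting \<open>k\<close> turns the coefficients of
  \<open>f\<close> into those of its star; Fubini is needed on either side of the
  translation.\<close>

lemma hom_rep_adjoint:
  assumes f: "f \<in> group_l1 G" and x: "x \<in> group_l2 H" and y: "y \<in> group_l2 H"
  shows "l2_inner H (hom_rep G H h f x) y = l2_inner H x (hom_rep G H h (l1_star G f) y)"
proof -
  let ?F = "\<lambda>k g. f k * (x (g \<otimes>\<^bsub>H\<^esub> h k) * cnj (y g))"
  have s: "(\<lambda>(k, g). cmod (?F k g)) summable_on carrier G \<times> carrier H"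
  proof (rule abs_summable_on_Times)
    fix k assume k: "k \<in> carrier G"
    define z where "z = (\<lambda>g. if g \<in> carrier H then x (g \<otimes>\<^bsub>H\<^esub> h k) else 0)"
    have z: "z \<in> group_l2 H" "l2_norm H z = l2_norm H x"
      using right_shift_l2[OF x, of "h k"] k by (auto simp: z_def)
    \<comment> \<open>Passing to absolute values keeps the norm, so Cauchy-Schwarz also bounds the
      absolute sum of row \<open>k\<close>.\<close>
    have abs: "(\<lambda>g. of_real (cmod (w g))) \<in> group_l2 H" "l2_norm H (\<lambda>g. of_real (cmod (w g))) = l2_norm H w"
      if "w \<in> group_l2 H" for w
      using that by (auto simp: group_l2_def l2_norm_def)
    have eq: "cmod (?F k g) = cmod (f k) * cmod (z g * cnj (y g))" if "g \<in> carrier H" for g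
      using that by (simp add: norm_mult z_def)
    have "(\<lambda>g. cmod (f k) * cmod (z g * cnj (y g))) summable_on carrier H"
      by (intro summable_on_cmult_right l2_inner_abs_summable z y)
    then show "(\<lambda>g. cmod (?F k g)) summable_on carrier H"
      by (subst summable_on_cong[OF eq])
    have "(\<Sum>\<^sub>\<infinity>g\<in>carrier H. cmod (z g * cnj (y g))) \<le> l2_norm H z * l2_norm H y"
    proof -
      have "of_real (\<Sum>\<^sub>\<infinity>g\<in>carrier H. cmod (z g * cnj (y g)))
          = l2_inner H (\<lambda>g. of_real (cmod (z g))) (\<lambda>g. of_real (cmod (y g)))"
        unfolding l2_inner_def
        by (intro infsumI[symmetric])
           (use has_sum_of_real[OF has_sum_infsum[OF l2_inner_abs_summable[OF z(1) y]]]
            in \<open>simp add: norm_mult\<close>)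
      then have "cmod (of_real (\<Sum>\<^sub>\<infinity>g\<in>carrier H. cmod (z g * cnj (y g)))) \<le> l2_norm H z * l2_norm H y"
        using l2_inner_Cauchy_Schwarz[OF abs(1)[OF z(1)] abs(1)[OF y]] abs(2) z y by simp
      then show ?thesis by (simp add: infsum_nonneg)
    qed
    then have "cmod (f k) * (\<Sum>\<^sub>\<infinity>g\<in>carrier H. cmod (z g * cnj (y g))) \<le> cmod (f k) * (l2_norm H x * l2_norm H y)"
      using z by (intro mult_left_mono) auto
    then show "(\<Sum>\<^sub>\<infinity>g\<in>carrier H. cmod (?F k g)) \<le> cmod (f k) * (l2_norm H x * l2_norm H y)"
      by (subst infsum_cong[OF eq]) (simp_all add: infsum_cmult_right')
  qed (intro summable_on_cmult_left group_l1_summable f)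
  let ?E = "\<lambda>k g. f k * (x g * cnj (y (g \<otimes>\<^bsub>H\<^esub> inv\<^bsub>H\<^esub> (h k))))"
  have shift: "bij_betw (\<lambda>g. g \<otimes>\<^bsub>H\<^esub> inv\<^bsub>H\<^esub> (h k)) (carrier H) (carrier H)" if "k \<in> carrier G" for k
    using that by (intro H.bij_betw_mult_right) auto
  have FE: "?F k (g \<otimes>\<^bsub>H\<^esub> inv\<^bsub>H\<^esub> (h k)) = ?E k g" if "k \<in> carrier G" "g \<in> carrier H" for k g
    using that by (simp add: H.m_assoc)
  have sE: "(\<lambda>(k, g). cmod (?E k g)) summable_on carrier G \<times> carrier H"
  proof -
    \<comment> \<open>Summability is transported along the fibrewise translation instead of being
      estimated again.\<close>
    have b: "bij_betw (\<lambda>(k, g). (k, g \<otimes>\<^bsub>H\<^esub> inv\<^bsub>H\<^esub> (h k))) (carrier G \<times> carrier H) (carrier G \<times> carrier H)"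
      by (rule bij_betwI[where g="\<lambda>(k, g). (k, g \<otimes>\<^bsub>H\<^esub> h k)"]) (auto simp: H.m_assoc)
    have "(\<lambda>z. case (case z of (k, g) \<Rightarrow> (k, g \<otimes>\<^bsub>H\<^esub> inv\<^bsub>H\<^esub> (h k))) of (k, g) \<Rightarrow> cmod (?F k g))
        summable_on carrier G \<times> carrier H"
      using s by (subst summable_on_reindex_bij_betw[OF b])
    then show ?thesis
      by (rule summable_on_cong[THEN iffD1, rotated]) (auto simp: FE)
  qed
  have "l2_inner H (hom_rep G H h f x) y = (\<Sum>\<^sub>\<infinity>g\<in>carrier H. \<Sum>\<^sub>\<infinity>k\<in>carrier G. ?F k g)"
    unfolding l2_inner_def
    by (rule infsum_cong) (use x in \<open>simp add: hom_rep_def infsum_cmult_left'[symmetric] mult.assoc\<close>)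
  also have "\<dots> = (\<Sum>\<^sub>\<infinity>k\<in>carrier G. \<Sum>\<^sub>\<infinity>g\<in>carrier H. ?F k g)"
    by (rule infsum_swap_abs[OF s, symmetric])
  also have "\<dots> = (\<Sum>\<^sub>\<infinity>k\<in>carrier G. \<Sum>\<^sub>\<infinity>g\<in>carrier H. ?E k g)"
  proof (rule infsum_cong)
    fix k assume k: "k \<in> carrier G"
    show "(\<Sum>\<^sub>\<infinity>g\<in>carrier H. ?F k g) = (\<Sum>\<^sub>\<infinity>g\<in>carrier H. ?E k g)"
      unfolding infsum_reindex_bij_betw[OF shift[OF k], of "?F k", symmetric]
      by (rule infsum_cong) (rule FE[OF k])
  qed
  also have "\<dots> = (\<Sum>\<^sub>\<infinity>g\<in>carrier H. \<Sum>\<^sub>\<infinity>k\<in>carrier G. ?E k g)"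
    by (rule infsum_swap_abs[OF sE])
  also have "\<dots> = l2_inner H x (hom_rep G H h (l1_star G f) y)"
    unfolding l2_inner_def
  proof (rule infsum_cong)
    fix g assume g: "g \<in> carrier H"
    have "cnj (hom_rep G H h (l1_star G f) y g)
        = (\<Sum>\<^sub>\<infinity>k\<in>carrier G. cnj (l1_star G f k * y (g \<otimes>\<^bsub>H\<^esub> h k)))"
      using g y by (simp add: hom_rep_def del: complex_cnj_mult)
    also have "\<dots> = (\<Sum>\<^sub>\<infinity>k\<in>carrier G. cnj (l1_star G f (inv\<^bsub>G\<^esub> k) * y (g \<otimes>\<^bsub>H\<^esub> h (inv\<^bsub>G\<^esub> k))))"
      by (rule infsum_reindex_bij_betw[OF G.bij_betw_inv, symmetric])
    also have "\<dots> = (\<Sum>\<^sub>\<infinity>k\<in>carrier G. f k * cnj (y (g \<otimes>\<^bsub>H\<^esub> inv\<^bsub>H\<^esub> (h k))))"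
      by (rule infsum_cong) (simp add: l1_star_def)
    finally show "(\<Sum>\<^sub>\<infinity>k\<in>carrier G. ?E k g) = x g * cnj (hom_rep G H h (l1_star G f) y g)"
      by (simp add: infsum_cmult_right'[symmetric] mult.left_commute)
  qed
  finally show ?thesis .
qed

lemma l2_inner_unit_right:
  assumes "x \<in> group_l2 H"
  shows "l2_inner H x (unit_series H) = x \<one>\<^bsub>H\<^esub>"
proof -
  have "l2_inner H x (unit_series H) = (\<Sum>\<^sub>\<infinity>g\<in>{\<one>\<^bsub>H\<^esub>}. x g)"
    unfolding l2_inner_def by (rule infsum_cong_neutral) (auto simp: unit_series_def)
  then show ?thesis by simp
qed

text \<open>A term survives only if \<open>h k\<close> is the unit. Traces therefore see the
  homomorphism only through its kernel, which is what the hypothesis on kernels can act on.\<close>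

lemma hom_rep_unit_series_one:
  "hom_rep G H h f (unit_series H) \<one>\<^bsub>H\<^esub> = (\<Sum>\<^sub>\<infinity>k\<in>kernel G H h. f k)"
proof -
  have "(\<Sum>\<^sub>\<infinity>k\<in>carrier G. f k * unit_series H (\<one>\<^bsub>H\<^esub> \<otimes>\<^bsub>H\<^esub> h k)) = (\<Sum>\<^sub>\<infinity>k\<in>kernel G H h. f k)"
    by (rule infsum_cong_neutral) (auto simp: unit_series_def kernel_def)
  then show ?thesis by (simp add: hom_rep_def)
qed

end

primrec conv_power :: "('a, 'm) monoid_scheme \<Rightarrow> ('a \<Rightarrow> complex) \<Rightarrow> nat \<Rightarrow> 'a \<Rightarrow> complex" where
  "conv_power G f 0 = unit_series G"
| "conv_power G f (Suc n) = convolution G f (conv_power G f n)"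

lemma (in group) conv_power_l1: "f \<in> group_l1 G \<Longrightarrow> conv_power G f n \<in> group_l1 G"
  by (induction n) auto

context group_hom
begin

lemma hom_rep_funpow:
  assumes f: "f \<in> group_l1 G" and x: "x \<in> group_l2 H"
  shows "(hom_rep G H h f ^^ n) x = hom_rep G H h (conv_power G f n) x"
  by (induction n) (simp_all add: hom_rep_unit[OF x] hom_rep_convolution[OF f G.conv_power_l1[OF f] x])

lemma vN_trace_op_poly_hom_rep:
  assumes f: "f \<in> group_l1 G"
  shows "vN_trace H (op_poly H p (hom_rep G H h f))
    = (\<Sum>i\<le>degree p. of_real (coeff p i) * (\<Sum>\<^sub>\<infinity>k\<in>kernel G H h. conv_power G f i k))"
proof -
  let ?A = "hom_rep G H h f" and ?e = "unit_series H"
  have e: "?e \<in> group_l2 H" by simp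
  have "vN_trace H (op_poly H p ?A) = op_poly H p ?A ?e \<one>\<^bsub>H\<^esub>"
    unfolding vN_trace_def
    by (intro l2_inner_unit_right vN_closed[OF H.op_poly_vN[OF hom_rep_vN[OF f]] e])
  also have "\<dots> = (\<Sum>i\<le>degree p. of_real (coeff p i) * (?A ^^ i) ?e \<one>\<^bsub>H\<^esub>)"
    by (simp add: op_poly_def)
  finally show ?thesis by (simp only: hom_rep_funpow[OF f e] hom_rep_unit_series_one)
qed

context
  fixes f S
  assumes f: "f \<in> group_l1 G"
    and S: "S = hom_rep G H h (convolution G (l1_star G f) f)"
begin

text \<open>Discharges the premise on the adjoint in the determinant lemmas, with \<open>S\<close>
  given by a single series upstairs.\<close>

lemma hom_rep_square: "compose (group_l2 H) (op_adjoint H (hom_rep G H h f)) (hom_rep G H h f) = S"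
proof -
  have "op_adjoint H (hom_rep G H h f) = hom_rep G H h (l1_star G f)"
    by (intro H.op_adjoint_eqI hom_rep_vN hom_rep_adjoint G.l1_star_l1 f)
  then show ?thesis
    unfolding S using f
    by (intro vN_eqI[of _ H] H.vN_compose hom_rep_vN G.convolution_l1 G.l1_star_l1)
       (auto simp: H.op_apply hom_rep_convolution intro!: hom_rep_vN)
qed

lemma hom_rep_square_inner:
  assumes x: "x \<in> group_l2 H" and y: "y \<in> group_l2 H"
  shows "l2_inner H x (S y) = l2_inner H (hom_rep G H h f x) (hom_rep G H h f y)"
  unfolding S hom_rep_convolution[OF G.l1_star_l1[OF f] f y]
  by (rule hom_rep_adjoint[OF f x hom_rep_l2(1)[OF f y], symmetric])

text \<open>The form of \<open>S\<close> at \<open>x\<close> is the squared norm of the image of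
  \<open>x\<close>. The constant \<open>c\<close> is a parameter: 0 in general, positive for an
  invertible series.\<close>

lemma hom_rep_square_between:
  assumes c: "\<And>x. x \<in> group_l2 H \<Longrightarrow> c * (l2_norm H x)\<^sup>2 \<le> (l2_norm H (hom_rep G H h f x))\<^sup>2"
  shows "op_between H S c ((l1_norm G f)\<^sup>2)"
  unfolding op_between_def self_adjoint_def
proof (intro conjI ballI)
  show "S \<in> group_vN H"
    unfolding S using f by (intro hom_rep_vN G.convolution_l1 G.l1_star_l1)
  fix x assume x: "x \<in> group_l2 H"
  show comm: "l2_inner H (S x) y = l2_inner H x (S y)" if y: "y \<in> group_l2 H" for y
    unfolding l2_inner_commute[of H "S x"] hom_rep_square_inner[OF x y] hom_rep_square_inner[OF y x]
    by (rule l2_inner_commute[symmetric])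
  have *: "Re (l2_inner H (S x) x) = (l2_norm H (hom_rep G H h f x))\<^sup>2"
    unfolding comm[OF x] hom_rep_square_inner[OF x x] l2_inner_self[OF hom_rep_l2(1)[OF f x]]
    by (rule Re_complex_of_real)
  show "c * (l2_norm H x)\<^sup>2 \<le> Re (l2_inner H (S x) x)"
    unfolding * by (rule c[OF x])
  show "Re (l2_inner H (S x) x) \<le> (l1_norm G f)\<^sup>2 * (l2_norm H x)\<^sup>2"
    unfolding * power_mult_distrib[symmetric] by (intro power_mono hom_rep_l2 f x) simp
qed

end

text \<open>A left inverse upstairs acts as a left inverse on every \<open>H\<close>, with norm at
  most its \<open>l1_norm\<close>; the bound is thus the same for all homomorphisms.\<close>

lemma hom_rep_bounded_below:
  assumes f: "f \<in> group_l1 G" and g: "g \<in> group_l1 G" and gf: "convolution G g f = unit_series G"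
    and x: "x \<in> group_l2 H"
  shows "l2_norm H x \<le> l1_norm G g * l2_norm H (hom_rep G H h f x)"
  using hom_rep_l2(2)[OF g hom_rep_l2(1)[OF f x]]
  by (simp only: hom_rep_convolution[OF g f x, symmetric] gf hom_rep_unit[OF x])

end

section \<open>Sums over converging sets and approximation of traces\<close>

text \<open>A finite \<open>Q\<close> carries all but \<open>e / 3\<close> of the absolute sum. Once
  \<open>K\<close> and \<open>Kn n\<close> agree on \<open>Q\<close>, the two sums differ only by
  their parts outside \<open>Q\<close>.\<close>

lemma infsum_sets_converge:
  fixes f :: "'a \<Rightarrow> complex"
  assumes f: "(\<lambda>g. cmod (f g)) summable_on X" and K: "K \<subseteq> X" "\<And>n. Kn n \<subseteq> X"
    and conv: "sets_converge_on X Kn K"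
  shows "(\<lambda>n. \<Sum>\<^sub>\<infinity>g\<in>Kn n. f g) \<longlonglongrightarrow> (\<Sum>\<^sub>\<infinity>g\<in>K. f g)"
proof (rule tendstoI)
  fix e :: real assume e: "0 < e"
  obtain Q where Q: "finite Q" "Q \<subseteq> X"
    "dist (\<Sum>g\<in>Q. cmod (f g)) (\<Sum>\<^sub>\<infinity>g\<in>X. cmod (f g)) \<le> e / 3"
    using infsum_finite_approximation[OF f, of "e / 3"] e by auto
  have sub: "(\<lambda>g. cmod (f g)) summable_on A" if "A \<subseteq> X" for A
    using summable_on_subset_banach[OF f that] .
  have "(\<Sum>\<^sub>\<infinity>g\<in>X. cmod (f g)) = (\<Sum>\<^sub>\<infinity>g\<in>Q. cmod (f g)) + (\<Sum>\<^sub>\<infinity>g\<in>X - Q. cmod (f g))"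
    using Q(2) infsum_Un_disjoint[OF sub[OF Q(2)] sub[of "X - Q"]] by (simp add: Un_absorb1)
  then have tail: "(\<Sum>\<^sub>\<infinity>g\<in>X - Q. cmod (f g)) \<le> e / 3"
    using Q by (simp add: dist_real_def)
  have near: "cmod ((\<Sum>\<^sub>\<infinity>g\<in>A. f g) - (\<Sum>\<^sub>\<infinity>g\<in>A \<inter> Q. f g)) \<le> e / 3" if A: "A \<subseteq> X" for A
  proof -
    have s: "(\<lambda>g. cmod (f g)) summable_on A \<inter> Q" "(\<lambda>g. cmod (f g)) summable_on A - Q"
      using A by (auto intro!: sub)
    have "(\<Sum>\<^sub>\<infinity>g\<in>A. f g) = (\<Sum>\<^sub>\<infinity>g\<in>(A \<inter> Q) \<union> (A - Q). f g)"
      by (simp add: Int_Diff_Un)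
    also have "\<dots> = (\<Sum>\<^sub>\<infinity>g\<in>A \<inter> Q. f g) + (\<Sum>\<^sub>\<infinity>g\<in>A - Q. f g)"
      by (rule infsum_Un_disjoint[OF abs_summable_summable[OF s(1)] abs_summable_summable[OF s(2)]]) auto
    finally have "cmod ((\<Sum>\<^sub>\<infinity>g\<in>A. f g) - (\<Sum>\<^sub>\<infinity>g\<in>A \<inter> Q. f g)) = cmod (\<Sum>\<^sub>\<infinity>g\<in>A - Q. f g)" by simp
    also have "\<dots> \<le> (\<Sum>\<^sub>\<infinity>g\<in>A - Q. cmod (f g))" by (rule norm_infsum_bound[OF s(2)])
    also have "\<dots> \<le> (\<Sum>\<^sub>\<infinity>g\<in>X - Q. cmod (f g))"
      using A by (intro infsum_mono2 s sub) auto
    finally show ?thesis using tail by linarith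
  qed
  have "\<forall>\<^sub>F n in sequentially. \<forall>g\<in>Q. g \<notin> sym_diff K (Kn n)"
  proof (rule eventually_ball_finite[OF Q(1)], rule ballI)
    fix g assume "g \<in> Q"
    then have "\<not> (\<exists>\<^sub>\<infinity>n. g \<in> sym_diff K (Kn n))"
      using conv Q(2) by (auto simp: sets_converge_on_def)
    then show "\<forall>\<^sub>F n in sequentially. g \<notin> sym_diff K (Kn n)"
      unfolding frequently_def cofinite_eq_sequentially by (rule notnotD)
  qed
  then show "\<forall>\<^sub>F n in sequentially. dist (\<Sum>\<^sub>\<infinity>g\<in>Kn n. f g) (\<Sum>\<^sub>\<infinity>g\<in>K. f g) < e"
  proof eventually_elim
    case (elim n)
    then have eq: "Kn n \<inter> Q = K \<inter> Q" by auto
    have "dist (\<Sum>\<^sub>\<infinity>g\<in>Kn n. f g) (\<Sum>\<^sub>\<infinity>g\<in>K. f g)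
        \<le> dist (\<Sum>\<^sub>\<infinity>g\<in>Kn n. f g) (\<Sum>\<^sub>\<infinity>g\<in>K \<inter> Q. f g) + dist (\<Sum>\<^sub>\<infinity>g\<in>K. f g) (\<Sum>\<^sub>\<infinity>g\<in>K \<inter> Q. f g)"
      by (rule dist_triangle2)
    also have "\<dots> \<le> e / 3 + e / 3"
      unfolding dist_norm using near[OF K(2), of n] near[OF K(1)] by (simp add: eq)
    finally show ?case using e by linarith
  qed
qed

text \<open>Monotonicity in both directions. The error does not involve the group, so one polynomial
  serves all members of a sequence.\<close>

lemma (in group) vN_trace_func_calc_poly_approx:
  assumes A: "op_between G A m M" and u: "continuous_on {m..M} u"
    and p: "\<And>t. t \<in> {m..M} \<Longrightarrow> \<bar>poly p t - u t\<bar> \<le> \<epsilon>"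
  shows "\<bar>Re (vN_trace G (func_calc G u A)) - Re (vN_trace G (op_poly G p A))\<bar> \<le> \<epsilon>"
proof -
  have cp: "continuous_on {m..M} (poly p)" by (rule continuous_on_poly[OF continuous_on_id])
  have "u t \<le> poly p t + \<epsilon>" "poly p t \<le> u t + \<epsilon>" if "t \<in> {m..M}" for t
    using p[OF that] by (auto simp: abs_le_iff)
  from vN_trace_func_calc_mono[OF A u cp this(1)] vN_trace_func_calc_mono[OF A cp u this(2)]
  show ?thesis unfolding func_calc_poly[OF A] by linarith
qed

section \<open>The limits in \<open>n\<close> and in \<epsilon>\<close>

text \<open>Homomorphisms are assumed from index 1 on, so facts about a single member carry
  \<open>1 \<le> n\<close> and limits are compared only eventually.\<close>

locale group_hom_sequence =
  fixes \<Gamma>t :: "('b, 'k) monoid_scheme"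
    and \<Gamma> :: "('a, 'm) monoid_scheme"
    and \<Gamma>n :: "nat \<Rightarrow> ('c, 'l) monoid_scheme"
    and \<phi> :: "'b \<Rightarrow> 'a"
    and \<phi>n :: "nat \<Rightarrow> 'b \<Rightarrow> 'c"
    and f :: "'b \<Rightarrow> complex"
  assumes hom: "group_hom \<Gamma>t \<Gamma> \<phi>"
    and hom_n: "\<And>n. 1 \<le> n \<Longrightarrow> group_hom \<Gamma>t (\<Gamma>n n) (\<phi>n n)"
    and f: "f \<in> group_l1 \<Gamma>t"
    and kernel_conv: "sets_converge_on (carrier \<Gamma>t) (\<lambda>n. kernel \<Gamma>t (\<Gamma>n n) (\<phi>n n)) (kernel \<Gamma>t \<Gamma> \<phi>)"
begin

definition star_f where "star_f = convolution \<Gamma>t (l1_star \<Gamma>t f) f"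
definition S where "S = hom_rep \<Gamma>t \<Gamma> \<phi> star_f"
definition Sn where "Sn n = hom_rep \<Gamma>t (\<Gamma>n n) (\<phi>n n) star_f"
definition M where "M = (l1_norm \<Gamma>t f)\<^sup>2"

lemma star_f_l1: "star_f \<in> group_l1 \<Gamma>t"
proof -
  interpret group_hom \<Gamma>t \<Gamma> \<phi> by (rule hom)
  show ?thesis unfolding star_f_def by (intro G.convolution_l1 G.l1_star_l1 f)
qed

lemma trace_op_poly_tendsto:
  "(\<lambda>n. vN_trace (\<Gamma>n n) (op_poly (\<Gamma>n n) p (Sn n))) \<longlonglongrightarrow> vN_trace \<Gamma> (op_poly \<Gamma> p S)"
proof -
  interpret group_hom \<Gamma>t \<Gamma> \<phi> by (rule hom)
  have "(\<lambda>n. \<Sum>i\<le>degree p. of_real (coeff p i) * (\<Sum>\<^sub>\<infinity>k\<in>kernel \<Gamma>t (\<Gamma>n n) (\<phi>n n). conv_power \<Gamma>t star_f i k))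
      \<longlonglongrightarrow> vN_trace \<Gamma> (op_poly \<Gamma> p S)"
    unfolding S_def vN_trace_op_poly_hom_rep[OF star_f_l1]
    by (intro tendsto_sum tendsto_mult tendsto_const infsum_sets_converge[OF _ _ _ kernel_conv]
          group_l1_summable G.conv_power_l1 star_f_l1)
       (auto simp: kernel_def)
  then show ?thesis
  proof (rule Lim_transform_eventually)
    show "\<forall>\<^sub>F n in sequentially.
        (\<Sum>i\<le>degree p. of_real (coeff p i) * (\<Sum>\<^sub>\<infinity>k\<in>kernel \<Gamma>t (\<Gamma>n n) (\<phi>n n). conv_power \<Gamma>t star_f i k))
        = vN_trace (\<Gamma>n n) (op_poly (\<Gamma>n n) p (Sn n))"
      using eventually_ge_at_top[of 1]
    proof eventually_elim
      case (elim n)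
      interpret n: group_hom \<Gamma>t "\<Gamma>n n" "\<phi>n n" by (rule hom_n[OF elim])
      show ?case unfolding Sn_def n.vN_trace_op_poly_hom_rep[OF star_f_l1] ..
    qed
  qed
qed

lemma S_between: "op_between \<Gamma> S 0 M"
  unfolding M_def
  by (rule group_hom.hom_rep_square_between[OF hom f]) (simp_all add: S_def star_f_def)

lemma Sn_between: "1 \<le> n \<Longrightarrow> op_between (\<Gamma>n n) (Sn n) 0 M"
  unfolding M_def
  by (rule group_hom.hom_rep_square_between[OF hom_n f]) (simp_all add: Sn_def star_f_def)

text \<open>One polynomial approximates \<open>u\<close> on \<open>{0..M}\<close> within
  \<open>e / 3\<close>, for the limit group and for every \<open>n \<ge> 1\<close> alike; the last
  third is the convergence of its traces.\<close>

lemma trace_func_calc_tendsto: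
  assumes u: "continuous_on {0..M} u"
  shows "(\<lambda>n. Re (vN_trace (\<Gamma>n n) (func_calc (\<Gamma>n n) u (Sn n)))) \<longlonglongrightarrow> Re (vN_trace \<Gamma> (func_calc \<Gamma> u S))"
proof (rule tendstoI)
  fix e :: real assume e: "0 < e"
  then have "\<forall>\<^sub>F n in sequentially. inverse (real (Suc n)) < e / 3"
    using LIMSEQ_inverse_real_of_nat by (intro order_tendstoD) auto
  then obtain k where k: "inverse (real (Suc k)) < e / 3"
    by (auto simp: eventually_sequentially)
  obtain q :: "nat \<Rightarrow> real poly"
    where "\<And>n t. t \<in> {0..M} \<Longrightarrow> \<bar>poly (q n) t - u t\<bar> \<le> inverse (real (Suc n))"
    by (rule Weierstrass_polynomials[OF u]) blast
  then have p: "\<bar>poly (q k) t - u t\<bar> \<le> e / 3" if "t \<in> {0..M}" for t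
    using that k by (meson less_imp_le order_trans)
  interpret group_hom \<Gamma>t \<Gamma> \<phi> by (rule hom)
  have lim: "(\<lambda>n. Re (vN_trace (\<Gamma>n n) (op_poly (\<Gamma>n n) (q k) (Sn n)))) \<longlonglongrightarrow> Re (vN_trace \<Gamma> (op_poly \<Gamma> (q k) S))"
    by (intro tendsto_Re trace_op_poly_tendsto)
  have "\<forall>\<^sub>F n in sequentially. dist (Re (vN_trace (\<Gamma>n n) (op_poly (\<Gamma>n n) (q k) (Sn n))))
      (Re (vN_trace \<Gamma> (op_poly \<Gamma> (q k) S))) < e / 3"
    using e by (intro tendstoD[OF lim]) simp
  then show "\<forall>\<^sub>F n in sequentially. dist (Re (vN_trace (\<Gamma>n n) (func_calc (\<Gamma>n n) u (Sn n))))
      (Re (vN_trace \<Gamma> (func_calc \<Gamma> u S))) < e"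
    using eventually_ge_at_top[of 1]
  proof eventually_elim
    case (elim n)
    interpret n: group_hom \<Gamma>t "\<Gamma>n n" "\<phi>n n" by (rule hom_n[OF elim(2)])
    show ?case
      using elim(1) n.H.vN_trace_func_calc_poly_approx[OF Sn_between[OF elim(2)] u p]
        H.vN_trace_func_calc_poly_approx[OF S_between u p]
      unfolding dist_real_def by linarith
  qed
qed

lemma exp_fk_log_trace_tendsto:
  assumes "0 < \<epsilon>"
  shows "(\<lambda>n. exp (fk_log_trace (\<Gamma>n n) (Sn n) \<epsilon>)) \<longlonglongrightarrow> exp (fk_log_trace \<Gamma> S \<epsilon>)"
  unfolding fk_log_trace_def
  by (intro tendsto_exp trace_func_calc_tendsto continuous_on_ln_sqrt assms)

lemma fk_det_tendsto_at_right:
  "((\<lambda>\<epsilon>. exp (fk_log_trace \<Gamma> S \<epsilon>)) \<longlongrightarrow> fk_det \<Gamma> (hom_rep \<Gamma>t \<Gamma> \<phi> f)) (at_right 0)"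
proof -
  interpret group_hom \<Gamma>t \<Gamma> \<phi> by (rule hom)
  show ?thesis
    by (rule H.fk_det_tendsto(1)[OF S_between hom_rep_square[OF f]]) (simp add: S_def star_f_def)
qed

lemma fk_det_n_le:
  assumes "0 < \<epsilon>" "1 \<le> n"
  shows "fk_det (\<Gamma>n n) (hom_rep \<Gamma>t (\<Gamma>n n) (\<phi>n n) f) \<le> exp (fk_log_trace (\<Gamma>n n) (Sn n) \<epsilon>)"
proof -
  interpret n: group_hom \<Gamma>t "\<Gamma>n n" "\<phi>n n" by (rule hom_n[OF assms(2)])
  show ?thesis
    by (rule n.H.fk_det_tendsto(2)[OF Sn_between[OF assms(2)] n.hom_rep_square[OF f] assms(1)])
       (simp add: Sn_def star_f_def)
qed

lemma limsup_fk_det_le: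
  "limsup (\<lambda>n. ereal (fk_det (\<Gamma>n n) (hom_rep \<Gamma>t (\<Gamma>n n) (\<phi>n n) f)))
    \<le> ereal (fk_det \<Gamma> (hom_rep \<Gamma>t \<Gamma> \<phi> f))" (is "?L \<le> _")
proof -
  have "?L \<le> ereal (exp (fk_log_trace \<Gamma> S \<epsilon>))" if \<epsilon>: "0 < \<epsilon>" for \<epsilon>
  proof -
    have "?L \<le> limsup (\<lambda>n. ereal (exp (fk_log_trace (\<Gamma>n n) (Sn n) \<epsilon>)))"
    proof (rule Limsup_mono)
      show "\<forall>\<^sub>F n in sequentially. ereal (fk_det (\<Gamma>n n) (hom_rep \<Gamma>t (\<Gamma>n n) (\<phi>n n) f))
          \<le> ereal (exp (fk_log_trace (\<Gamma>n n) (Sn n) \<epsilon>))"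
        using eventually_ge_at_top[of 1] by eventually_elim (simp add: fk_det_n_le[OF \<epsilon>])
    qed
    also have "\<dots> = ereal (exp (fk_log_trace \<Gamma> S \<epsilon>))"
      using exp_fk_log_trace_tendsto[OF \<epsilon>] by (intro lim_imp_Limsup) auto
    finally show ?thesis .
  qed
  \<comment> \<open>The left side no longer depends on \<epsilon>, so \<epsilon> may now tend to 0
    on the right.\<close>
  then show ?thesis
    by (intro tendsto_lowerbound[OF tendsto_ereal[OF fk_det_tendsto_at_right]]
        eventually_mono[OF eventually_at_right_less]) auto
qed

lemma fk_det_tendsto_of_Units:
  assumes "f \<in> Units (l1_monoid \<Gamma>t)"
  shows "(\<lambda>n. fk_det (\<Gamma>n n) (hom_rep \<Gamma>t (\<Gamma>n n) (\<phi>n n) f)) \<longlonglongrightarrow> fk_det \<Gamma> (hom_rep \<Gamma>t \<Gamma> \<phi> f)"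
proof -
  obtain g where g: "g \<in> group_l1 \<Gamma>t" "convolution \<Gamma>t g f = unit_series \<Gamma>t"
    using assms by (auto simp: Units_def l1_monoid_def)
  define K where "K = l1_norm \<Gamma>t g + 1"
  have K: "0 < K" "l1_norm \<Gamma>t g \<le> K" by (simp_all add: K_def add_nonneg_pos)
  \<comment> \<open>Squaring \<open>|x| \<le> K |f x|\<close>, where \<open>f x\<close> is the image
    of \<open>x\<close>, gives this lower bound; the summand 1 in \<open>K\<close> allows
    division.\<close>
  define c where "c = 1 / K\<^sup>2"
  have c: "0 < c" using K by (simp add: c_def)
  have lower: "exp (- (\<epsilon> / sqrt c)) * exp (fk_log_trace (\<Gamma>n n) (Sn n) \<epsilon>)
      \<le> fk_det (\<Gamma>n n) (hom_rep \<Gamma>t (\<Gamma>n n) (\<phi>n n) f)" if n: "1 \<le> n" and \<epsilon>: "0 < \<epsilon>" for n \<epsilon>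
  proof -
    interpret n: group_hom \<Gamma>t "\<Gamma>n n" "\<phi>n n" by (rule hom_n[OF n])
    have Sn: "Sn n = hom_rep \<Gamma>t (\<Gamma>n n) (\<phi>n n) (convolution \<Gamma>t (l1_star \<Gamma>t f) f)"
      by (simp add: Sn_def star_f_def)
    have "c * (l2_norm (\<Gamma>n n) x)\<^sup>2 \<le> (l2_norm (\<Gamma>n n) (hom_rep \<Gamma>t (\<Gamma>n n) (\<phi>n n) f x))\<^sup>2"
      if x: "x \<in> group_l2 (\<Gamma>n n)" for x
    proof -
      let ?y = "l2_norm (\<Gamma>n n) (hom_rep \<Gamma>t (\<Gamma>n n) (\<phi>n n) f x)"
      have "l2_norm (\<Gamma>n n) x \<le> l1_norm \<Gamma>t g * ?y" by (rule n.hom_rep_bounded_below[OF f g x])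
      also have "\<dots> \<le> K * ?y" using K by (intro mult_right_mono) auto
      finally have "(l2_norm (\<Gamma>n n) x)\<^sup>2 \<le> (K * ?y)\<^sup>2" by (intro power_mono) auto
      then show ?thesis using K by (simp add: c_def power_mult_distrib divide_le_eq mult.commute)
    qed
    from n.hom_rep_square_between[OF f Sn this] show ?thesis
      by (rule n.H.fk_det_lower_bound[OF _ c n.hom_rep_square[OF f Sn] \<epsilon>])
  qed
  let ?L = "fk_det \<Gamma> (hom_rep \<Gamma>t \<Gamma> \<phi> f)"
  let ?D = "\<lambda>\<epsilon>. exp (fk_log_trace \<Gamma> S \<epsilon>)"
  show ?thesis
  proof (rule order_tendstoI)
    fix a assume a: "a < ?L"
    \<comment> \<open>The correction factor tends to 1, so some positive \<epsilon> keeps the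
      product above \<open>a\<close>; with it fixed, \<open>n\<close> may tend to infinity.\<close>
    have "((\<lambda>\<epsilon>. exp (- (\<epsilon> / sqrt c)) * ?D \<epsilon>) \<longlongrightarrow> exp (- (0 / sqrt c)) * ?L) (at_right 0)"
      by (intro tendsto_mult tendsto_exp tendsto_minus tendsto_divide tendsto_ident_at tendsto_const
          fk_det_tendsto_at_right) (use c in simp)
    then have "\<forall>\<^sub>F \<epsilon> in at_right 0. a < exp (- (\<epsilon> / sqrt c)) * ?D \<epsilon>"
      by (rule order_tendstoD) (use a in simp)
    then have "\<forall>\<^sub>F \<epsilon> in at_right 0. a < exp (- (\<epsilon> / sqrt c)) * ?D \<epsilon> \<and> 0 < \<epsilon>"
      using eventually_at_right_less by (rule eventually_conj)
    from eventually_happens'[OF _ this]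
    obtain \<epsilon> where \<epsilon>: "a < exp (- (\<epsilon> / sqrt c)) * ?D \<epsilon>" "0 < \<epsilon>" by auto
    have "(\<lambda>n. exp (- (\<epsilon> / sqrt c)) * exp (fk_log_trace (\<Gamma>n n) (Sn n) \<epsilon>))
        \<longlonglongrightarrow> exp (- (\<epsilon> / sqrt c)) * ?D \<epsilon>"
      by (intro tendsto_mult tendsto_const exp_fk_log_trace_tendsto \<epsilon>)
    then have "\<forall>\<^sub>F n in sequentially. a < exp (- (\<epsilon> / sqrt c)) * exp (fk_log_trace (\<Gamma>n n) (Sn n) \<epsilon>)"
      using \<epsilon>(1) by (rule order_tendstoD)
    then show "\<forall>\<^sub>F n in sequentially. a < fk_det (\<Gamma>n n) (hom_rep \<Gamma>t (\<Gamma>n n) (\<phi>n n) f)"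
      using eventually_ge_at_top[of 1]
      by eventually_elim (rule less_le_trans[OF _ lower[OF _ \<epsilon>(2)]])
  next
    fix a assume "?L < a"
    then have "\<forall>\<^sub>F \<epsilon> in at_right 0. ?D \<epsilon> < a"
      by (rule order_tendstoD[OF fk_det_tendsto_at_right])
    then have "\<forall>\<^sub>F \<epsilon> in at_right 0. ?D \<epsilon> < a \<and> 0 < \<epsilon>"
      using eventually_at_right_less by (rule eventually_conj)
    from eventually_happens'[OF _ this]
    obtain \<epsilon> where \<epsilon>: "?D \<epsilon> < a" "0 < \<epsilon>" by auto
    have "\<forall>\<^sub>F n in sequentially. exp (fk_log_trace (\<Gamma>n n) (Sn n) \<epsilon>) < a"
      using exp_fk_log_trace_tendsto[OF \<epsilon>(2)] \<epsilon>(1) by (rule order_tendstoD)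
    then show "\<forall>\<^sub>F n in sequentially. fk_det (\<Gamma>n n) (hom_rep \<Gamma>t (\<Gamma>n n) (\<phi>n n) f) < a"
      using eventually_ge_at_top[of 1]
      by eventually_elim (rule le_less_trans[OF fk_det_n_le[OF \<epsilon>(2)]])
  qed
qed

end

theorem theorem22:
  fixes \<Gamma> :: "('a, 'm) monoid_scheme"
    and \<Gamma>t :: "('b, 'k) monoid_scheme"
    and \<Gamma>n :: "nat \<Rightarrow> ('c, 'l) monoid_scheme"
    and \<phi> :: "'b \<Rightarrow> 'a"
    and \<phi>n :: "nat \<Rightarrow> 'b \<Rightarrow> 'c"
    and ft :: "'b \<Rightarrow> complex"
  assumes "group \<Gamma>" and "countable (carrier \<Gamma>)"
    and "group \<Gamma>t" and "countable (carrier \<Gamma>t)"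
    and "\<And>n. n \<ge> 1 \<Longrightarrow> group (\<Gamma>n n)" and "\<And>n. n \<ge> 1 \<Longrightarrow> countable (carrier (\<Gamma>n n))"
    and "\<phi> \<in> hom \<Gamma>t \<Gamma>"
    and "\<And>n. n \<ge> 1 \<Longrightarrow> \<phi>n n \<in> hom \<Gamma>t (\<Gamma>n n)"
    and "ft \<in> group_l1 \<Gamma>t"
    and "sets_converge_on (carrier \<Gamma>t) (\<lambda>n. kernel \<Gamma>t (\<Gamma>n n) (\<phi>n n)) (kernel \<Gamma>t \<Gamma> \<phi>)"
  shows "limsup (\<lambda>n. ereal (fk_det (\<Gamma>n n) (l1_rep (\<Gamma>n n) (push_forward \<Gamma>t (\<phi>n n) ft))))
           \<le> ereal (fk_det \<Gamma> (l1_rep \<Gamma> (push_forward \<Gamma>t \<phi> ft)))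
       \<and> (ft \<in> Units (l1_monoid \<Gamma>t) \<longrightarrow>
           (\<lambda>n. fk_det (\<Gamma>n n) (l1_rep (\<Gamma>n n) (push_forward \<Gamma>t (\<phi>n n) ft)))
             \<longlonglongrightarrow> fk_det \<Gamma> (l1_rep \<Gamma> (push_forward \<Gamma>t \<phi> ft)))"
proof -
  interpret group_hom_sequence \<Gamma>t \<Gamma> \<Gamma>n \<phi> \<phi>n ft
    using assms unfolding group_hom_sequence_def group_hom_def group_hom_axioms_def by blast
  have rep: "l1_rep \<Gamma> (push_forward \<Gamma>t \<phi> ft) = hom_rep \<Gamma>t \<Gamma> \<phi> ft"
    by (rule group_hom.l1_rep_push_forward[OF hom f])
  have rep_n: "l1_rep (\<Gamma>n n) (push_forward \<Gamma>t (\<phi>n n) ft) = hom_rep \<Gamma>t (\<Gamma>n n) (\<phi>n n) ft" if "1 \<le> n" for n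
    by (rule group_hom.l1_rep_push_forward[OF hom_n[OF that] f])
  \<comment> \<open>The identification with \<open>hom_rep\<close> is available for
    \<open>n \<ge> 1\<close>; both the limes superior and the limit depend only on the tail.\<close>
  have ev: "\<forall>\<^sub>F n in sequentially. fk_det (\<Gamma>n n) (l1_rep (\<Gamma>n n) (push_forward \<Gamma>t (\<phi>n n) ft))
      = fk_det (\<Gamma>n n) (hom_rep \<Gamma>t (\<Gamma>n n) (\<phi>n n) ft)"
    using eventually_ge_at_top[of 1] by eventually_elim (simp add: rep_n)
  then have "limsup (\<lambda>n. ereal (fk_det (\<Gamma>n n) (l1_rep (\<Gamma>n n) (push_forward \<Gamma>t (\<phi>n n) ft))))
      = limsup (\<lambda>n. ereal (fk_det (\<Gamma>n n) (hom_rep \<Gamma>t (\<Gamma>n n) (\<phi>n n) ft)))"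
    by (intro Limsup_eq) (auto elim: eventually_mono)
  moreover have "(\<lambda>n. fk_det (\<Gamma>n n) (l1_rep (\<Gamma>n n) (push_forward \<Gamma>t (\<phi>n n) ft)))
      \<longlonglongrightarrow> fk_det \<Gamma> (hom_rep \<Gamma>t \<Gamma> \<phi> ft)" if "ft \<in> Units (l1_monoid \<Gamma>t)"
    using fk_det_tendsto_of_Units[OF that] ev by (simp add: tendsto_cong)
  ultimately show ?thesis
    using limsup_fk_det_le by (simp add: rep)
qed

end
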